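(* Let $G$ be a locally compact group and $1<p<\infty$. Consider the following assertions. (i) $L^p(G)=L_p^{T}(G)$, as sets. (ii) The norms $\|\cdot\|_p$ and $|||\cdot|||_p^T$ are equivalent on $L^T_p(G)$. (iii) There exists a positive constant $K$ such that $\|f\|_p^T\leq K\|f\|_p$ for each $f\in L_p^{T}(G)$. (iv) $G$ is compact. Then (i)$\Leftrightarrow$(iv), (ii)$\Leftrightarrow$(iii), and (iv)$\Rightarrow$(iii). If moreover $G$ is unimodular and $1<p\leq 2$, then all four assertions are equivalent.
   Context: $\lambda$ is a fixed left Haar measure on $G$, and $L^p(G)$ is taken with respect to $\lambda$. For measurable $f,g$ the convolution is $f*g(x)=\int_G f(y)g(y^{-1}x)\,d\lambda(y)$; $f*g$ is said to exist if the integrand is $\lambda$-integrable in $y$ for almost all $x\in G$. For $1<p<\infty$, $L_p^T(G)$ is the set of all $f\in L^p(G)$ such that $g*f$ exists for all $g\in L^p(G)$ and $\|f\|_p^T=\sup\{\|g*f\|_p: g\in L^p(G),\ \|g\|_p\le 1\}<\infty$. A second norm on $L_p^T(G)$ is $|||f|||_p^T=\|f\|_p+\|f\|_p^T$. *)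

theory Defs
  imports "HOL-Analysis.Analysis"
begin

text \<open>
  Groups are written additively, following the library class \<^class>\<open>topological_group_add\<close>.
  That class does not assume commutativity: \<open>x + y\<close> stands for the product \<open>xy\<close>, \<open>- x\<close> for
  the inverse of \<open>x\<close>, and \<open>- y + x\<close> for \<open>y\<^sup>-\<^sup>1x\<close>.
\<close>

text \<open>
  Groups need not be sigma-compact, so Haar measures need not be sigma-finite: inner regularity
  is only required on open sets.
\<close>

definition radon_measure :: "'a::t2_space measure \<Rightarrow> bool" where
  "radon_measure \<mu> \<longleftrightarrow>
     sets \<mu> = sets borel \<and>
     (\<forall>K. compact K \<longrightarrow> emeasure \<mu> K < \<infinity>) \<and>
     (\<forall>A\<in>sets borel. emeasure \<mu> A = (INF U\<in>{U. open U \<and> A \<subseteq> U}. emeasure \<mu> U)) \<and>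
     (\<forall>U. open U \<longrightarrow> emeasure \<mu> U = (SUP K\<in>{K. compact K \<and> K \<subseteq> U}. emeasure \<mu> K))"

definition left_haar_measure :: "'a::{topological_group_add, t2_space} measure \<Rightarrow> bool" where
  "left_haar_measure \<mu> \<longleftrightarrow>
     radon_measure \<mu> \<and> emeasure \<mu> UNIV \<noteq> 0 \<and>
     (\<forall>x. \<forall>A\<in>sets borel. emeasure \<mu> ((\<lambda>y. x + y) ` A) = emeasure \<mu> A)"

definition right_haar_measure :: "'a::{topological_group_add, t2_space} measure \<Rightarrow> bool" where
  "right_haar_measure \<mu> \<longleftrightarrow>
     radon_measure \<mu> \<and> emeasure \<mu> UNIV \<noteq> 0 \<and>
     (\<forall>x. \<forall>A\<in>sets borel. emeasure \<mu> ((\<lambda>y. y + x) ` A) = emeasure \<mu> A)"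

definition unimodular :: "'a::{topological_group_add, t2_space} itself \<Rightarrow> bool" where
  "unimodular _ \<longleftrightarrow> (\<forall>\<mu>::'a measure. left_haar_measure \<mu> \<longrightarrow> right_haar_measure \<mu>)"

text \<open>
  The spaces consist of functions rather than classes modulo equality almost everywhere; all
  notions below only depend on the class of a function.
\<close>

definition Lp_space :: "'a measure \<Rightarrow> real \<Rightarrow> ('a \<Rightarrow> complex) set" where
  "Lp_space \<mu> p = {f \<in> borel_measurable \<mu>. integrable \<mu> (\<lambda>x. norm (f x) powr p)}"

definition Lp_norm :: "'a measure \<Rightarrow> real \<Rightarrow> ('a \<Rightarrow> complex) \<Rightarrow> ennreal" where
  "Lp_norm \<mu> p f =
     (if f \<in> Lp_space \<mu> p then ennreal ((\<integral>x. norm (f x) powr p \<partial>\<mu>) powr (1 / p)) else \<infinity>)"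

definition convolution ::
  "'a::group_add measure \<Rightarrow> ('a \<Rightarrow> complex) \<Rightarrow> ('a \<Rightarrow> complex) \<Rightarrow> 'a \<Rightarrow> complex" where
  "convolution \<mu> f g x = (\<integral>y. f y * g (- y + x) \<partial>\<mu>)"

definition convolution_exists ::
  "'a::group_add measure \<Rightarrow> ('a \<Rightarrow> complex) \<Rightarrow> ('a \<Rightarrow> complex) \<Rightarrow> bool" where
  "convolution_exists \<mu> f g \<longleftrightarrow> (AE x in \<mu>. integrable \<mu> (\<lambda>y. f y * g (- y + x)))"

definition LpT_norm :: "'a::group_add measure \<Rightarrow> real \<Rightarrow> ('a \<Rightarrow> complex) \<Rightarrow> ennreal" where
  "LpT_norm \<mu> p f =
     (SUP g\<in>{g \<in> Lp_space \<mu> p. Lp_norm \<mu> p g \<le> 1}. Lp_norm \<mu> p (convolution \<mu> g f))"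

definition LpT_space :: "'a::group_add measure \<Rightarrow> real \<Rightarrow> ('a \<Rightarrow> complex) set" where
  "LpT_space \<mu> p =
     {f \<in> Lp_space \<mu> p. (\<forall>g\<in>Lp_space \<mu> p. convolution_exists \<mu> g f) \<and> LpT_norm \<mu> p f < \<infinity>}"

definition LpT_sum_norm :: "'a::group_add measure \<Rightarrow> real \<Rightarrow> ('a \<Rightarrow> complex) \<Rightarrow> ennreal" where
  "LpT_sum_norm \<mu> p f = Lp_norm \<mu> p f + LpT_norm \<mu> p f"

definition equivalent_norms_on :: "'b set \<Rightarrow> ('b \<Rightarrow> ennreal) \<Rightarrow> ('b \<Rightarrow> ennreal) \<Rightarrow> bool" where
  "equivalent_norms_on S N N' \<longleftrightarrow>
     (\<exists>c C. 0 < c \<and> 0 < C \<and> (\<forall>f\<in>S. ennreal c * N f \<le> N' f \<and> N' f \<le> ennreal C * N f))"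

end

theory Submission
  imports Defs
begin

text \<open>
  Write \<open>f * g\<close> for the convolution and let \<open>f, g \<ge> 0\<close> be continuous with compact support.
  If \<open>G\<close> is compact, Jensen's inequality gives \<open>\<parallel>g * f\<parallel>\<^sub>p \<le> \<mu>(G)\<^sup>1\<^sup>-\<^sup>1\<^sup>/\<^sup>p \<parallel>g\<parallel>\<^sub>p \<parallel>f\<parallel>\<^sub>p\<close>.

  If \<open>G\<close> is not compact, no bound \<open>\<parallel>f * g\<parallel>\<^sub>p \<le> K \<parallel>f\<parallel>\<^sub>p \<parallel>g\<parallel>\<^sub>p\<close> can hold.
  Put \<open>h = f * g\<close>, \<open>H = h\<^sup>p\<close> and, for a point \<open>x\<close>,
  \<open>f' = (H * \<delta>\<^sub>x * f\<^sup>p)\<^sup>1\<^sup>/\<^sup>p\<close>, \<open>g' = (g\<^sup>p * \<delta>\<^sub>x * H)\<^sup>1\<^sup>/\<^sup>p\<close>, \<open>k = (H * \<delta>\<^sub>x * H)\<^sup>1\<^sup>/\<^sup>p\<close>.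
  By Minkowski's integral inequality both \<open>f' * g\<close> and \<open>f * g'\<close> are at least \<open>k\<close>.
  For \<open>x\<close> far away \<open>f'\<close> and \<open>g'\<close> have supports disjoint from those of \<open>f\<close> and \<open>g\<close>, so with
  \<open>F = f + t f'\<close>, \<open>G = g + t g'\<close> and \<open>s = t\<^sup>p \<parallel>h\<parallel>\<^sub>p\<^sup>p\<close> the \<open>p\<close>-th powers of the norms of \<open>f\<close> and \<open>g\<close> grow by the
  factor \<open>1 + s\<close> each, whereas that of the convolution grows by at least \<open>1 + 2\<^sup>p s\<close>, because
  \<open>F * G \<ge> h + 2 t k\<close>. For small \<open>s\<close> this exceeds \<open>(1 + s)\<^sup>2\<close>, since \<open>p > 1\<close>; iterating, the ratio of
  the norms is unbounded. A gliding hump turns this into a single \<open>f\<close> that is in \<open>L\<^sup>p\<close> but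
  not in \<open>L\<^sub>p\<^sup>T\<close>.
\<close>

section \<open>Integral inequalities\<close>

text \<open>Young's inequality for \<open>u\<close> and \<open>a powr (p - 1)\<close> with the
  conjugate exponents \<open>p\<close> and \<open>p / (p - 1)\<close> becomes, after rearranging,
  the statement that the graph of the \<open>p\<close>-th power lies above its tangent at
  \<open>a\<close>.\<close>

lemma powr_tangent_le:
  fixes u a p :: real
  assumes "0 \<le> u" "0 < a" "1 \<le> p"
  shows "a powr p + p * a powr (p - 1) * (u - a) \<le> u powr p"
proof (cases "p = 1")
  case True
  then show ?thesis using assms by simp
next
  case False
  then have p: "1 < p" using assms by simp
  define q where "q = p / (p - 1)"
  have q: "q > 1" "1 / p + 1 / q = 1" using p by (auto simp: q_def field_simps)
  have "u * a powr (p - 1) \<le> u powr p / p + (a powr (p - 1)) powr q / q"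
    using Youngs_inequality[OF p q assms(1), of "a powr (p - 1)"] by simp
  also have "(a powr (p - 1)) powr q = a powr p" using p by (simp add: powr_powr q_def)
  also have "a powr p / q = a powr p * (1 - 1 / p)" using p by (simp add: q_def field_simps)
  finally have "p * (u * a powr (p - 1)) \<le> p * (u powr p / p + a powr p * (1 - 1 / p))"
    using p by (intro mult_left_mono) auto
  also have "\<dots> = u powr p + (p - 1) * a powr p" using p by (simp add: field_simps)
  finally have "p * u * a powr (p - 1) \<le> u powr p + (p - 1) * a powr p" by simp
  moreover have "a powr (p - 1) * a = a powr p"
    using assms(2) powr_add[of a "p - 1" 1] by simp
  ultimately show ?thesis by (simp add: algebra_simps)
qed

text \<open>A fraction \<open>c / (a + b)\<close> is at most 1, so its \<open>p\<close>-th power is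
  at most the fraction itself, and the two fractions add up to 1.\<close>

lemma powr_add_le:
  fixes a b p :: real
  assumes "0 \<le> a" "0 \<le> b" "1 \<le> p"
  shows "a powr p + b powr p \<le> (a + b) powr p"
proof (cases "a + b = 0")
  case True
  then show ?thesis using assms by (simp add: add_nonneg_eq_0_iff)
next
  case False
  then have s: "a + b > 0" using assms by simp
  have *: "c powr p \<le> c / (a + b) * (a + b) powr p" if "0 \<le> c" "c \<le> a + b" for c
  proof -
    have "(c / (a + b)) powr p \<le> (c / (a + b)) powr 1"
      using that s assms by (intro powr_mono') auto
    then have "(c / (a + b)) powr p * (a + b) powr p \<le> c / (a + b) * (a + b) powr p"
      using that s by (intro mult_right_mono) auto
    then show ?thesis using that s by (simp add: powr_mult[symmetric])
  qed
  have "a powr p + b powr p \<le> a / (a + b) * (a + b) powr p + b / (a + b) * (a + b) powr p"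
    using assms by (intro add_mono *) auto
  also have "\<dots> = (a + b) powr p" using s by (metis add_divide_distrib distrib_right divide_self less_irrefl mult_1)
  finally show ?thesis .
qed

text \<open>The domination by which integrability of a \<open>p\<close>-th power yields
  integrability against a finite weight.\<close>

lemma le_one_plus_powr:
  fixes u p :: real
  assumes "0 \<le> u" "1 \<le> p"
  shows "u \<le> 1 + u powr p"
proof (cases "u \<le> 1")
  case False
  then have "u powr 1 \<le> u powr p" using assms by (intro powr_mono) auto
  then show ?thesis using False by simp
qed (use powr_ge_zero[of u p] in linarith)

text \<open>Jensen's inequality for the measure with density \<open>v\<close>, not normalised. The
  tangent inequality at the weighted mean of \<open>u\<close> is integrated against
  \<open>v\<close>, and its linear term drops out.\<close>

lemma jensen_weighted:
  fixes u v :: "'a \<Rightarrow> real"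
  assumes [measurable]: "u \<in> borel_measurable M" "v \<in> borel_measurable M"
    and nonneg: "\<And>x. 0 \<le> u x" "\<And>x. 0 \<le> v x" and p: "1 \<le> p"
    and v: "integrable M v" and uv: "integrable M (\<lambda>x. u x powr p * v x)"
  shows "integrable M (\<lambda>x. u x * v x)"
    and "(\<integral>x. u x * v x \<partial>M) powr p \<le> (\<integral>x. v x \<partial>M) powr (p - 1) * (\<integral>x. u x powr p * v x \<partial>M)"
proof -
  show int: "integrable M (\<lambda>x. u x * v x)"
  proof (rule Bochner_Integration.integrable_bound)
    show "integrable M (\<lambda>x. v x + u x powr p * v x)" using v uv by simp
    show "AE x in M. norm (u x * v x) \<le> norm (v x + u x powr p * v x)"
    proof (intro AE_I2)
      fix x
      have "u x * v x \<le> (1 + u x powr p) * v x"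
        using le_one_plus_powr[of "u x" p] nonneg p by (intro mult_right_mono) auto
      then show "norm (u x * v x) \<le> norm (v x + u x powr p * v x)"
        using nonneg by (simp add: algebra_simps)
    qed
  qed simp
  define V where "V = (\<integral>x. v x \<partial>M)"
  \<comment> \<open>The weighted mean of \<open>u\<close>. Since division by zero gives 0, the case
    \<open>V = 0\<close> falls under \<open>A = 0\<close>, and the other case has both
    \<open>A\<close> and \<open>V\<close> positive.\<close>
  define A where "A = (\<integral>x. u x * v x \<partial>M) / V"
  have V0: "0 \<le> V" unfolding V_def using nonneg by simp
  have R0: "0 \<le> (\<integral>x. u x powr p * v x \<partial>M)" using nonneg by simp
  have A0: "0 \<le> A" unfolding A_def using V0 nonneg by simp
  show "(\<integral>x. u x * v x \<partial>M) powr p \<le> (\<integral>x. v x \<partial>M) powr (p - 1) * (\<integral>x. u x powr p * v x \<partial>M)"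
  proof (cases "A = 0")
    case True
    have "(\<integral>x. u x * v x \<partial>M) = 0"
    proof (cases "V = 0")
      case V: True
      have "AE x in M. v x = 0"
        using V integral_nonneg_eq_0_iff_AE[OF v] nonneg by (simp add: V_def)
      then have "(\<integral>x. u x * v x \<partial>M) = (\<integral>x. 0 \<partial>M)"
        by (intro integral_cong_AE) auto
      then show ?thesis by simp
    next
      case False
      then show ?thesis using True by (simp add: A_def)
    qed
    then show ?thesis using R0 by simp
  next
    case False
    then have A: "A > 0" and V: "V > 0" using A0 V0 by (auto simp: A_def less_le)
    have "(\<integral>x. A powr p * v x + p * A powr (p - 1) * (u x * v x - A * v x) \<partial>M)
        \<le> (\<integral>x. u x powr p * v x \<partial>M)"
    proof (rule integral_mono)
      show "integrable M (\<lambda>x. A powr p * v x + p * A powr (p - 1) * (u x * v x - A * v x))"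
        using v int by simp
      fix x
      have "(A powr p + p * A powr (p - 1) * (u x - A)) * v x \<le> u x powr p * v x"
        using powr_tangent_le[OF nonneg(1) A p] nonneg by (intro mult_right_mono) auto
      then show "A powr p * v x + p * A powr (p - 1) * (u x * v x - A * v x) \<le> u x powr p * v x"
        by (simp add: algebra_simps)
    qed (rule uv)
    also have "(\<integral>x. A powr p * v x + p * A powr (p - 1) * (u x * v x - A * v x) \<partial>M)
        = A powr p * V + p * A powr (p - 1) * ((\<integral>x. u x * v x \<partial>M) - A * V)"
      using v int by (simp add: V_def)
    also have "\<dots> = A powr p * V" using V by (simp add: A_def)
    finally have "V powr (p - 1) * (A powr p * V) \<le> V powr (p - 1) * (\<integral>x. u x powr p * v x \<partial>M)"
      by (intro mult_left_mono) auto
    moreover have "V powr (p - 1) * (A powr p * V) = (A * V) powr p"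
      using V A powr_add[of V "p - 1" 1] by (simp add: powr_mult)
    moreover have "A * V = (\<integral>x. u x * v x \<partial>M)" using V by (simp add: A_def)
    ultimately show ?thesis by (simp add: V_def)
  qed
qed

text \<open>Obtained from Jensen instead of duality. Let \<open>T w\<close> be the L^p norm of the
  slice at \<open>w\<close> and \<tau> its integral. Jensen with weight \<open>T\<close> bounds the
  \<open>p\<close>-th power of the inner integral by \<tau>^(p-1) times the integral of \<Phi>^p
  T^(1-p); integrating over \<open>y\<close> and exchanging the order turns the last integral into
  \<tau>. Finite measures and a bounded kernel supply all integrability.\<close>

lemma integral_Minkowski:
  fixes \<Phi> :: "'a \<Rightarrow> 'b \<Rightarrow> real"
  assumes M: "finite_measure M" and N: "finite_measure N" and p: "1 \<le> p"
    and [measurable]: "case_prod \<Phi> \<in> borel_measurable (M \<Otimes>\<^sub>M N)"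
    and nonneg: "\<And>y w. 0 \<le> \<Phi> y w" and bound: "\<And>y w. \<Phi> y w \<le> B"
  shows "(\<integral>y. (\<integral>w. \<Phi> y w \<partial>N) powr p \<partial>M) powr (1 / p) \<le> (\<integral>w. (\<integral>y. \<Phi> y w powr p \<partial>M) powr (1 / p) \<partial>N)"
proof -
  interpret M: finite_measure M by fact
  interpret N: finite_measure N by fact
  interpret P: pair_sigma_finite M N ..
  interpret P: finite_measure "M \<Otimes>\<^sub>M N" by (rule finite_measure_pair_measure) (fact M N)+
  have B: "0 \<le> B" using nonneg bound order_trans by blast
  define T where "T w = (\<integral>y. \<Phi> y w powr p \<partial>M) powr (1 / p)" for w
  have [measurable]: "T \<in> borel_measurable N" unfolding T_def by measurable
  have T0: "0 \<le> T w" for w by (simp add: T_def)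
  have Tp: "T w powr p = (\<integral>y. \<Phi> y w powr p \<partial>M)" for w
    using p nonneg by (simp add: T_def powr_powr)
  have Phi_p: "\<Phi> y w powr p \<le> B powr p" for y w
    using nonneg bound p by (intro powr_mono2) auto
  define D where "D = (B powr p * measure M (space M)) powr (1 / p)"
  have intPhi: "integrable M (\<lambda>y. \<Phi> y w powr p)" if "w \<in> space N" for w
    using that by (intro M.integrable_const_bound[where B = "B powr p"]) (auto simp: Phi_p)
  have TB: "T w \<le> D" if "w \<in> space N" for w
    unfolding T_def D_def
  proof (intro powr_mono2)
    have "(\<integral>y. \<Phi> y w powr p \<partial>M) \<le> (\<integral>y. B powr p \<partial>M)"
      using that by (intro integral_mono intPhi) (auto simp: Phi_p)
    then show "(\<integral>y. \<Phi> y w powr p \<partial>M) \<le> B powr p * measure M (space M)"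
      by (simp add: mult.commute)
  qed (use p in auto)
  have intT: "integrable N T"
    by (intro N.integrable_const_bound[where B = D]) (auto simp: TB T0 intro!: AE_I2)
  define \<tau> where "\<tau> = (\<integral>w. T w \<partial>N)"
  have \<tau>0: "0 \<le> \<tau>" unfolding \<tau>_def by (simp add: T0)
  \<comment> \<open>Jensen with weight \<open>T\<close>, shifted by \<open>e\<close> because \<open>T\<close> may vanish\<close>
  have S: "(\<integral>w. \<Phi> y w \<partial>N) powr p \<le> (\<integral>w. T w + e \<partial>N) powr (p - 1) * (\<integral>w. (\<Phi> y w / (T w + e)) powr p * (T w + e) \<partial>N)"
    if e: "0 < e" and y: "y \<in> space M" for e y
  proof -
    have pos: "T w + e > 0" for w using T0[of w] e by simp
    have 1: "(\<integral>w. \<Phi> y w \<partial>N) = (\<integral>w. \<Phi> y w / (T w + e) * (T w + e) \<partial>N)"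
      using pos by (simp add: less_imp_neq[THEN not_sym])
    show ?thesis unfolding 1
    proof (rule jensen_weighted(2))
      show "integrable N (\<lambda>w. (\<Phi> y w / (T w + e)) powr p * (T w + e))"
      proof (rule N.integrable_const_bound[where B = "(B / e) powr p * (D + e)"])
        show "AE w in N. norm ((\<Phi> y w / (T w + e)) powr p * (T w + e)) \<le> (B / e) powr p * (D + e)"
        proof (rule AE_I2)
          fix w assume w: "w \<in> space N"
          have "\<Phi> y w / (T w + e) \<le> B / e"
            using e T0[of w] nonneg bound B by (intro frac_le) auto
          then have "(\<Phi> y w / (T w + e)) powr p \<le> (B / e) powr p"
            using p nonneg pos by (intro powr_mono2) (auto simp: less_imp_le)
          then show "norm ((\<Phi> y w / (T w + e)) powr p * (T w + e)) \<le> (B / e) powr p * (D + e)"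
            using TB[OF w] pos[of w] by (auto simp: abs_mult intro!: mult_mono)
        qed
      qed (use y in measurable)
    qed (use y pos p nonneg intT in \<open>auto simp: less_imp_le\<close>)
  qed
  define I where "I = (\<integral>y. (\<integral>w. \<Phi> y w \<partial>N) powr p \<partial>M)"
  have I: "I \<le> (\<tau> + e * measure N (space N)) powr (p - 1) * \<tau>" if e: "0 < e" for e
  proof -
    have pos: "T w + e > 0" for w using T0[of w] e by simp
    \<comment> \<open>The integrand of Jensen's bound with the powers of \<open>T w + e\<close>
      collected, so that its integral over \<open>y\<close> is
      \<open>T w powr p * (T w + e) powr (1 - p)\<close>. As \<open>1 - p\<close> is not positive,
      \<open>e powr (1 - p)\<close> bounds the second factor.\<close>
    define \<Psi> where "\<Psi> y w = \<Phi> y w powr p * (T w + e) powr (1 - p)" for y w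
    have \<Psi>: "(\<Phi> y w / (T w + e)) powr p * (T w + e) = \<Psi> y w" for y w
      using pos[of w] nonneg[of y w] powr_add[of "T w + e" "-p" 1]
      by (simp add: \<Psi>_def powr_divide powr_minus divide_simps)
    have [measurable]: "case_prod \<Psi> \<in> borel_measurable (M \<Otimes>\<^sub>M N)" unfolding \<Psi>_def by measurable
    have \<Psi>0: "0 \<le> \<Psi> y w" for y w by (simp add: \<Psi>_def)
    have \<Psi>B: "\<Psi> y w \<le> B powr p * e powr (1 - p)" for y w
      unfolding \<Psi>_def using e p T0[of w] by (intro mult_mono Phi_p powr_mono2') auto
    have int\<Psi>: "integrable (M \<Otimes>\<^sub>M N) (case_prod \<Psi>)"
      by (rule P.integrable_const_bound[where B = "B powr p * e powr (1 - p)"]) (auto simp: \<Psi>0 \<Psi>B)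
    have "I \<le> (\<integral>y. (\<integral>w. T w + e \<partial>N) powr (p - 1) * (\<integral>w. \<Psi> y w \<partial>N) \<partial>M)"
      unfolding I_def
    proof (rule integral_mono_AE)
      have "0 \<le> (\<integral>w. \<Phi> y w \<partial>N)" "(\<integral>w. \<Phi> y w \<partial>N) \<le> B * measure N (space N)" if "y \<in> space M" for y
      proof -
        show "0 \<le> (\<integral>w. \<Phi> y w \<partial>N)" using nonneg by simp
        have "(\<integral>w. \<Phi> y w \<partial>N) \<le> (\<integral>w. B \<partial>N)" 
          using that nonneg bound by (intro integral_mono N.integrable_const_bound[where B = B]) (auto simp: B)
        then show "(\<integral>w. \<Phi> y w \<partial>N) \<le> B * measure N (space N)" by (simp add: mult.commute)
      qed
      then show "integrable M (\<lambda>y. (\<integral>w. \<Phi> y w \<partial>N) powr p)"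
        using p by (intro M.integrable_const_bound[where B = "(B * measure N (space N)) powr p"])
          (auto intro!: AE_I2 powr_mono2)
      show "integrable M (\<lambda>y. (\<integral>w. T w + e \<partial>N) powr (p - 1) * (\<integral>w. \<Psi> y w \<partial>N))"
        using P.integrable_fst[OF int\<Psi>] by simp
      show "AE y in M. (\<integral>w. \<Phi> y w \<partial>N) powr p \<le> (\<integral>w. T w + e \<partial>N) powr (p - 1) * (\<integral>w. \<Psi> y w \<partial>N)"
        using S[OF e] by (simp add: \<Psi>)
    qed
    also have "\<dots> = (\<tau> + e * measure N (space N)) powr (p - 1) * (\<integral>y. (\<integral>w. \<Psi> y w \<partial>N) \<partial>M)"
      using intT by (simp add: \<tau>_def mult.commute)
    also have "(\<integral>y. (\<integral>w. \<Psi> y w \<partial>N) \<partial>M) = (\<integral>w. (\<integral>y. \<Psi> y w \<partial>M) \<partial>N)"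
      by (rule P.Fubini_integral[symmetric]) (use int\<Psi> in simp)
    also have "\<dots> \<le> \<tau>" unfolding \<tau>_def
    proof (rule integral_mono)
      show "integrable N (\<lambda>w. \<integral>y. \<Psi> y w \<partial>M)" using P.integrable_snd[OF int\<Psi>] by simp
      fix w
      have "(\<integral>y. \<Psi> y w \<partial>M) = T w powr p * (T w + e) powr (1 - p)"
        by (simp add: \<Psi>_def Tp)
      \<comment> \<open>The exponent \<open>1 - p\<close> is not positive, so removing
        \<open>e\<close> from the base only enlarges the factor.\<close>
      also have "\<dots> \<le> T w"
      proof (cases "T w = 0")
        case False
        then have Tw: "T w > 0" using T0[of w] by simp
        have "T w powr p * (T w + e) powr (1 - p) \<le> T w powr p * T w powr (1 - p)"
          using Tw e p by (intro mult_left_mono powr_mono2') auto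
        also have "\<dots> = T w" using Tw powr_add[of "T w" p "1 - p"] by simp
        finally show ?thesis .
      qed (use p in simp)
      finally show "(\<integral>y. \<Psi> y w \<partial>M) \<le> T w" .
    qed (rule intT)
    finally show ?thesis by (simp add: mult_left_mono)
  qed
  \<comment> \<open>If \<tau> is 0, the factor \<tau> makes the bound vanish already for
    \<open>e = 1\<close>. Otherwise the base stays away from 0 and \<open>e\<close> may tend to
    0.\<close>
  have "I \<le> \<tau> powr p"
  proof (cases "\<tau> = 0")
    case True
    then show ?thesis using I[of 1] by simp
  next
    case False
    then have \<tau>: "\<tau> > 0" using \<tau>0 by simp
    have "((\<lambda>e. (\<tau> + e * measure N (space N)) powr (p - 1) * \<tau>) \<longlongrightarrow> (\<tau> + 0 * measure N (space N)) powr (p - 1) * \<tau>) (at_right 0)"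
      using \<tau> by (intro tendsto_intros) auto
    moreover have "eventually (\<lambda>e. I \<le> (\<tau> + e * measure N (space N)) powr (p - 1) * \<tau>) (at_right (0::real))"
      using I by (auto simp: eventually_at_right_less intro: eventually_mono[OF eventually_at_right_less])
    ultimately have "I \<le> \<tau> powr (p - 1) * \<tau>"
      using tendsto_lowerbound[of _ _ "at_right (0::real)" I] by simp
    also have "\<dots> = \<tau> powr p" using \<tau> powr_add[of \<tau> "p - 1" 1] by simp
    finally show ?thesis .
  qed
  then have "I powr (1 / p) \<le> (\<tau> powr p) powr (1 / p)"
    using p by (intro powr_mono2) (auto simp: I_def)
  also have "\<dots> = \<tau>" using \<tau>0 p by (simp add: powr_powr)
  finally show ?thesis by (simp add: I_def \<tau>_def T_def)
qed

section \<open>Measurability and continuity of kernels on spaces without a countable base\<close>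

text \<open>Without countable bases a continuous function of two variables need not be measurable
  for the product of the Borel algebras. On a compact rectangle it is: there the set where \<Phi> is
  at least \<open>q + 1 / real (Suc n)\<close> is compact, hence covered by finitely many open
  rectangles on which \<Phi> exceeds \<open>q\<close>, and over all \<open>n\<close> these finite
  unions exhaust the superlevel set.\<close>

lemma borel_measurable_restrict_compact_Times:
  fixes \<Phi> :: "'a::topological_space \<Rightarrow> 'b::topological_space \<Rightarrow> real"
  assumes cont: "continuous_on UNIV (\<lambda>(x, y). \<Phi> x y)" and X: "compact X" and L: "compact L"
    and [measurable]: "X \<in> sets borel" "L \<in> sets borel"
  shows "(\<lambda>(x, y). indicator X x * indicator L y * \<Phi> x y) \<in> borel_measurable (borel \<Otimes>\<^sub>M borel)"
proof -
  define O' where "O' q = {p. case_prod \<Phi> p > q}" for q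
  have opn: "open (O' q)" for q
    using cont unfolding O'_def by (intro open_Collect_less) (auto simp: case_prod_unfold)
  have sets: "O' q \<inter> X \<times> L \<in> sets (borel \<Otimes>\<^sub>M borel)" for q
  proof -
    define C where "C n = {p. case_prod \<Phi> p \<ge> q + 1 / real (Suc n)} \<inter> (X \<times> L)" for n :: nat
    have cpt: "compact (C n)" for n
      unfolding C_def using X L cont
      by (intro closed_Int_compact closed_Collect_le compact_Times) (auto simp: case_prod_unfold)
    have "\<exists>R\<in>sets (borel \<Otimes>\<^sub>M borel). C n \<subseteq> R \<and> R \<subseteq> O' q" for n
    proof -
      have "\<exists>A B. open A \<and> open B \<and> z \<in> A \<times> B \<and> A \<times> B \<subseteq> O' q" if "z \<in> C n" for z
      proof -
        have "0 < 1 / real (Suc n)" by simp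
        moreover have "q + 1 / real (Suc n) \<le> case_prod \<Phi> z" using that by (simp add: C_def)
        ultimately have "z \<in> O' q" unfolding O'_def mem_Collect_eq by linarith
        then show ?thesis using opn[of q] by (metis open_prod_elim)
      qed
      then obtain A B where AB: "\<And>z. z \<in> C n \<Longrightarrow> open (A z) \<and> open (B z) \<and> z \<in> A z \<times> B z \<and> A z \<times> B z \<subseteq> O' q"
        by metis
      obtain D where D: "D \<subseteq> C n" "finite D" "C n \<subseteq> (\<Union>z\<in>D. A z \<times> B z)"
        
      proof (rule compactE_image[OF cpt, of "C n" "\<lambda>z. A z \<times> B z"])
        show "C n \<subseteq> (\<Union>z\<in>C n. A z \<times> B z)" using AB by blast
      qed (use AB open_Times in blast)+
      have "(\<Union>z\<in>D. A z \<times> B z) \<in> sets (borel \<Otimes>\<^sub>M borel)"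
        using D AB by (intro sets.finite_UN pair_measureI) auto
      then show ?thesis using D AB by (intro bexI[of _ "\<Union>z\<in>D. A z \<times> B z"]) blast+
    qed
    then obtain R where R: "\<And>n. R n \<in> sets (borel \<Otimes>\<^sub>M borel)" "\<And>n. C n \<subseteq> R n" "\<And>n. R n \<subseteq> O' q"
      by metis
    have "O' q \<inter> X \<times> L = (\<Union>n. R n) \<inter> X \<times> L"
    proof (intro equalityI subsetI)
      fix z assume z: "z \<in> O' q \<inter> X \<times> L"
      then have "0 < case_prod \<Phi> z - q" by (simp add: O'_def)
      then obtain n where "1 / real (Suc n) < case_prod \<Phi> z - q" using nat_approx_posE by blast
      then have "z \<in> C n" using z by (auto simp: C_def)
      then show "z \<in> (\<Union>n. R n) \<inter> X \<times> L" using R z by blast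
    qed (use R in blast)
    moreover have "(\<Union>n. R n) \<inter> X \<times> L \<in> sets (borel \<Otimes>\<^sub>M borel)"
      using R(1) by (intro sets.Int sets.countable_UN pair_measureI) auto
    ultimately show ?thesis by simp
  qed
  have ind: "indicator X x * indicator L y * r = (if x \<in> X \<and> y \<in> L then r else 0)" for x y and r :: real
    by (simp add: indicator_def)
  \<comment> \<open>Off the rectangle the function is 0, so for negative \<open>q\<close> the
    complement of the rectangle belongs to the superlevel set.\<close>
  have "{z \<in> space (borel \<Otimes>\<^sub>M borel). (case z of (x, y) \<Rightarrow> indicator X x * indicator L y * \<Phi> x y) > q}
      = (if q < 0 then (O' q \<inter> X \<times> L) \<union> (UNIV - X \<times> L) else O' q \<inter> X \<times> L)" for q
    by (cases "q < 0") (auto simp: O'_def space_pair_measure ind split: if_splits)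
  moreover have "UNIV - X \<times> L \<in> sets (borel \<Otimes>\<^sub>M borel)"
    using sets.compl_sets[of "X \<times> L" "borel \<Otimes>\<^sub>M borel"] by (simp add: space_pair_measure pair_measureI)
  ultimately show ?thesis
    using sets by (intro borel_measurableI_greater) (simp only: sets.Un split: if_split, blast)
qed

text \<open>The space need not be first countable, so dominated convergence along sequences is
  replaced by the tube lemma: some neighbourhood of \<open>x0\<close> has \<open>\<Phi> x\<close>
  close to \<open>\<Phi> x0\<close> uniformly on the compact set \<open>L\<close>, and
  \<open>g\<close> is integrable and lives on \<open>L\<close>.\<close>

lemma continuous_on_integral_compact:
  fixes \<Phi> :: "'a::t2_space \<Rightarrow> 'b::topological_space \<Rightarrow> real" and g :: "'b \<Rightarrow> 'c::{banach, second_countable_topology}"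
  assumes cont: "continuous_on UNIV (\<lambda>(x, y). \<Phi> x y)" and L: "compact L"
    and [measurable_cong]: "sets M = sets borel"
    and g: "integrable M g" and supp: "\<And>y. y \<notin> L \<Longrightarrow> g y = 0"
  shows "continuous_on UNIV (\<lambda>x. \<integral>y. \<Phi> x y *\<^sub>R g y \<partial>M)"
proof -
  have cont_x: "continuous_on UNIV (\<Phi> x)" for x
    by (intro continuous_on_compose2[OF cont, of _ "\<lambda>y. (x, y)", simplified] continuous_intros)
  then have [measurable]: "\<Phi> x \<in> borel_measurable borel" for x
    by (rule borel_measurable_continuous_onI)
  have [measurable]: "g \<in> borel_measurable M" using g by auto
  have int: "integrable M (\<lambda>y. \<Phi> x y *\<^sub>R g y)" for x
  proof -
    have "compact (\<Phi> x ` L)"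
      using continuous_on_subset[OF cont_x] L by (intro compact_continuous_image) auto
    then obtain b where b: "\<And>y. y \<in> L \<Longrightarrow> \<bar>\<Phi> x y\<bar> \<le> b"
      by (meson compact_imp_bounded bounded_real imageI)
    show ?thesis
    proof (rule Bochner_Integration.integrable_bound)
      show "integrable M (\<lambda>y. b *\<^sub>R g y)" using g by simp
      show "AE y in M. norm (\<Phi> x y *\<^sub>R g y) \<le> norm (b *\<^sub>R g y)"
      proof (rule AE_I2)
        fix y
        have "\<bar>\<Phi> x y\<bar> * norm (g y) \<le> \<bar>b\<bar> * norm (g y)" if "y \<in> L"
          using b[OF that] by (intro mult_right_mono) auto
        then show "norm (\<Phi> x y *\<^sub>R g y) \<le> norm (b *\<^sub>R g y)"
          using supp[of y] by (cases "y \<in> L") auto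
      qed
    qed measurable
  qed
  have "isCont (\<lambda>x. \<integral>y. \<Phi> x y *\<^sub>R g y \<partial>M) x0" for x0
    unfolding isCont_def
  proof (rule tendstoI)
    fix e :: real assume e: "0 < e"
    define G where "G = (\<integral>y. norm (g y) \<partial>M)"
    have G0: "0 \<le> G" by (simp add: G_def)
    \<comment> \<open>The summand 1 keeps the denominator positive when \<open>G = 0\<close> and
      makes \<open>d * G < e\<close> strict.\<close>
    define d where "d = e / (G + 1)"
    have d: "d > 0" using e G0 by (simp add: d_def)
    define W where "W = {z. \<bar>case_prod \<Phi> z - \<Phi> x0 (snd z)\<bar> < d}"
    have "open W" unfolding W_def
      using cont by (intro open_Collect_less continuous_intros continuous_on_compose2[OF cont, of _ "\<lambda>z. (x0, snd z)", simplified])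
        (auto simp: case_prod_unfold)
    moreover have "{x0} \<times> L \<subseteq> W" using d by (auto simp: W_def)
    ultimately obtain X0 where X0: "x0 \<in> X0" "open X0" "X0 \<times> L \<subseteq> W"
      using Elementary_Topology.tube_lemma[OF L] by metis
    have "dist (\<integral>y. \<Phi> x y *\<^sub>R g y \<partial>M) (\<integral>y. \<Phi> x0 y *\<^sub>R g y \<partial>M) < e" if x: "x \<in> X0" for x
    proof -
      have "dist (\<integral>y. \<Phi> x y *\<^sub>R g y \<partial>M) (\<integral>y. \<Phi> x0 y *\<^sub>R g y \<partial>M) = norm (\<integral>y. (\<Phi> x y - \<Phi> x0 y) *\<^sub>R g y \<partial>M)"
        using int by (simp add: dist_norm scaleR_diff_left)
      also have "\<dots> \<le> (\<integral>y. norm ((\<Phi> x y - \<Phi> x0 y) *\<^sub>R g y) \<partial>M)" by (rule integral_norm_bound)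
      also have "\<dots> \<le> (\<integral>y. d * norm (g y) \<partial>M)"
      proof (rule integral_mono)
        show "integrable M (\<lambda>y. norm ((\<Phi> x y - \<Phi> x0 y) *\<^sub>R g y))"
          using int[of x] int[of x0] by (intro integrable_norm) (simp add: scaleR_diff_left)
        fix y
        have "\<bar>\<Phi> x y - \<Phi> x0 y\<bar> \<le> d" if "y \<in> L" using X0 x that by (force simp: W_def)
        then show "norm ((\<Phi> x y - \<Phi> x0 y) *\<^sub>R g y) \<le> d * norm (g y)"
          using supp[of y] by (cases "y \<in> L") (auto intro: mult_right_mono)
      qed (use g in simp)
      also have "\<dots> = d * G" by (simp add: G_def)
      also have "\<dots> < e" using G0 e by (simp add: d_def field_simps)
      finally show ?thesis .
    qed
    then show "\<forall>\<^sub>F x in at x0. dist (\<integral>y. \<Phi> x y *\<^sub>R g y \<partial>M) (\<integral>y. \<Phi> x0 y *\<^sub>R g y \<partial>M) < e"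
      using X0 eventually_at_topological by blast
  qed
  then show ?thesis by (simp add: continuous_at_imp_continuous_on)
qed

section \<open>L^p norms and norms of convolution operators\<close>

lemma Lp_norm_eq:
  "f \<in> Lp_space M p \<Longrightarrow> Lp_norm M p f = ennreal ((\<integral>x. norm (f x) powr p \<partial>M) powr (1 / p))"
  by (simp add: Lp_norm_def)

lemma Lp_norm_le_iff:
  assumes "0 < p" "0 \<le> B"
  shows "Lp_norm M p f \<le> ennreal B \<longleftrightarrow> f \<in> Lp_space M p \<and> (\<integral>x. norm (f x) powr p \<partial>M) \<le> B powr p"
proof (cases "f \<in> Lp_space M p")
  case True
  define I where "I = (\<integral>x. norm (f x) powr p \<partial>M)"
  have I: "0 \<le> I" by (simp add: I_def)
  have "I powr (1 / p) \<le> B \<longleftrightarrow> I \<le> B powr p"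
  proof
    assume "I powr (1 / p) \<le> B"
    then have "(I powr (1 / p)) powr p \<le> B powr p" using assms by (intro powr_mono2) auto
    then show "I \<le> B powr p" using I assms by (simp add: powr_powr)
  next
    assume "I \<le> B powr p"
    then have "I powr (1 / p) \<le> (B powr p) powr (1 / p)" using I assms by (intro powr_mono2) auto
    then show "I powr (1 / p) \<le> B" using assms by (simp add: powr_powr)
  qed
  then show ?thesis using True assms by (simp add: Lp_norm_eq I_def)
qed (simp add: Lp_norm_def top_unique)

text \<open>Convolution estimates come as bounds between integrals of \<open>p\<close>-th powers;
  the root is taken once, here.\<close>

lemma LpT_norm_leI:
  assumes p: "0 < p" and C: "0 \<le> C"
    and "\<And>g. g \<in> Lp_space \<mu> p \<Longrightarrow> convolution \<mu> g f \<in> Lp_space \<mu> p"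
    and le: "\<And>g. g \<in> Lp_space \<mu> p \<Longrightarrow>
      (\<integral>x. norm (convolution \<mu> g f x) powr p \<partial>\<mu>) \<le> C * (\<integral>x. norm (g x) powr p \<partial>\<mu>)"
  shows "LpT_norm \<mu> p f \<le> ennreal (C powr (1 / p))"
  unfolding LpT_norm_def
proof (rule SUP_least)
  fix g assume "g \<in> {g \<in> Lp_space \<mu> p. Lp_norm \<mu> p g \<le> 1}"
  then have g: "g \<in> Lp_space \<mu> p" "Lp_norm \<mu> p g \<le> ennreal 1" by auto
  then have "(\<integral>x. norm (g x) powr p \<partial>\<mu>) \<le> 1"
    using p by (subst (asm) Lp_norm_le_iff) auto
  then have "(\<integral>x. norm (convolution \<mu> g f x) powr p \<partial>\<mu>) \<le> C * 1"
    using C by (intro order_trans[OF le[OF g(1)]] mult_left_mono)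
  then show "Lp_norm \<mu> p (convolution \<mu> g f) \<le> ennreal (C powr (1 / p))"
    using p C assms(3)[OF g(1)] by (subst Lp_norm_le_iff) (auto simp: powr_powr)
qed

lemma convolution_cmult: "convolution \<mu> (\<lambda>x. c * g x) f x = c * convolution \<mu> g f x"
  unfolding convolution_def mult.assoc by simp

section \<open>Haar measure and functions with compact support\<close>

locale left_haar_space =
  fixes \<mu> :: "'a::{topological_group_add, t2_space} measure"
  assumes locally_compact: "locally_compact_space (euclidean :: 'a topology)"
    and haar: "left_haar_measure \<mu>"
begin

lemma sets_mu [measurable_cong, simp]: "sets \<mu> = sets borel"
  using haar by (simp add: left_haar_measure_def radon_measure_def)

lemma space_mu [simp]: "space \<mu> = UNIV"
  using sets_eq_imp_space_eq[OF sets_mu] by simp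

lemma emeasure_compact_finite: "compact K \<Longrightarrow> emeasure \<mu> K < \<infinity>"
  using haar by (simp add: left_haar_measure_def radon_measure_def)

lemma outer_regular:
  "A \<in> sets borel \<Longrightarrow> emeasure \<mu> A = (INF U\<in>{U. open U \<and> A \<subseteq> U}. emeasure \<mu> U)"
  using haar unfolding left_haar_measure_def radon_measure_def by blast

lemma inner_regular:
  "open U \<Longrightarrow> emeasure \<mu> U = (SUP K\<in>{K. compact K \<and> K \<subseteq> U}. emeasure \<mu> K)"
  using haar unfolding left_haar_measure_def radon_measure_def by blast

lemma translate_measurable [measurable]: "(+) a \<in> borel \<rightarrow>\<^sub>M (borel :: 'a measure)"
  by (intro borel_measurable_continuous_onI continuous_intros)

text \<open>Left invariance as an equality of image measures, the form in which change of variables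
  applies to integrals.\<close>

lemma distr_translate: "distr \<mu> \<mu> ((+) a) = \<mu>"
proof (rule measure_eqI)
  fix A assume "A \<in> sets (distr \<mu> \<mu> ((+) a))"
  then have A: "A \<in> sets borel" by simp
  have "(+) a -` A = (+) (- a) ` A"
  proof (intro equalityI subsetI)
    fix x assume "x \<in> (+) a -` A"
    then have "a + x \<in> A" by simp
    then have "- a + (a + x) \<in> (+) (- a) ` A" by blast
    then show "x \<in> (+) (- a) ` A" by (simp add: add.assoc[symmetric])
  qed (auto simp: add.assoc[symmetric])
  moreover have "(+) a \<in> \<mu> \<rightarrow>\<^sub>M \<mu>" by (simp cong: measurable_cong_sets)
  ultimately have "emeasure (distr \<mu> \<mu> ((+) a)) A = emeasure \<mu> ((+) (- a) ` A)"
    using A by (simp add: emeasure_distr)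
  also have "\<dots> = emeasure \<mu> A"
    using haar A unfolding left_haar_measure_def by blast
  finally show "emeasure (distr \<mu> \<mu> ((+) a)) A = emeasure \<mu> A" .
qed simp

lemma nn_integral_translate:
  assumes [measurable]: "f \<in> borel_measurable borel"
  shows "(\<integral>\<^sup>+x. f (a + x) \<partial>\<mu>) = (\<integral>\<^sup>+x. f x \<partial>\<mu>)"
  using nn_integral_distr[of "(+) a" \<mu> \<mu> f] by (simp add: distr_translate cong: measurable_cong_sets)

lemma integral_translate:
  fixes f :: "'a \<Rightarrow> 'b::{banach, second_countable_topology}"
  assumes [measurable]: "f \<in> borel_measurable borel"
  shows "(\<integral>x. f (a + x) \<partial>\<mu>) = (\<integral>x. f x \<partial>\<mu>)"
  using integral_distr[of "(+) a" \<mu> \<mu> f] by (simp add: distr_translate cong: measurable_cong_sets)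

lemma open_translate:
  fixes U :: "'a set"
  assumes "open U"
  shows "open ((+) a ` U)"
proof -
  have "(+) a ` U = (+) (- a) -` U"
  proof (intro equalityI subsetI)
    fix x assume "x \<in> (+) (- a) -` U"
    then have "a + (- a + x) \<in> (+) a ` U" by (intro imageI) simp
    then show "x \<in> (+) a ` U" by (simp add: add.assoc[symmetric])
  qed (auto simp: add.assoc[symmetric])
  then show ?thesis by (simp only:) (intro open_vimage assms continuous_intros)
qed

text \<open>Finitely many translates of \<open>U\<close> cover any compact set. If \<open>U\<close>
  were null, all compact sets would be null, and by inner regularity so would the whole
  group.\<close>

lemma emeasure_open_pos:
  assumes U: "open U" "U \<noteq> {}"
  shows "emeasure \<mu> U > 0"
proof (rule ccontr)
  assume "\<not> emeasure \<mu> U > 0"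
  then have U0: "emeasure \<mu> U = 0" by simp
  obtain u where u: "u \<in> U" using U by blast
  have "emeasure \<mu> K = 0" if K: "compact K" for K
  proof -
    have "x \<in> (+) (x - u) ` U" if "x \<in> K" for x
      using imageI[OF u, of "(+) (x - u)"] by simp
    then have "K \<subseteq> (\<Union>x\<in>K. (+) (x - u) ` U)" by blast
    then obtain D where D: "D \<subseteq> K" "finite D" "K \<subseteq> (\<Union>x\<in>D. (+) (x - u) ` U)"
      by (rule compactE_image[OF K, of K "\<lambda>x. (+) (x - u) ` U", rotated]) (auto intro: open_translate U)
    have "emeasure \<mu> K \<le> emeasure \<mu> (\<Union>x\<in>D. (+) (x - u) ` U)"
      using D U open_translate by (intro emeasure_mono) auto
    also have "\<dots> \<le> (\<Sum>x\<in>D. emeasure \<mu> ((+) (x - u) ` U))"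
      using D U open_translate by (intro emeasure_subadditive_finite) auto
    also have "\<dots> = 0"
      using haar U U0 unfolding left_haar_measure_def by (intro sum.neutral) auto
    finally show ?thesis by simp
  qed
  then have "emeasure \<mu> UNIV = 0"
    using inner_regular[OF open_UNIV] by (auto intro!: antisym SUP_least)
  then show False using haar by (simp add: left_haar_measure_def)
qed

lemma compact_nhd: "\<exists>U K. open U \<and> compact K \<and> x \<in> U \<and> U \<subseteq> (K :: 'a set)"
  using locally_compact unfolding locally_compact_space_def by auto

lemma compact_sum:
  fixes A B :: "'a set"
  assumes "compact A" "compact B"
  shows "compact {a + b |a b. a \<in> A \<and> b \<in> B}"
proof -
  have "compact ((\<lambda>z. fst z + snd z) ` (A \<times> B))"
    by (intro compact_continuous_image compact_Times assms continuous_intros)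
  also have "(\<lambda>z. fst z + snd z) ` (A \<times> B) = {a + b |a b. a \<in> A \<and> b \<in> B}" by force
  finally show ?thesis .
qed

lemma compact_uminus:
  fixes A :: "'a set"
  assumes "compact A"
  shows "compact (uminus ` A)"
  by (intro compact_continuous_image assms continuous_intros)

lemma compact_borel: "compact K \<Longrightarrow> (K :: 'a set) \<in> sets borel"
  by (simp add: compact_imp_closed)

section \<open>Nonnegative continuous functions with compact support\<close>

definition Cc :: "('a \<Rightarrow> real) set" where
  "Cc = {f. continuous_on UNIV f \<and> (\<forall>x. 0 \<le> f x) \<and> (\<exists>K. compact K \<and> (\<forall>x. x \<notin> K \<longrightarrow> f x = 0))}"

lemma CcI: "continuous_on UNIV f \<Longrightarrow> (\<And>x. 0 \<le> f x) \<Longrightarrow> compact K \<Longrightarrow> (\<And>x. x \<notin> K \<Longrightarrow> f x = 0) \<Longrightarrow> f \<in> Cc"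
  by (auto simp: Cc_def)

lemma CcE:
  assumes "f \<in> Cc"
  obtains K where "compact K" "\<And>x. x \<notin> K \<Longrightarrow> f x = 0"
  using assms by (auto simp: Cc_def)

lemma Cc_cont: "f \<in> Cc \<Longrightarrow> continuous_on UNIV f"
  by (simp add: Cc_def)

lemma Cc_cont_on:
  "f \<in> Cc \<Longrightarrow> continuous_on S g \<Longrightarrow> continuous_on S (\<lambda>x. f (g x))"
  using continuous_on_compose2[OF Cc_cont] by blast

lemma Cc_nonneg: "f \<in> Cc \<Longrightarrow> 0 \<le> f x"
  by (simp add: Cc_def)

lemma Cc_meas [measurable_dest]: "f \<in> Cc \<Longrightarrow> f \<in> borel_measurable borel"
  by (intro borel_measurable_continuous_onI Cc_cont)

lemma Cc_bounded:
  assumes "f \<in> Cc"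
  obtains B where "0 \<le> B" "\<And>x. f x \<le> B"
proof -
  obtain K where K: "compact K" "\<And>x. x \<notin> K \<Longrightarrow> f x = 0" by (rule CcE[OF assms]) blast
  have "compact (f ` K)"
    using K Cc_cont[OF assms] by (intro compact_continuous_image) (auto intro: continuous_on_subset)
  then obtain b where "\<And>x. x \<in> K \<Longrightarrow> \<bar>f x\<bar> \<le> b"
    by (meson compact_imp_bounded bounded_real imageI)
  then have "f x \<le> \<bar>b\<bar>" for x using K(2)[of x] by (cases "x \<in> K") force+
  then show ?thesis using that[of "\<bar>b\<bar>"] by auto
qed

lemma integrable_indicator_compact:
  assumes "compact K"
  shows "integrable \<mu> (\<lambda>x. c * indicator K x :: real)"
  using assms emeasure_compact_finite[OF assms] compact_borel[OF assms]
  by (intro integrable_mult_right integrable_real_indicator) auto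

lemma Cc_integrable: 
  assumes "f \<in> Cc"
  shows "integrable \<mu> f"
proof -
  obtain K where K: "compact K" "\<And>x. x \<notin> K \<Longrightarrow> f x = 0" by (rule CcE[OF assms]) blast
  obtain B where B: "0 \<le> B" "\<And>x. f x \<le> B" by (rule Cc_bounded[OF assms]) blast
  show ?thesis
  proof (rule Bochner_Integration.integrable_bound)
    show "integrable \<mu> (\<lambda>x. B * indicator K x)" by (rule integrable_indicator_compact[OF K(1)])
    show "AE x in \<mu>. norm (f x) \<le> norm (B * indicator K x)"
      using B K Cc_nonneg[OF assms] by (auto simp: indicator_def intro!: AE_I2)
  qed (use Cc_meas[OF assms] in simp)
qed

lemma Cc_powr:
  assumes "f \<in> Cc" "0 < r"
  shows "(\<lambda>x. f x powr r) \<in> Cc"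
proof -
  obtain K where K: "compact K" "\<And>x. x \<notin> K \<Longrightarrow> f x = 0" by (rule CcE[OF assms(1)]) blast
  show ?thesis
    by (intro CcI[of _ K] continuous_on_powr' continuous_on_const Cc_cont[OF assms(1)]) (use assms K in \<open>auto simp: Cc_nonneg\<close>)
qed

lemma Cc_add:
  assumes "f \<in> Cc" "g \<in> Cc"
  shows "(\<lambda>x. f x + g x) \<in> Cc"
proof -
  obtain K where K: "compact K" "\<And>x. x \<notin> K \<Longrightarrow> f x = 0" by (rule CcE[OF assms(1)]) blast
  obtain L where L: "compact L" "\<And>x. x \<notin> L \<Longrightarrow> g x = 0" by (rule CcE[OF assms(2)]) blast
  show ?thesis
    by (intro CcI[of _ "K \<union> L"] continuous_intros Cc_cont[OF assms(1)] Cc_cont[OF assms(2)])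
      (use assms K L in \<open>auto simp: Cc_nonneg\<close>)
qed

lemma Cc_scale:
  assumes "f \<in> Cc" "0 \<le> c"
  shows "(\<lambda>x. c * f x) \<in> Cc"
proof -
  obtain K where K: "compact K" "\<And>x. x \<notin> K \<Longrightarrow> f x = 0" by (rule CcE[OF assms(1)]) blast
  show ?thesis
    by (intro CcI[of _ K] continuous_intros Cc_cont[OF assms(1)]) (use assms K in \<open>auto simp: Cc_nonneg\<close>)
qed

lemma Cc_translate:
  assumes "f \<in> Cc"
  shows "(\<lambda>x. f (- a + x)) \<in> Cc"
proof -
  obtain K where K: "compact K" "\<And>x. x \<notin> K \<Longrightarrow> f x = 0" by (rule CcE[OF assms]) blast
  have "compact ((+) a ` K)" by (intro compact_continuous_image K continuous_intros)
  moreover have "f (- a + x) = 0" if "x \<notin> (+) a ` K" for x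
  proof (rule K(2), rule notI)
    assume "- a + x \<in> K"
    then have "a + (- a + x) \<in> (+) a ` K" by blast
    then show False using that by (simp add: add.assoc[symmetric])
  qed
  ultimately show ?thesis
    by (intro CcI[of _ "(+) a ` K"] Cc_cont_on[OF assms] continuous_intros) (auto simp: Cc_nonneg[OF assms])
qed

text \<open>Otherwise the set where \<open>f\<close> is positive would be a nonempty open null
  set.\<close>

lemma Cc_integral_pos:
  assumes f: "f \<in> Cc" and x: "f x > 0"
  shows "(\<integral>x. f x \<partial>\<mu>) > 0"
proof (rule ccontr)
  assume "\<not> ?thesis"
  moreover have "(\<integral>x. f x \<partial>\<mu>) \<ge> 0" by (rule Bochner_Integration.integral_nonneg) (rule Cc_nonneg[OF f])
  ultimately have "(\<integral>x. f x \<partial>\<mu>) = 0" by simp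
  then have "AE x in \<mu>. f x = 0"
    using integral_nonneg_eq_0_iff_AE[OF Cc_integrable[OF f]] Cc_nonneg[OF f] by simp
  then have "AE x in \<mu>. \<not> f x > 0" by (rule AE_mp) simp
  moreover have op: "open {x. f x > 0}" by (intro open_Collect_less continuous_intros Cc_cont[OF f])
  ultimately have "emeasure \<mu> {x. f x > 0} = 0"
    by (subst (asm) AE_iff_measurable[of "{x. f x > 0}"]) auto
  moreover note op
  ultimately show False using emeasure_open_pos[of "{x. f x > 0}"] x by auto
qed

text \<open>Urysohn's lemma; a locally compact Hausdorff space is completely regular.\<close>

lemma exists_Cc_one:
  assumes K: "compact K" and U: "open U" "K \<subseteq> U"
  obtains f where "f \<in> Cc" "\<And>x. f x \<le> 1" "\<And>x. x \<in> K \<Longrightarrow> f x = 1" "\<And>x. x \<notin> U \<Longrightarrow> f x = 0"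
proof -
  have "Hausdorff_space (euclidean :: 'a topology)"
    unfolding Hausdorff_space_def disjnt_def by (simp, metis hausdorff)
  then have reg: "completely_regular_space (euclidean :: 'a topology)"
    using locally_compact locally_compact_regular_imp_completely_regular_space by blast
  obtain V W where VW: "\<And>x. open (V x) \<and> compact (W x) \<and> x \<in> V x \<and> V x \<subseteq> (W x :: 'a set)"
    using compact_nhd by metis
  obtain D where D: "D \<subseteq> K" "finite D" "K \<subseteq> (\<Union>x\<in>D. V x)"
    by (rule compactE_image[OF K, of K V, rotated]) (use VW in auto)
  \<comment> \<open>Cutting \<open>U\<close> down to finitely many neighbourhoods that sit inside
    compact sets makes the support of the Urysohn function compact.\<close>
  define O' where "O' = U \<inter> (\<Union>x\<in>D. V x)"
  have "open O'" "K \<subseteq> O'" using VW U D by (auto simp: O'_def)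
  then have "closedin euclidean (- O')" "disjnt K (- O')" "compactin euclidean K"
    using K by (auto simp: disjnt_def)
  then obtain f where f: "continuous_map euclidean (subtopology euclidean {0..1::real}) f"
      "f ` (- O') \<subseteq> {0}" "f ` K \<subseteq> {1}"
    using reg Urysohn_completely_regular_compact_closed[of 0 1 euclidean K "- O'"] by force
  then have cont: "continuous_on UNIV f" and range: "\<And>x. 0 \<le> f x \<and> f x \<le> 1"
    by (auto simp: continuous_map_in_subtopology)
  have zero: "f x = 0" if "x \<notin> O'" for x using f(2) that by auto
  have "f \<in> Cc"
  proof (rule CcI[of f "\<Union>x\<in>D. W x"])
    show "compact (\<Union>x\<in>D. W x)" using D VW by (intro compact_UN) auto
    fix x assume "x \<notin> (\<Union>x\<in>D. W x)"
    then have "x \<notin> O'" using VW by (auto simp: O'_def)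
    then show "f x = 0" by (rule zero)
  qed (use cont range in auto)
  then show ?thesis
    using that[of f] range f(3) zero by (auto simp: O'_def)
qed

section \<open>Convolution of functions with compact support\<close>

lemma borel_uminus_translate [measurable]: "(\<lambda>y. - y + x) \<in> borel \<rightarrow>\<^sub>M (borel :: 'a measure)"
  by (intro borel_measurable_continuous_onI continuous_intros)

text \<open>Tonelli's theorem although \<mu> need not be sigma-finite: the densities
  \<open>indicator X\<close> and \<open>w\<close> give finite measures, and the compact supports
  confine the kernel to a compact rectangle, where it is product measurable.\<close>

lemma nn_integral_conv_swap:
  assumes [measurable]: "w \<in> borel_measurable borel" and w: "(\<integral>\<^sup>+y. w y \<partial>\<mu>) < \<infinity>"
    and g: "g \<in> Cc" and X: "compact X"
  shows "(\<integral>\<^sup>+x. indicator X x * (\<integral>\<^sup>+y. w y * ennreal (g (- y + x)) \<partial>\<mu>) \<partial>\<mu>)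
       = (\<integral>\<^sup>+y. w y * (\<integral>\<^sup>+x. indicator X x * ennreal (g (- y + x)) \<partial>\<mu>) \<partial>\<mu>)"
proof -
  have [measurable]: "g \<in> borel_measurable borel" by (rule Cc_meas[OF g])
  obtain S where S: "compact S" "\<And>x. x \<notin> S \<Longrightarrow> g x = 0" by (rule CcE[OF g]) blast
  \<comment> \<open>If \<open>x\<close> is in \<open>X\<close> and \<open>- y + x\<close> is in
    \<open>S\<close>, then \<open>y = x + - (- y + x)\<close> lies in this set.\<close>
  define L where "L = {a + b |a b. a \<in> X \<and> b \<in> uminus ` S}"
  have L: "compact L" unfolding L_def by (intro compact_sum compact_uminus X S)
  have [measurable]: "X \<in> sets borel" "L \<in> sets borel" using X L compact_borel by auto
  define M where "M = density \<mu> (indicator X)"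
  define N where "N = density \<mu> w"
  have "finite_measure M"
    using emeasure_compact_finite[OF X] by (intro finite_measureI) (simp add: M_def emeasure_density nn_integral_indicator)
  moreover have "finite_measure N"
    using w by (intro finite_measureI) (simp add: N_def emeasure_density)
  ultimately interpret P: pair_sigma_finite M N
    by (simp add: pair_sigma_finite_def finite_measure.axioms(1))
  have sM [measurable_cong]: "sets M = sets borel" "sets N = sets borel" by (simp_all add: M_def N_def)
  define F where "F = (\<lambda>(x, y). indicator X x * indicator L y * g (- y + x))"
  have "continuous_on UNIV (\<lambda>(x, y). g (- y + x))"
    unfolding case_prod_unfold by (intro Cc_cont_on[OF g] continuous_intros)
  then have "F \<in> borel_measurable (borel \<Otimes>\<^sub>M borel)"
    unfolding F_def using X L by (intro borel_measurable_restrict_compact_Times) auto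
  then have [measurable]: "F \<in> borel_measurable (M \<Otimes>\<^sub>M N)"
    by (simp cong: measurable_cong_sets sets_pair_measure_cong add: sM)
  have F: "ennreal (F (x, y)) = indicator X x * ennreal (g (- y + x))" for x y
  proof (cases "x \<in> X \<and> - y + x \<in> S")
    case True
    have "y = x + - (- y + x)" by (simp add: minus_add add.assoc[symmetric])
    then have "y \<in> L" unfolding L_def using True by blast
    then show ?thesis using True by (simp add: F_def indicator_def)
  qed (auto simp: F_def indicator_def S(2))
  have "(\<integral>\<^sup>+x. (\<integral>\<^sup>+y. ennreal (F (x, y)) \<partial>N) \<partial>M) = (\<integral>\<^sup>+y. (\<integral>\<^sup>+x. ennreal (F (x, y)) \<partial>M) \<partial>N)"
    using P.Fubini'[of "\<lambda>x y. ennreal (F (x, y))"] by simp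
  moreover have "(\<integral>\<^sup>+x. (\<integral>\<^sup>+y. ennreal (F (x, y)) \<partial>N) \<partial>M)
      = (\<integral>\<^sup>+x. indicator X x * (\<integral>\<^sup>+y. w y * ennreal (g (- y + x)) \<partial>\<mu>) \<partial>\<mu>)"
  proof -
    have "(\<integral>\<^sup>+y. ennreal (F (x, y)) \<partial>N) = indicator X x * (\<integral>\<^sup>+y. w y * ennreal (g (- y + x)) \<partial>\<mu>)" for x
      unfolding N_def F by (simp add: nn_integral_density mult.left_commute nn_integral_cmult)
    \<comment> \<open>Measurability in \<open>x\<close> is inherited from the inner integral of the
      jointly measurable \<open>F\<close>.\<close>
    moreover from this[symmetric] have "(\<lambda>x. indicator X x * (\<integral>\<^sup>+y. w y * ennreal (g (- y + x)) \<partial>\<mu>)) \<in> borel_measurable M"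
      by simp
    then have "(\<lambda>x. indicator X x * (\<integral>\<^sup>+y. w y * ennreal (g (- y + x)) \<partial>\<mu>)) \<in> borel_measurable \<mu>"
      by (simp add: M_def)
    ultimately show ?thesis
      by (simp add: M_def nn_integral_density mult.assoc[symmetric] flip: indicator_inter_arith)
  qed
  moreover have "(\<integral>\<^sup>+y. (\<integral>\<^sup>+x. ennreal (F (x, y)) \<partial>M) \<partial>N)
      = (\<integral>\<^sup>+y. w y * (\<integral>\<^sup>+x. indicator X x * ennreal (g (- y + x)) \<partial>\<mu>) \<partial>\<mu>)"
  proof -
    have "(\<integral>\<^sup>+x. ennreal (F (x, y)) \<partial>M) = (\<integral>\<^sup>+x. indicator X x * ennreal (g (- y + x)) \<partial>\<mu>)" for y
      unfolding M_def F by (simp add: nn_integral_density mult.assoc[symmetric] flip: indicator_inter_arith)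
    moreover from this[symmetric] have "(\<lambda>y. (\<integral>\<^sup>+x. indicator X x * ennreal (g (- y + x)) \<partial>\<mu>)) \<in> borel_measurable N"
      by simp
    then have "(\<lambda>y. (\<integral>\<^sup>+x. indicator X x * ennreal (g (- y + x)) \<partial>\<mu>)) \<in> borel_measurable \<mu>"
      by (simp add: N_def)
    ultimately show ?thesis by (simp add: N_def nn_integral_density)
  qed
  ultimately show ?thesis by simp
qed

text \<open>After the swap, left invariance bounds the inner integral by the integral of
  \<open>g\<close>, uniformly in \<open>y\<close>.\<close>

lemma nn_integral_conv_le:
  assumes [measurable]: "w \<in> borel_measurable borel" and w: "(\<integral>\<^sup>+y. w y \<partial>\<mu>) < \<infinity>"
    and g: "g \<in> Cc" and X: "compact X"
  shows "(\<integral>\<^sup>+x. indicator X x * (\<integral>\<^sup>+y. w y * ennreal (g (- y + x)) \<partial>\<mu>) \<partial>\<mu>)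
       \<le> (\<integral>\<^sup>+y. w y \<partial>\<mu>) * ennreal (\<integral>x. g x \<partial>\<mu>)"
proof -
  have [measurable]: "g \<in> borel_measurable borel" by (rule Cc_meas[OF g])
  have "(\<integral>\<^sup>+x. indicator X x * ennreal (g (- y + x)) \<partial>\<mu>) \<le> ennreal (\<integral>x. g x \<partial>\<mu>)" for y
  proof -
    have "(\<integral>\<^sup>+x. indicator X x * ennreal (g (- y + x)) \<partial>\<mu>) \<le> (\<integral>\<^sup>+x. ennreal (g (- y + x)) \<partial>\<mu>)"
      by (intro nn_integral_mono) (auto simp: indicator_def)
    also have "\<dots> = (\<integral>\<^sup>+x. ennreal (g x) \<partial>\<mu>)" by (rule nn_integral_translate) simp
    also have "\<dots> = ennreal (\<integral>x. g x \<partial>\<mu>)"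
      by (intro nn_integral_eq_integral Cc_integrable g) (simp add: Cc_nonneg[OF g])
    finally show ?thesis .
  qed
  then have "(\<integral>\<^sup>+y. w y * (\<integral>\<^sup>+x. indicator X x * ennreal (g (- y + x)) \<partial>\<mu>) \<partial>\<mu>)
      \<le> (\<integral>\<^sup>+y. w y * ennreal (\<integral>x. g x \<partial>\<mu>) \<partial>\<mu>)"
    by (intro nn_integral_mono mult_left_mono) auto
  also have "\<dots> = (\<integral>\<^sup>+y. w y \<partial>\<mu>) * ennreal (\<integral>x. g x \<partial>\<mu>)" by (simp add: nn_integral_multc)
  finally show ?thesis unfolding nn_integral_conv_swap[OF assms] .
qed

definition cv :: "('a \<Rightarrow> real) \<Rightarrow> ('a \<Rightarrow> real) \<Rightarrow> 'a \<Rightarrow> real" where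
  "cv f g x = (\<integral>y. f y * g (- y + x) \<partial>\<mu>)"

lemma integrable_mult_Cc:
  assumes f: "f \<in> Cc" and g: "continuous_on UNIV (g :: 'a \<Rightarrow> real)"
  shows "integrable \<mu> (\<lambda>y. f y * g y)"
proof -
  obtain K where K: "compact K" "\<And>x. x \<notin> K \<Longrightarrow> f x = 0" by (rule CcE[OF f]) blast
  have "compact (g ` K)"
    using K g by (intro compact_continuous_image) (auto intro: continuous_on_subset)
  then obtain b where b: "\<And>x. x \<in> K \<Longrightarrow> \<bar>g x\<bar> \<le> b"
    by (meson compact_imp_bounded bounded_real imageI)
  show ?thesis
  proof (rule Bochner_Integration.integrable_bound)
    show "integrable \<mu> (\<lambda>y. b * f y)" by (intro integrable_mult_right Cc_integrable f)
    show "AE y in \<mu>. norm (f y * g y) \<le> norm (b * f y)"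
    proof (rule AE_I2)
      fix y show "norm (f y * g y) \<le> norm (b * f y)"
        using b[of y] K(2)[of y] Cc_nonneg[OF f, of y]
        by (cases "y \<in> K") (auto simp: abs_mult mult.commute[of b] intro!: mult_left_mono)
    qed
    show "(\<lambda>y. f y * g y) \<in> borel_measurable \<mu>"
      using Cc_meas[OF f] borel_measurable_continuous_onI[OF g] by simp
  qed
qed

lemma cv_integrable:
  assumes "f \<in> Cc" "g \<in> Cc"
  shows "integrable \<mu> (\<lambda>y. f y * g (- y + x))"
  by (intro integrable_mult_Cc assms Cc_cont_on[OF assms(2)] continuous_intros)

lemma cv_supp:
  assumes "\<And>x. x \<notin> K \<Longrightarrow> f x = 0" "\<And>x. x \<notin> L \<Longrightarrow> g x = 0"
    and "x \<notin> {a + b |a b. a \<in> K \<and> b \<in> L}"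
  shows "cv f g x = 0"
proof -
  have "(\<lambda>y. f y * g (- y + x)) = (\<lambda>y. 0)"
  proof (rule ext, rule ccontr)
    fix y assume "f y * g (- y + x) \<noteq> 0"
    then have "y \<in> K" "- y + x \<in> L" using assms(1,2) by auto
    moreover have "x = y + (- y + x)" by (simp add: add.assoc[symmetric])
    ultimately show False using assms(3) by blast
  qed
  then show ?thesis unfolding cv_def by simp
qed

lemma cv_Cc:
  assumes f: "f \<in> Cc" and g: "g \<in> Cc"
  shows "cv f g \<in> Cc"
proof -
  obtain K where K: "compact K" "\<And>x. x \<notin> K \<Longrightarrow> f x = 0" by (rule CcE[OF f]) blast
  obtain L where L: "compact L" "\<And>x. x \<notin> L \<Longrightarrow> g x = 0" by (rule CcE[OF g]) blast
  show ?thesis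
  proof (rule CcI)
    have "continuous_on UNIV (\<lambda>x. \<integral>y. g (- y + x) *\<^sub>R f y \<partial>\<mu>)"
    proof (rule continuous_on_integral_compact[OF _ K(1)])
      show "continuous_on UNIV (\<lambda>(x, y). g (- y + x))"
        unfolding case_prod_unfold by (intro Cc_cont_on[OF g] continuous_intros)
    qed (use K Cc_integrable[OF f] in auto)
    then show "continuous_on UNIV (cv f g)" unfolding cv_def by (simp add: mult.commute)
    show "0 \<le> cv f g x" for x
      unfolding cv_def using Cc_nonneg[OF f] Cc_nonneg[OF g] by simp
    show "compact {a + b |a b. a \<in> K \<and> b \<in> L}" by (intro compact_sum K L)
    show "cv f g x = 0" if "x \<notin> {a + b |a b. a \<in> K \<and> b \<in> L}" for x
      by (rule cv_supp[OF K(2) L(2) that])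
  qed
qed

text \<open>Exchange the order of integration and use left invariance in the inner integral. The
  compact set \<open>X = K + L\<close> contains every point that matters, so restricting to it
  changes nothing.\<close>

lemma integral_cv:
  assumes f: "f \<in> Cc" and g: "g \<in> Cc"
  shows "(\<integral>x. cv f g x \<partial>\<mu>) = (\<integral>x. f x \<partial>\<mu>) * (\<integral>x. g x \<partial>\<mu>)"
proof -
  have [measurable]: "f \<in> borel_measurable borel" "g \<in> borel_measurable borel"
    using f g by (auto simp: Cc_meas)
  obtain K where K: "compact K" "\<And>x. x \<notin> K \<Longrightarrow> f x = 0" by (rule CcE[OF f]) blast
  obtain L where L: "compact L" "\<And>x. x \<notin> L \<Longrightarrow> g x = 0" by (rule CcE[OF g]) blast
  define X where "X = {a + b |a b. a \<in> K \<and> b \<in> L}"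
  have X: "compact X" unfolding X_def by (intro compact_sum K L)
  have nn: "(\<integral>\<^sup>+x. ennreal (u x) \<partial>\<mu>) = ennreal (\<integral>x. u x \<partial>\<mu>)" if "u \<in> Cc" for u
    by (intro nn_integral_eq_integral Cc_integrable that) (simp add: Cc_nonneg[OF that])
  have conv: "ennreal (cv f g x) = (\<integral>\<^sup>+y. ennreal (f y) * ennreal (g (- y + x)) \<partial>\<mu>)" for x
    unfolding cv_def using cv_integrable[OF f g] Cc_nonneg[OF f] Cc_nonneg[OF g]
    by (subst nn_integral_eq_integral[symmetric]) (auto simp: ennreal_mult)
  have "ennreal (\<integral>x. cv f g x \<partial>\<mu>) = (\<integral>\<^sup>+x. ennreal (cv f g x) \<partial>\<mu>)"
    by (rule nn[OF cv_Cc[OF f g], symmetric])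
  also have "\<dots> = (\<integral>\<^sup>+x. indicator X x * (\<integral>\<^sup>+y. ennreal (f y) * ennreal (g (- y + x)) \<partial>\<mu>) \<partial>\<mu>)"
  proof (rule nn_integral_cong)
    fix x
    have "cv f g x = 0" if "x \<notin> X" using cv_supp[OF K(2) L(2)] that by (simp add: X_def)
    then show "ennreal (cv f g x) = indicator X x * (\<integral>\<^sup>+y. ennreal (f y) * ennreal (g (- y + x)) \<partial>\<mu>)"
      unfolding conv[symmetric] by (auto simp: indicator_def)
  qed
  also have "\<dots> = (\<integral>\<^sup>+y. ennreal (f y) * (\<integral>\<^sup>+x. indicator X x * ennreal (g (- y + x)) \<partial>\<mu>) \<partial>\<mu>)"
    by (rule nn_integral_conv_swap) (use nn[OF f] g X in auto)
  also have "\<dots> = (\<integral>\<^sup>+y. ennreal (f y) * ennreal (\<integral>x. g x \<partial>\<mu>) \<partial>\<mu>)"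
  proof (rule nn_integral_cong)
    fix y
    show "ennreal (f y) * (\<integral>\<^sup>+x. indicator X x * ennreal (g (- y + x)) \<partial>\<mu>) = ennreal (f y) * ennreal (\<integral>x. g x \<partial>\<mu>)"
    proof (cases "y \<in> K")
      case True
      have "indicator X x * ennreal (g (- y + x)) = ennreal (g (- y + x))" for x
      proof (cases "- y + x \<in> L")
        case L: True
        have "x = y + (- y + x)" by (simp add: add.assoc[symmetric])
        then have "x \<in> X" using True L unfolding X_def by blast
        then show ?thesis by simp
      qed (simp add: L(2))
      then have "(\<integral>\<^sup>+x. indicator X x * ennreal (g (- y + x)) \<partial>\<mu>) = (\<integral>\<^sup>+x. ennreal (g x) \<partial>\<mu>)"
        by (simp add: nn_integral_translate[of "\<lambda>x. ennreal (g x)"])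
      then show ?thesis by (simp add: nn[OF g])
    qed (simp add: K(2))
  qed
  also have "\<dots> = ennreal ((\<integral>x. f x \<partial>\<mu>) * (\<integral>x. g x \<partial>\<mu>))"
    using Cc_nonneg[OF f] Cc_nonneg[OF g] by (simp add: nn_integral_multc nn[OF f] ennreal_mult)
  finally show ?thesis
    using Cc_nonneg[OF f] Cc_nonneg[OF g] Cc_nonneg[OF cv_Cc[OF f g]] by simp
qed

text \<open>\<open>integral_Minkowski\<close> for Haar measure. Taking \<open>c\<close> and
  \<open>indicator L\<close> as densities makes both measures finite, and cutting the kernel off to
  \<open>C \<times> L\<close> makes it bounded and product measurable.\<close>

lemma Cc_Minkowski:
  fixes \<Psi> :: "'a \<Rightarrow> 'a \<Rightarrow> real"
  assumes c: "c \<in> Cc" and p: "1 \<le> p" and L: "compact L"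
    and cont: "continuous_on UNIV (\<lambda>(y, w). \<Psi> y w)" and nonneg: "\<And>y w. 0 \<le> \<Psi> y w"
    and supp: "\<And>y w. w \<notin> L \<Longrightarrow> \<Psi> y w = 0"
  shows "(\<integral>y. c y * (\<integral>w. \<Psi> y w \<partial>\<mu>) powr p \<partial>\<mu>) powr (1 / p) \<le> (\<integral>w. (\<integral>y. c y * \<Psi> y w powr p \<partial>\<mu>) powr (1 / p) \<partial>\<mu>)"
proof -
  have [measurable]: "c \<in> borel_measurable borel" by (rule Cc_meas[OF c])
  obtain C where C: "compact C" "\<And>x. x \<notin> C \<Longrightarrow> c x = 0" by (rule CcE[OF c]) blast
  have [measurable]: "C \<in> sets borel" "L \<in> sets borel" using C L compact_borel by auto
  define M where "M = density \<mu> c"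
  define N where "N = density \<mu> (indicator L :: 'a \<Rightarrow> real)"
  have sM [measurable_cong]: "sets M = sets borel" "sets N = sets borel" by (simp_all add: M_def N_def)
  have "finite_measure M"
    using Cc_integrable[OF c] Cc_nonneg[OF c]
    by (intro finite_measureI) (simp add: M_def emeasure_density nn_integral_eq_integral)
  moreover have "finite_measure N"
    using emeasure_compact_finite[OF L]
    by (intro finite_measureI) (simp add: N_def emeasure_density ennreal_indicator nn_integral_indicator)
  moreover define \<Phi> where "\<Phi> y w = indicator C y * indicator L w * \<Psi> y w" for y w
  have "(\<lambda>(y, w). \<Phi> y w) \<in> borel_measurable (borel \<Otimes>\<^sub>M borel)"
    unfolding \<Phi>_def using C L cont by (intro borel_measurable_restrict_compact_Times) auto
  then have meas: "case_prod \<Phi> \<in> borel_measurable (M \<Otimes>\<^sub>M N)"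
    by (simp cong: measurable_cong_sets sets_pair_measure_cong add: sM)
  have "compact ((\<lambda>(y, w). \<Psi> y w) ` (C \<times> L))"
    using C L cont by (intro compact_continuous_image compact_Times) (auto intro: continuous_on_subset)
  then obtain b where b: "\<And>z. z \<in> C \<times> L \<Longrightarrow> \<bar>case_prod \<Psi> z\<bar> \<le> b"
    by (meson compact_imp_bounded bounded_real imageI)
  have "\<Phi> y w \<le> \<bar>b\<bar>" for y w
    using b[of "(y, w)"] by (auto simp: \<Phi>_def indicator_def)
  ultimately have "(\<integral>y. (\<integral>w. \<Phi> y w \<partial>N) powr p \<partial>M) powr (1 / p) \<le> (\<integral>w. (\<integral>y. \<Phi> y w powr p \<partial>M) powr (1 / p) \<partial>N)"
    using p nonneg by (intro integral_Minkowski[where B = "\<bar>b\<bar>"] meas) (auto simp: \<Phi>_def)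
  moreover have "(\<integral>y. (\<integral>w. \<Phi> y w \<partial>N) powr p \<partial>M) = (\<integral>y. c y * (\<integral>w. \<Psi> y w \<partial>\<mu>) powr p \<partial>\<mu>)"
  proof -
    have [measurable]: "case_prod \<Phi> \<in> borel_measurable (borel \<Otimes>\<^sub>M N)"
      using meas by (simp cong: measurable_cong_sets sets_pair_measure_cong add: sM)
    interpret N: finite_measure N by fact
    have [measurable]: "(\<lambda>y. (\<integral>w. \<Phi> y w \<partial>N) powr p) \<in> borel_measurable borel" by measurable
    have m [measurable]: "(\<lambda>w. \<Phi> y w) \<in> borel_measurable borel" for y
      using measurable_compose[OF measurable_Pair1' meas, of y] by (simp add: M_def sM cong: measurable_cong_sets)
    have 1: "(\<integral>w. \<Phi> y w \<partial>N) = indicator C y * (\<integral>w. \<Psi> y w \<partial>\<mu>)" for y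
    proof -
      have "(\<integral>w. \<Phi> y w \<partial>N) = (\<integral>w. indicator L w * \<Phi> y w \<partial>\<mu>)"
        unfolding N_def by (subst integral_density) auto
      also have "\<dots> = (\<integral>w. indicator C y * \<Psi> y w \<partial>\<mu>)"
        by (intro Bochner_Integration.integral_cong) (auto simp: \<Phi>_def indicator_def supp)
      finally show ?thesis by simp
    qed
    have "(\<integral>y. (\<integral>w. \<Phi> y w \<partial>N) powr p \<partial>M) = (\<integral>y. c y * (\<integral>w. \<Phi> y w \<partial>N) powr p \<partial>\<mu>)"
      unfolding M_def using Cc_nonneg[OF c] by (subst integral_density) auto
    also have "\<dots> = (\<integral>y. c y * (\<integral>w. \<Psi> y w \<partial>\<mu>) powr p \<partial>\<mu>)"
      unfolding 1 by (intro Bochner_Integration.integral_cong) (auto simp: indicator_def C(2))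
    finally show ?thesis .
  qed
  moreover have "(\<integral>w. (\<integral>y. \<Phi> y w powr p \<partial>M) powr (1 / p) \<partial>N) = (\<integral>w. (\<integral>y. c y * \<Psi> y w powr p \<partial>\<mu>) powr (1 / p) \<partial>\<mu>)"
  proof -
    interpret M: finite_measure M by fact
    have [measurable]: "(\<lambda>(w, y). \<Phi> y w) \<in> borel_measurable (borel \<Otimes>\<^sub>M M)"
      using measurable_pair_swap[OF meas] by (simp cong: measurable_cong_sets sets_pair_measure_cong add: sM case_prod_unfold)
    have [measurable]: "(\<lambda>w. (\<integral>y. \<Phi> y w powr p \<partial>M) powr (1 / p)) \<in> borel_measurable borel" by measurable
    have m [measurable]: "(\<lambda>y. \<Phi> y w) \<in> borel_measurable borel" for w
      using measurable_compose[OF measurable_Pair2' meas, of w] by (simp add: N_def sM cong: measurable_cong_sets)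
    have 1: "(\<integral>y. \<Phi> y w powr p \<partial>M) = indicator L w * (\<integral>y. c y * \<Psi> y w powr p \<partial>\<mu>)" for w
    proof -
      have "(\<integral>y. \<Phi> y w powr p \<partial>M) = (\<integral>y. c y * \<Phi> y w powr p \<partial>\<mu>)"
        unfolding M_def using Cc_nonneg[OF c] by (subst integral_density) auto
      also have "\<dots> = (\<integral>y. indicator L w * (c y * \<Psi> y w powr p) \<partial>\<mu>)"
        by (intro Bochner_Integration.integral_cong) (auto simp: \<Phi>_def indicator_def C(2))
      finally show ?thesis by simp
    qed
    have "(\<integral>w. (\<integral>y. \<Phi> y w powr p \<partial>M) powr (1 / p) \<partial>N) = (\<integral>w. indicator L w * (\<integral>y. \<Phi> y w powr p \<partial>M) powr (1 / p) \<partial>\<mu>)"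
      unfolding N_def by (subst integral_density) auto
    also have "\<dots> = (\<integral>w. (\<integral>y. c y * \<Psi> y w powr p \<partial>\<mu>) powr (1 / p) \<partial>\<mu>)"
      unfolding 1 by (intro Bochner_Integration.integral_cong) (auto simp: indicator_def supp)
    finally show ?thesis .
  qed
  ultimately show ?thesis by simp
qed

section \<open>Amplification in non-compact groups\<close>

lemma Cc_mult:
  assumes f: "f \<in> Cc" and g: "g \<in> Cc"
  shows "(\<lambda>x. f x * g x) \<in> Cc"
proof -
  obtain K where K: "compact K" "\<And>x. x \<notin> K \<Longrightarrow> f x = 0" by (rule CcE[OF f]) blast
  show ?thesis
    by (rule CcI[of _ K]) (use K in \<open>auto intro!: continuous_intros Cc_cont[OF f] Cc_cont[OF g] simp: Cc_nonneg[OF f] Cc_nonneg[OF g]\<close>)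
qed

lemma Cc_reflect:
  assumes f: "f \<in> Cc"
  shows "(\<lambda>y. f (- y + x)) \<in> Cc"
proof -
  obtain K where K: "compact K" "\<And>x. x \<notin> K \<Longrightarrow> f x = 0" by (rule CcE[OF f]) blast
  show ?thesis
  proof (rule CcI[of _ "(\<lambda>b. x - b) ` K"])
    show "compact ((\<lambda>b. x - b) ` K)" by (intro compact_continuous_image K continuous_intros)
    fix y assume y: "y \<notin> (\<lambda>b. x - b) ` K"
    have "y = x - (- y + x)" by (simp add: diff_conv_add_uminus minus_add add.assoc[symmetric])
    then have "- y + x \<notin> K" using y by blast
    then show "f (- y + x) = 0" by (rule K(2))
  qed (use Cc_nonneg[OF f] in \<open>auto intro!: Cc_cont_on[OF f] continuous_intros\<close>)
qed

lemma cv_add_left: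
  assumes "f1 \<in> Cc" "f2 \<in> Cc" "g \<in> Cc"
  shows "cv (\<lambda>x. f1 x + f2 x) g x = cv f1 g x + cv f2 g x"
  unfolding cv_def distrib_right
  by (intro Bochner_Integration.integral_add cv_integrable assms)

lemma cv_add_right:
  assumes "f \<in> Cc" "g1 \<in> Cc" "g2 \<in> Cc"
  shows "cv f (\<lambda>x. g1 x + g2 x) x = cv f g1 x + cv f g2 x"
  unfolding cv_def distrib_left
  by (intro Bochner_Integration.integral_add cv_integrable assms)

lemma cv_scale_left: "cv (\<lambda>x. c * f x) g x = c * cv f g x"
  unfolding cv_def mult.assoc by simp

lemma cv_scale_right: "cv f (\<lambda>x. c * g x) x = c * cv f g x"
  unfolding cv_def mult.left_commute[of _ c] by simp

lemma cv_translate: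
  assumes "f \<in> Cc" "g \<in> Cc"
  shows "(\<integral>w. f (a + w) * g (- w + z) \<partial>\<mu>) = cv f g (a + z)"
proof -
  have [measurable]: "f \<in> borel_measurable borel" "g \<in> borel_measurable borel"
    using assms by (auto simp: Cc_meas)
  have "(\<integral>w. (\<lambda>w. f w * g (- w + (a + z))) (a + w) \<partial>\<mu>) = cv f g (a + z)"
    unfolding cv_def by (rule integral_translate) simp
  then show ?thesis by (simp add: minus_add add.assoc[symmetric])
qed

text \<open>On the right \<open>g\<close> is convolved from the left with an L^p average, with
  weight \<open>c\<close>, of the translates of \<open>f\<close> by \<open>y + x\<close>; on the
  left stands the same average of the translated convolutions. Minkowski's inequality lets the
  average pass inside the convolution integral.\<close>

lemma cv_convexity_left:
  assumes f: "f \<in> Cc" and g: "g \<in> Cc" and c: "c \<in> Cc" and p: "1 \<le> p"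
  shows "(cv c (\<lambda>y. cv f g (- x + y) powr p) z) powr (1 / p)
    \<le> cv (\<lambda>w. (cv c (\<lambda>y. f (- x + y) powr p) w) powr (1 / p)) g z"
proof -
  obtain S where S: "compact S" "\<And>x. x \<notin> S \<Longrightarrow> g x = 0" by (rule CcE[OF g]) blast
  define L where "L = (\<lambda>b. z - b) ` S"
  define \<Psi> where "\<Psi> y w = f (- x + (- y + w)) * g (- w + z)" for y w
  have L: "compact L" unfolding L_def by (intro compact_continuous_image S continuous_intros)
  have "continuous_on UNIV (\<lambda>(y, w). \<Psi> y w)"
    unfolding \<Psi>_def case_prod_unfold
    by (intro continuous_on_mult Cc_cont_on[OF f] Cc_cont_on[OF g] continuous_intros)
  moreover have "\<Psi> y w = 0" if "w \<notin> L" for y w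
  proof -
    have "w = z - (- w + z)" by (simp add: diff_conv_add_uminus minus_add add.assoc[symmetric])
    then have "- w + z \<notin> S" using that unfolding L_def by blast
    then show ?thesis by (simp add: \<Psi>_def S(2))
  qed
  ultimately have "(\<integral>y. c y * (\<integral>w. \<Psi> y w \<partial>\<mu>) powr p \<partial>\<mu>) powr (1 / p)
      \<le> (\<integral>w. (\<integral>y. c y * \<Psi> y w powr p \<partial>\<mu>) powr (1 / p) \<partial>\<mu>)"
    by (intro Cc_Minkowski[OF c p L]) (auto simp: \<Psi>_def Cc_nonneg[OF f] Cc_nonneg[OF g])
  moreover have "(\<integral>w. \<Psi> y w \<partial>\<mu>) = cv f g (- x + (- y + z))" for y
    unfolding \<Psi>_def using cv_translate[OF f g, of "- x + - y" z] by (simp only: add.assoc)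
  moreover have "(\<integral>y. c y * \<Psi> y w powr p \<partial>\<mu>) powr (1 / p)
      = (cv c (\<lambda>y. f (- x + y) powr p) w) powr (1 / p) * g (- w + z)" for w
  proof -
    have "(\<integral>y. c y * \<Psi> y w powr p \<partial>\<mu>) = (\<integral>y. c y * f (- x + (- y + w)) powr p * g (- w + z) powr p \<partial>\<mu>)"
      by (simp add: \<Psi>_def powr_mult Cc_nonneg[OF f] Cc_nonneg[OF g] mult.assoc)
    also have "\<dots> = cv c (\<lambda>y. f (- x + y) powr p) w * g (- w + z) powr p"
      by (simp add: cv_def)
    finally show ?thesis
      using p Cc_nonneg[OF g, of "- w + z"] Cc_nonneg[OF c] by (simp add: powr_mult powr_powr cv_def)
  qed
  ultimately show ?thesis unfolding cv_def by simp
qed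

text \<open>The mirror image, with the average taken in the second factor: the weight is
  \<open>c (- u + z)\<close>, and the substitution of \<open>v + u\<close> for \<open>u\<close>
  moves the translation from \<open>g\<close> to \<open>c\<close>.\<close>

lemma cv_convexity_right:
  assumes f: "f \<in> Cc" and g: "g \<in> Cc" and c: "c \<in> Cc" and p: "1 \<le> p"
  shows "(cv (\<lambda>y. cv f g y powr p) c z) powr (1 / p)
    \<le> cv f (\<lambda>w. (cv (\<lambda>y. g y powr p) c w) powr (1 / p)) z"
proof -
  have [measurable]: "g \<in> borel_measurable borel" "c \<in> borel_measurable borel"
    using g c by (auto simp: Cc_meas)
  obtain L where L: "compact L" "\<And>x. x \<notin> L \<Longrightarrow> f x = 0" by (rule CcE[OF f]) blast
  define \<Psi> where "\<Psi> u v = f v * g (- v + u)" for u v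
  have "continuous_on UNIV (\<lambda>(u, v). \<Psi> u v)"
    unfolding \<Psi>_def case_prod_unfold
    by (intro continuous_on_mult Cc_cont_on[OF f] Cc_cont_on[OF g] continuous_intros)
  then have "(\<integral>u. c (- u + z) * (\<integral>v. \<Psi> u v \<partial>\<mu>) powr p \<partial>\<mu>) powr (1 / p)
      \<le> (\<integral>v. (\<integral>u. c (- u + z) * \<Psi> u v powr p \<partial>\<mu>) powr (1 / p) \<partial>\<mu>)"
    by (intro Cc_Minkowski[OF Cc_reflect[OF c] p L(1)])
      (auto simp: \<Psi>_def Cc_nonneg[OF f] Cc_nonneg[OF g] L(2))
  moreover have "(\<integral>v. \<Psi> u v \<partial>\<mu>) = cv f g u" for u
    by (simp add: \<Psi>_def cv_def)
  moreover have "(\<integral>u. c (- u + z) * \<Psi> u v powr p \<partial>\<mu>) powr (1 / p)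
      = f v * (cv (\<lambda>y. g y powr p) c (- v + z)) powr (1 / p)" for v
  proof -
    have "cv (\<lambda>y. g y powr p) c (- v + z) = (\<integral>u. (\<lambda>u. g (- v + u) powr p * c (- u + z)) (v + u) \<partial>\<mu>)"
      by (simp add: cv_def minus_add add.assoc[symmetric])
    also have "\<dots> = (\<integral>u. g (- v + u) powr p * c (- u + z) \<partial>\<mu>)"
      by (rule integral_translate) simp
    finally have "(\<integral>u. c (- u + z) * \<Psi> u v powr p \<partial>\<mu>) = f v powr p * cv (\<lambda>y. g y powr p) c (- v + z)"
      by (simp add: \<Psi>_def powr_mult Cc_nonneg[OF f] Cc_nonneg[OF g] mult_ac)
    moreover have "0 \<le> cv (\<lambda>y. g y powr p) c (- v + z)"
      unfolding cv_def by (simp add: Cc_nonneg[OF c])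
    ultimately show ?thesis
      using p Cc_nonneg[OF f, of v] by (simp add: powr_mult powr_powr)
  qed
  ultimately show ?thesis unfolding cv_def by (simp add: mult.commute)
qed

text \<open>If \<open>f w\<close> and \<open>h y * f (- x + (- y + w))\<close> are both nonzero,
  then \<open>x = - y + w - (- x + (- y + w))\<close> lies in \<open>- C + A - A\<close>; likewise
  the second pair forces \<open>x\<close> into \<open>- B + B - C\<close>. Both sets are compact, so
  a non-compact group has a point outside their union.\<close>

lemma Cc_translate_compact:
  assumes "\<not> compact (UNIV :: 'a set)" "f \<in> Cc" "g \<in> Cc" "h \<in> Cc"
  obtains x where
    "\<And>w. f w = 0 \<or> cv h (\<lambda>y. f (- x + y)) w = 0"
    "\<And>w. g w = 0 \<or> cv g (\<lambda>y. h (- x + y)) w = 0"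
proof -
  obtain A where A: "compact A" "\<And>x. x \<notin> A \<Longrightarrow> f x = 0" by (rule CcE[OF assms(2)]) blast
  obtain B where B: "compact B" "\<And>x. x \<notin> B \<Longrightarrow> g x = 0" by (rule CcE[OF assms(3)]) blast
  obtain C where C: "compact C" "\<And>x. x \<notin> C \<Longrightarrow> h x = 0" by (rule CcE[OF assms(4)]) blast
  define Z where "Z P Q R = (\<lambda>(a, b, c). - a + b - c) ` (P \<times> Q \<times> R)" for P Q R :: "'a set"
  have Z: "compact (Z P Q R)" if "compact P" "compact Q" "compact R" for P Q R
    unfolding Z_def using that
    by (intro compact_continuous_image compact_Times) (auto simp: case_prod_unfold intro!: continuous_intros)
  have "compact (Z C A A \<union> Z B B C)" using Z A B C by blast
  then obtain x where x: "x \<notin> Z C A A" "x \<notin> Z B B C" using assms(1) by (metis UNIV_eq_I UnI1 UnI2)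
  have "v - (- x + v) = x" for v
    by (simp only: diff_conv_add_uminus minus_add minus_minus add_minus_cancel)
  then have eq: "- y + w - (- x + (- y + w)) = x" for y w by blast
  show thesis
  proof
    fix w
    show "f w = 0 \<or> cv h (\<lambda>y. f (- x + y)) w = 0"
    proof (cases "w \<in> A")
      case True
      have "(\<lambda>y. h y * f (- x + (- y + w))) = (\<lambda>y. 0)"
      proof (rule ext, rule ccontr)
        fix y assume "h y * f (- x + (- y + w)) \<noteq> 0"
        then have "y \<in> C" "- x + (- y + w) \<in> A" using A C by auto
        then have "- y + w - (- x + (- y + w)) \<in> Z C A A" unfolding Z_def using True by force
        then show False unfolding eq using x by blast
      qed
      then show ?thesis unfolding cv_def by simp
    qed (simp add: A)
    show "g w = 0 \<or> cv g (\<lambda>y. h (- x + y)) w = 0"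
    proof (cases "w \<in> B")
      case True
      have "(\<lambda>y. g y * h (- x + (- y + w))) = (\<lambda>y. 0)"
      proof (rule ext, rule ccontr)
        fix y assume "g y * h (- x + (- y + w)) \<noteq> 0"
        then have "y \<in> B" "- x + (- y + w) \<in> C" using B C by auto
        then have "- y + w - (- x + (- y + w)) \<in> Z B B C" unfolding Z_def using True by force
        then show False unfolding eq using x by blast
      qed
      then show ?thesis unfolding cv_def by simp
    qed (simp add: B)
  qed
qed

section \<open>One round of amplification and its iteration\<close>

lemma integral_translate_Cc: "f \<in> Cc \<Longrightarrow> (\<integral>z. f (- x + z) \<partial>\<mu>) = (\<integral>z. f z \<partial>\<mu>)"
  by (rule integral_translate) (rule Cc_meas)

lemma cv_mono_integral_powr:
  assumes "u \<in> Cc" "v \<in> Cc" "\<And>x. u x \<le> v x" "0 < p"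
  shows "(\<integral>x. u x powr p \<partial>\<mu>) \<le> (\<integral>x. v x powr p \<partial>\<mu>)"
  using assms by (intro integral_mono Cc_integrable Cc_powr powr_mono2) (auto simp: Cc_nonneg)

text \<open>The quotient of the mass of the convolution by the product of the masses of the factors,
  all with \<open>p\<close>-th powers, grows at least by
  \<open>(1 + 2 powr p * s) / (1 + s)\<^sup>2\<close>.\<close>

lemma cv_amplify:
  assumes nc: "\<not> compact (UNIV :: 'a set)" and p: "1 < p" and f: "f \<in> Cc" and g: "g \<in> Cc"
    and Q: "0 < (\<integral>x. cv f g x powr p \<partial>\<mu>)" and s: "0 < s"
  obtains F G where "F \<in> Cc" "G \<in> Cc"
    "(\<integral>x. F x powr p \<partial>\<mu>) = (1 + s) * (\<integral>x. f x powr p \<partial>\<mu>)"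
    "(\<integral>x. G x powr p \<partial>\<mu>) = (1 + s) * (\<integral>x. g x powr p \<partial>\<mu>)"
    "(1 + 2 powr p * s) * (\<integral>x. cv f g x powr p \<partial>\<mu>) \<le> (\<integral>x. cv F G x powr p \<partial>\<mu>)"
proof -
  define h where "h = cv f g"
  define H where "H x = h x powr p" for x
  define Q where "Q = (\<integral>x. H x \<partial>\<mu>)"
  have Q0: "Q > 0" using Q by (simp add: Q_def H_def h_def)
  have h: "h \<in> Cc" unfolding h_def by (rule cv_Cc[OF f g])
  have H: "H \<in> Cc" unfolding H_def[abs_def] using p by (intro Cc_powr h) simp
  have fp: "(\<lambda>x. f x powr p) \<in> Cc" and gp: "(\<lambda>x. g x powr p) \<in> Cc" using p by (auto intro: Cc_powr f g)
  \<comment> \<open>The disjoint supports make the \<open>p\<close>-th power of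
    \<open>f + t * f'\<close>, and of \<open>g + t * g'\<close>, split into a sum.\<close>
  obtain x where x: "\<And>w. f w powr p = 0 \<or> cv H (\<lambda>y. f (- x + y) powr p) w = 0"
      "\<And>w. g w powr p = 0 \<or> cv (\<lambda>x. g x powr p) (\<lambda>y. H (- x + y)) w = 0"
    by (rule Cc_translate_compact[OF nc fp gp H]) blast
  define f1 where "f1 = cv H (\<lambda>y. f (- x + y) powr p)"
  define g1 where "g1 = cv (\<lambda>x. g x powr p) (\<lambda>y. H (- x + y))"
  define k1 where "k1 = cv H (\<lambda>y. H (- x + y))"
  define f' where "f' w = f1 w powr (1 / p)" for w
  define g' where "g' w = g1 w powr (1 / p)" for w
  define k where "k w = k1 w powr (1 / p)" for w
  have Hx: "(\<lambda>y. H (- x + y)) \<in> Cc" by (rule Cc_translate[OF H])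
  have f1: "f1 \<in> Cc" unfolding f1_def by (intro cv_Cc H Cc_translate[OF fp])
  have g1: "g1 \<in> Cc" unfolding g1_def by (intro cv_Cc gp Hx)
  have k1: "k1 \<in> Cc" unfolding k1_def by (intro cv_Cc H Hx)
  have f': "f' \<in> Cc" and g': "g' \<in> Cc" and k: "k \<in> Cc"
    unfolding f'_def[abs_def] g'_def[abs_def] k_def[abs_def] using p by (auto intro!: Cc_powr f1 g1 k1)
  have kf: "k z \<le> cv f' g z" for z
    unfolding k_def k1_def f'_def[abs_def] f1_def using cv_convexity_left[OF f g H, of p x z] p
    by (simp add: H_def h_def)
  have kg: "k z \<le> cv f g' z" for z
    unfolding k_def k1_def g'_def[abs_def] g1_def using cv_convexity_right[OF f g Hx, of p z] p
    by (simp add: H_def[abs_def] h_def)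
  have f'p: "f' w powr p = f1 w" and g'p: "g' w powr p = g1 w" and kp: "k w powr p = k1 w" for w
    using p Cc_nonneg[OF f1] Cc_nonneg[OF g1] Cc_nonneg[OF k1] by (auto simp: f'_def g'_def k_def powr_powr)
  \<comment> \<open>Mass is multiplicative under convolution and unchanged by translation, so the
    \<open>p\<close>-th power masses of \<open>f'\<close>, \<open>g'\<close> and \<open>k\<close>
    are those of \<open>f\<close>, \<open>g\<close> and \<open>h\<close>, each times
    \<open>Q\<close>.\<close>
  have If1: "(\<integral>w. f1 w \<partial>\<mu>) = Q * (\<integral>x. f x powr p \<partial>\<mu>)"
    unfolding f1_def by (subst integral_cv[OF H Cc_translate[OF fp]]) (simp add: Q_def integral_translate_Cc[OF fp])
  have Ig1: "(\<integral>w. g1 w \<partial>\<mu>) = Q * (\<integral>x. g x powr p \<partial>\<mu>)"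
    unfolding g1_def by (subst integral_cv[OF gp Hx]) (simp add: Q_def integral_translate_Cc[OF H])
  have Ik1: "(\<integral>w. k1 w \<partial>\<mu>) = Q * Q"
    unfolding k1_def by (subst integral_cv[OF H Hx]) (simp add: Q_def integral_translate_Cc[OF H])
  \<comment> \<open>Chosen so that \<open>t powr p * Q = s\<close>, the relative growth that is
    asked for.\<close>
  define t where "t = (s / Q) powr (1 / p)"
  have t0: "0 \<le> t" by (simp add: t_def)
  have tp: "t powr p = s / Q" using p s Q0 by (simp add: t_def powr_powr)
  define F where "F w = f w + t * f' w" for w
  define G where "G w = g w + t * g' w" for w
  have tf': "(\<lambda>w. t * f' w) \<in> Cc" and tg': "(\<lambda>w. t * g' w) \<in> Cc" by (intro Cc_scale f' g' t0)+
  have F: "F \<in> Cc" and G: "G \<in> Cc" unfolding F_def[abs_def] G_def[abs_def] by (intro Cc_add f g tf' tg')+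
  have Fp: "F w powr p = f w powr p + t powr p * f1 w" for w
    using x(1)[of w] p t0 Cc_nonneg[OF f', of w] f'p[of w]
    by (auto simp: F_def f1_def[symmetric] powr_mult f'_def)
  have Gp: "G w powr p = g w powr p + t powr p * g1 w" for w
    using x(2)[of w] p t0 Cc_nonneg[OF g', of w] g'p[of w]
    by (auto simp: G_def g1_def[symmetric] powr_mult g'_def)
  have IF: "(\<integral>w. F w powr p \<partial>\<mu>) = (1 + s) * (\<integral>x. f x powr p \<partial>\<mu>)"
    unfolding Fp using Q0 Cc_integrable[OF fp] Cc_integrable[OF f1]
    by (simp add: If1 tp field_simps)
  have IG: "(\<integral>w. G w powr p \<partial>\<mu>) = (1 + s) * (\<integral>x. g x powr p \<partial>\<mu>)"
    unfolding Gp using Q0 Cc_integrable[OF gp] Cc_integrable[OF g1]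
    by (simp add: Ig1 tp field_simps)
  have tk: "(\<lambda>w. 2 * t * k w) \<in> Cc" using t0 by (intro Cc_scale k) simp
  \<comment> \<open>Of the four products in \<open>cv F G\<close>, the two mixed ones are each at
    least \<open>t * k\<close>, and the last one is dropped as nonnegative.\<close>
  have le: "h z + 2 * t * k z \<le> cv F G z" for z
  proof -
    have "cv F G z = cv f g z + t * cv f g' z + (t * cv f' g z + t * (t * cv f' g' z))"
      unfolding F_def[abs_def] G_def[abs_def]
      by (simp add: cv_add_left cv_add_right f g f' g' tf' tg' Cc_add cv_scale_left cv_scale_right distrib_left)
    moreover have "t * k z \<le> t * cv f g' z" "t * k z \<le> t * cv f' g z"
      using kf kg t0 by (auto intro: mult_left_mono)
    moreover have "0 \<le> t * (t * cv f' g' z)" using t0 Cc_nonneg[OF cv_Cc[OF f' g']] by simp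
    ultimately show ?thesis by (simp add: h_def)
  qed
  \<comment> \<open>The factor \<open>2 powr p\<close>, and with it the gain, comes from adding the
    two mixed terms before the \<open>p\<close>-th power is taken; superadditivity then separates
    \<open>h\<close> from \<open>2 * t * k\<close>.\<close>
  have "(1 + 2 powr p * s) * Q = (\<integral>z. H z + (2 * t) powr p * k1 z \<partial>\<mu>)"
    using Q0 t0 Cc_integrable[OF H] Cc_integrable[OF k1]
    by (simp add: Ik1 powr_mult tp Q_def[symmetric] field_simps)
  also have "\<dots> \<le> (\<integral>z. (h z + 2 * t * k z) powr p \<partial>\<mu>)"
  proof (rule integral_mono)
    show "integrable \<mu> (\<lambda>z. H z + (2 * t) powr p * k1 z)" using Cc_integrable[OF H] Cc_integrable[OF k1] by simp
    show "integrable \<mu> (\<lambda>z. (h z + 2 * t * k z) powr p)"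
      using p by (intro Cc_integrable Cc_powr Cc_add h tk) simp
    fix z
    have "h z powr p + (2 * t * k z) powr p \<le> (h z + 2 * t * k z) powr p"
      using p t0 Cc_nonneg[OF h] Cc_nonneg[OF k] by (intro powr_add_le) auto
    then show "H z + (2 * t) powr p * k1 z \<le> (h z + 2 * t * k z) powr p"
      using t0 Cc_nonneg[OF k, of z] by (simp add: H_def powr_mult kp)
  qed
  also have "\<dots> \<le> (\<integral>z. cv F G z powr p \<partial>\<mu>)"
    using p le by (intro cv_mono_integral_powr Cc_add h tk cv_Cc F G) auto
  finally show thesis using that[OF F G IF IG] by (simp add: Q_def H_def h_def)
qed

text \<open>Iterating \<open>cv_amplify\<close> from a bump function multiplies the quotient of
  masses by at least a fixed \<rho> > 1 each time.\<close>

lemma cv_unbounded: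
  assumes nc: "\<not> compact (UNIV :: 'a set)" and p: "1 < p"
  obtains f g where "f \<in> Cc" "g \<in> Cc"
    "C * ((\<integral>x. f x powr p \<partial>\<mu>) * (\<integral>x. g x powr p \<partial>\<mu>)) < (\<integral>x. cv f g x powr p \<partial>\<mu>)"
proof -
  define N where "N f = (\<integral>x. f x powr p \<partial>\<mu>)" for f :: "'a \<Rightarrow> real"
  have N0: "0 \<le> N f" for f by (simp add: N_def)
  \<comment> \<open>With \<open>2 powr p = 2 * s + 2\<close> the gain
    \<open>1 + 2 * s + 2 * s\<^sup>2\<close> exceeds \<open>(1 + s)\<^sup>2\<close> by
    \<open>s\<^sup>2\<close>.\<close>
  define s where "s = (2 powr p - 2) / 2"
  have "2 powr 1 < 2 powr p" using p by (intro powr_less_mono) auto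
  then have s: "s > 0" and s2: "2 powr p = 2 * s + 2" by (auto simp: s_def field_simps)
  define \<rho> where "\<rho> = (1 + 2 powr p * s) / (1 + s)\<^sup>2"
  have "(1 + s)\<^sup>2 < 1 + 2 powr p * s" using s by (simp add: s2 power2_eq_square algebra_simps)
  then have \<rho>: "\<rho> > 1" using s by (simp add: \<rho>_def)
  have \<rho>s: "\<rho> * (1 + s)\<^sup>2 = 1 + 2 powr p * s" using s by (simp add: \<rho>_def)
  obtain \<phi> where \<phi>: "\<phi> \<in> Cc" "\<phi> 0 = 1"
    by (rule exists_Cc_one[of "{0}" UNIV]) auto
  have "cv \<phi> \<phi> 0 > 0"
    unfolding cv_def using \<phi> by (intro Cc_integral_pos[where x = 0] Cc_mult Cc_reflect) auto
  then have Q0: "N (cv \<phi> \<phi>) > 0"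
    unfolding N_def using p \<phi> by (intro Cc_integral_pos[where x = 0] Cc_powr cv_Cc) auto
  \<comment> \<open>A positive lower bound for the initial quotient; the summand 1 keeps the
    denominator positive at once.\<close>
  define c where "c = N (cv \<phi> \<phi>) / (1 + N \<phi> * N \<phi>)"
  have d: "1 + N \<phi> * N \<phi> > 0" using N0[of \<phi>] by (simp add: add_pos_nonneg)
  have c0: "c > 0" using Q0 d by (simp add: c_def)
  have step: "\<exists>f g. f \<in> Cc \<and> g \<in> Cc \<and> 0 < N (cv f g) \<and> \<rho> ^ n * c * (N f * N g) \<le> N (cv f g)" for n
  proof (induction n)
    case 0
    have "c * (N \<phi> * N \<phi>) \<le> c * (1 + N \<phi> * N \<phi>)" using c0 by (intro mult_left_mono) auto
    also have "\<dots> = N (cv \<phi> \<phi>)" using d by (simp add: c_def)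
    finally show ?case using \<phi> Q0 by auto
  next
    case (Suc n)
    then obtain f g where fg: "f \<in> Cc" "g \<in> Cc" "0 < N (cv f g)" "\<rho> ^ n * c * (N f * N g) \<le> N (cv f g)" by blast
    obtain F G where FG: "F \<in> Cc" "G \<in> Cc" "N F = (1 + s) * N f" "N G = (1 + s) * N g"
        "(1 + 2 powr p * s) * N (cv f g) \<le> N (cv F G)"
      using cv_amplify[OF nc p fg(1,2) _ s] fg(3) unfolding N_def by blast
    have pos: "0 < 1 + 2 powr p * s" using s by (simp add: add_pos_nonneg)
    have "\<rho> ^ Suc n * c * (N F * N G) = \<rho> * (1 + s)\<^sup>2 * (\<rho> ^ n * c * (N f * N g))"
      by (simp add: FG power2_eq_square mult_ac)
    also have "\<dots> \<le> (1 + 2 powr p * s) * N (cv f g)"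
      unfolding \<rho>s using pos fg by (intro mult_left_mono) auto
    also have "\<dots> \<le> N (cv F G)" by (rule FG)
    finally have "\<rho> ^ Suc n * c * (N F * N G) \<le> N (cv F G)" .
    moreover have "0 < N (cv F G)" using FG(5) mult_pos_pos[OF pos fg(3)] by linarith
    ultimately show ?case using FG by blast
  qed
  obtain n where "C / c < \<rho> ^ n" using real_arch_pow[OF \<rho>] by blast
  then have n: "C < \<rho> ^ n * c" using c0 by (simp add: field_simps)
  obtain f g where fg: "f \<in> Cc" "g \<in> Cc" "0 < N (cv f g)" "\<rho> ^ n * c * (N f * N g) \<le> N (cv f g)" using step by blast
  have "C * (N f * N g) < N (cv f g)"
  proof (cases "N f * N g = 0")
    case False
    then have "0 < N f * N g" using N0 by (simp add: less_le)
    then have "C * (N f * N g) < \<rho> ^ n * c * (N f * N g)" using n by (rule mult_strict_right_mono[rotated])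
    then show ?thesis using fg by simp
  next
    case True
    then show ?thesis using fg(3) by (simp only: mult_zero_right)
  qed
  then show thesis using that fg unfolding N_def by blast
qed

section \<open>Convolution on \<open>L\<^sup>p\<close>\<close>

text \<open>Inner regularity gives compact subsets whose measures have supremum
  \<open>emeasure \<mu> U\<close>; since this is finite, the part of \<open>U\<close> outside their
  union is null.\<close>

lemma open_inner_AE:
  assumes U: "open U" and fin: "emeasure \<mu> U < \<infinity>"
  obtains K :: "nat \<Rightarrow> 'a set" where "\<And>n. compact (K n)" "\<And>n. K n \<subseteq> U" "AE x in \<mu>. x \<in> U \<longrightarrow> x \<in> (\<Union>n. K n)"
proof -
  have "{K. compact K \<and> K \<subseteq> U} \<noteq> {}" by (auto intro: exI[of _ "{}"])
  then obtain a :: "nat \<Rightarrow> ennreal" where a: "range a \<subseteq> emeasure \<mu> ` {K. compact K \<and> K \<subseteq> U}"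
      "emeasure \<mu> U = (SUP n. a n)"
    using ennreal_SUP_countable_SUP[of "{K. compact K \<and> K \<subseteq> U}" "emeasure \<mu>"] inner_regular[OF U] by auto
  then have "\<exists>K. compact K \<and> K \<subseteq> U \<and> a n = emeasure \<mu> K" for n by blast
  then obtain K where K: "\<And>n. compact (K n)" "\<And>n. K n \<subseteq> U" "\<And>n. a n = emeasure \<mu> (K n)" by metis
  have [measurable]: "K n \<in> sets borel" "U \<in> sets borel" for n using K U compact_borel by auto
  have "emeasure \<mu> U \<le> emeasure \<mu> (\<Union>n. K n)"
    unfolding a(2) K(3) by (intro SUP_least emeasure_mono) auto
  moreover have "emeasure \<mu> (U - (\<Union>n. K n)) = emeasure \<mu> U - emeasure \<mu> (\<Union>n. K n)"
  proof (rule emeasure_Diff)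
    have "emeasure \<mu> (\<Union>n. K n) \<le> emeasure \<mu> U" using K by (intro emeasure_mono) auto
    then show "emeasure \<mu> (\<Union>n. K n) \<noteq> \<infinity>" using fin by auto
  qed (use K in auto)
  ultimately have "emeasure \<mu> (U - (\<Union>n. K n)) = 0" using fin by (simp add: diff_eq_0_iff_ennreal)
  then have "AE x in \<mu>. x \<notin> U - (\<Union>n. K n)" by (intro AE_not_in) auto
  then have "AE x in \<mu>. x \<in> U \<longrightarrow> x \<in> (\<Union>n. K n)" by (rule AE_mp) auto
  then show thesis using that K by blast
qed

text \<open>A replacement for sigma-finiteness. The open sets where \<open>W\<close> exceeds
  \<open>1 / real (Suc n)\<close> have finite measure, by Markov's inequality on their compact
  subsets and inner regularity. So countably many compact sets carry \<open>W\<close> up to a null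
  set, and monotone convergence applies.\<close>

lemma nn_integral_le_of_compact:
  fixes W :: "'a \<Rightarrow> real"
  assumes cont: "continuous_on UNIV W" and nonneg: "\<And>x. 0 \<le> W x" and C: "C < \<infinity>"
    and le: "\<And>X. compact X \<Longrightarrow> (\<integral>\<^sup>+x. indicator X x * ennreal (W x) \<partial>\<mu>) \<le> C"
  shows "(\<integral>\<^sup>+x. ennreal (W x) \<partial>\<mu>) \<le> C"
proof -
  have [measurable]: "W \<in> borel_measurable borel" by (rule borel_measurable_continuous_onI[OF cont])
  define U where "U n = {x. 1 / real (Suc n) < W x}" for n :: nat
  have U: "open (U n)" for n unfolding U_def by (intro open_Collect_less cont continuous_on_const)
  have fin: "emeasure \<mu> (U n) < \<infinity>" for n
  proof -
    have "emeasure \<mu> K \<le> ennreal (real (Suc n)) * C" if K: "compact K" "K \<subseteq> U n" for K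
    proof -
      have [measurable]: "K \<in> sets borel" by (rule compact_borel[OF K(1)])
      have "emeasure \<mu> K = (\<integral>\<^sup>+x. indicator K x \<partial>\<mu>)" by simp
      also have "\<dots> \<le> (\<integral>\<^sup>+x. ennreal (real (Suc n)) * (indicator K x * ennreal (W x)) \<partial>\<mu>)"
      proof (rule nn_integral_mono)
        fix x
        have "1 \<le> real (Suc n) * W x" if "x \<in> K"
          using that K by (auto simp: U_def field_simps)
        then show "indicator K x \<le> ennreal (real (Suc n)) * (indicator K x * ennreal (W x))"
          using nonneg[of x] by (auto simp: indicator_def ennreal_mult[symmetric] simp del: of_nat_Suc)
      qed
      also have "\<dots> = ennreal (real (Suc n)) * (\<integral>\<^sup>+x. indicator K x * ennreal (W x) \<partial>\<mu>)"
        by (rule nn_integral_cmult) simp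
      also have "\<dots> \<le> ennreal (real (Suc n)) * C" by (intro mult_left_mono le K) auto
      finally show ?thesis .
    qed
    then have "emeasure \<mu> (U n) \<le> ennreal (real (Suc n)) * C"
      unfolding inner_regular[OF U] by (intro SUP_least) auto
    also have "\<dots> < \<infinity>" using C by (simp add: ennreal_mult_less_top)
    finally show ?thesis .
  qed
  have "\<exists>K :: nat \<Rightarrow> 'a set. (\<forall>m. compact (K m)) \<and> (AE x in \<mu>. x \<in> U n \<longrightarrow> x \<in> (\<Union>m. K m))" for n
    by (rule open_inner_AE[OF U fin, of n]) blast
  then obtain K :: "nat \<Rightarrow> nat \<Rightarrow> 'a set" where K: "\<And>n m. compact (K n m)" "\<And>n. AE x in \<mu>. x \<in> U n \<longrightarrow> x \<in> (\<Union>m. K n m)"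
    by metis
  define Z where "Z k = (\<Union>n\<le>k. \<Union>m\<le>k. K n m)" for k
  have Z: "compact (Z k)" for k unfolding Z_def using K by (intro compact_UN) auto
  have [measurable]: "Z k \<in> sets borel" for k by (rule compact_borel[OF Z])
  have inc: "incseq Z" unfolding Z_def by (intro monoI) force
  have "AE x in \<mu>. \<forall>n. x \<in> U n \<longrightarrow> x \<in> (\<Union>m. K n m)" using K by (simp add: AE_all_countable)
  then have "AE x in \<mu>. ennreal (W x) = (SUP k. indicator (Z k) x * ennreal (W x))"
  proof (rule AE_mp, intro AE_I2 impI)
    fix x assume x: "\<forall>n. x \<in> U n \<longrightarrow> x \<in> (\<Union>m. K n m)"
    show "ennreal (W x) = (SUP k. indicator (Z k) x * ennreal (W x))"
    proof (rule antisym)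
      show "ennreal (W x) \<le> (SUP k. indicator (Z k) x * ennreal (W x))"
      proof (cases "W x = 0")
        case False
        then have "0 < W x" using nonneg[of x] by simp
        then obtain n where "1 / real (Suc n) < W x" using nat_approx_posE by blast
        then obtain m where "x \<in> K n m" using x by (auto simp: U_def)
        then have "x \<in> Z (max n m)" unfolding Z_def by force
        then show ?thesis by (intro SUP_upper2[of "max n m"]) auto
      qed simp
    qed (auto intro!: SUP_least simp: indicator_def)
  qed
  then have "(\<integral>\<^sup>+x. ennreal (W x) \<partial>\<mu>) = (\<integral>\<^sup>+x. (SUP k. indicator (Z k) x * ennreal (W x)) \<partial>\<mu>)"
    by (rule nn_integral_cong_AE)
  also have "\<dots> = (SUP k. \<integral>\<^sup>+x. indicator (Z k) x * ennreal (W x) \<partial>\<mu>)"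
    using inc by (intro nn_integral_monotone_convergence_SUP)
      (auto simp: incseq_def le_fun_def indicator_def subset_iff)
  also have "\<dots> \<le> C" using le Z by (intro SUP_least) auto
  finally show ?thesis .
qed

text \<open>Substitute \<open>x + y\<close> for \<open>y\<close>. The common value is the mass of
  the reflected function, which can differ from that of \<open>f\<close> if the group is not
  unimodular.\<close>

lemma integral_reflect:
  assumes "f \<in> Cc"
  shows "(\<integral>y. f (- y + x) \<partial>\<mu>) = (\<integral>y. f (- y) \<partial>\<mu>)"
proof -
  have [measurable]: "f \<in> borel_measurable borel" by (rule Cc_meas[OF assms])
  have "(\<integral>y. (\<lambda>y. f (- y + x)) (x + y) \<partial>\<mu>) = (\<integral>y. f (- y + x) \<partial>\<mu>)"
    by (rule integral_translate) simp
  then show ?thesis by (simp add: minus_add add.assoc)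
qed

lemma Lp_meas: "f \<in> Lp_space \<mu> p \<Longrightarrow> f \<in> borel_measurable borel"
  by (simp add: Lp_space_def cong: measurable_cong_sets)

lemma Lp_integrable_compact:
  assumes g: "g \<in> Lp_space \<mu> p" and p: "1 \<le> p" and L: "compact L"
  shows "integrable \<mu> (\<lambda>y. indicator L y *\<^sub>R g y)"
proof (rule Bochner_Integration.integrable_bound)
  show "integrable \<mu> (\<lambda>y. 1 * indicator L y + norm (g y) powr p)"
    using g by (intro Bochner_Integration.integrable_add integrable_indicator_compact L) (simp add: Lp_space_def)
  show "(\<lambda>y. indicator L y *\<^sub>R g y) \<in> borel_measurable \<mu>"
    using Lp_meas[OF g] compact_borel[OF L] by simp
  show "AE y in \<mu>. norm (indicator L y *\<^sub>R g y) \<le> norm (1 * indicator L y + norm (g y) powr p)"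
    using le_one_plus_powr[OF _ p] by (intro AE_I2) (auto simp: indicator_def)
qed

text \<open>Near a point \<open>x0\<close>, with \<open>x\<close> in a compact neighbourhood
  \<open>X\<close>, only the \<open>y\<close> in the compact set \<open>X - S\<close> contribute.
  There \<open>g\<close> is integrable, so \<open>continuous_on_integral_compact\<close>
  applies.\<close>

lemma convolution_Cc_continuous:
  assumes g: "g \<in> Lp_space \<mu> p" and p: "1 \<le> p" and f: "f \<in> Cc"
  shows "continuous_on UNIV (convolution \<mu> g (\<lambda>x. complex_of_real (f x)))"
proof -
  obtain S where S: "compact S" "\<And>x. x \<notin> S \<Longrightarrow> f x = 0" by (rule CcE[OF f]) blast
  have "isCont (convolution \<mu> g (\<lambda>x. complex_of_real (f x))) x0" for x0
  proof -
    obtain U X :: "'a set" where U: "open U" "compact X" "x0 \<in> U" "U \<subseteq> X" using compact_nhd by blast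
    define L where "L = {a + b |a b. a \<in> X \<and> b \<in> uminus ` S}"
    have L: "compact L" unfolding L_def by (intro compact_sum compact_uminus U S)
    have "continuous_on UNIV (\<lambda>(x, y). f (- y + x))"
      unfolding case_prod_unfold by (intro Cc_cont_on[OF f] continuous_intros)
    then have "continuous_on UNIV (\<lambda>x. \<integral>y. f (- y + x) *\<^sub>R (indicator L y *\<^sub>R g y) \<partial>\<mu>)"
      by (rule continuous_on_integral_compact[OF _ L]) (auto intro: Lp_integrable_compact[OF g p L])
    then have "continuous_on U (\<lambda>x. \<integral>y. f (- y + x) *\<^sub>R (indicator L y *\<^sub>R g y) \<partial>\<mu>)"
      by (rule continuous_on_subset) simp
    moreover have "(\<integral>y. f (- y + x) *\<^sub>R (indicator L y *\<^sub>R g y) \<partial>\<mu>) = convolution \<mu> g (\<lambda>x. complex_of_real (f x)) x" if "x \<in> U" for x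
      unfolding convolution_def
    proof (rule Bochner_Integration.integral_cong)
      fix y
      show "f (- y + x) *\<^sub>R (indicator L y *\<^sub>R g y) = g y * complex_of_real (f (- y + x))"
      proof (cases "- y + x \<in> S")
        case True
        have "x + - (- y + x) = y" by (simp only: minus_add minus_minus add_minus_cancel)
        then have "y \<in> L" unfolding L_def using True U that by force
        then show ?thesis by (simp add: scaleR_conv_of_real mult.commute)
      qed (simp add: S(2))
    qed simp
    ultimately have "continuous_on U (convolution \<mu> g (\<lambda>x. complex_of_real (f x)))"
      by (simp cong: continuous_on_cong)
    then show ?thesis using U by (simp add: continuous_on_eq_continuous_at)
  qed
  then show ?thesis by (simp add: continuous_at_imp_continuous_on)
qed

text \<open>Young's inequality. Jensen with weight \<open>f (- y + x)\<close>, of mass independent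
  of \<open>x\<close>, bounds \<open>norm (convolution ...) powr p\<close> by that mass to the power
  \<open>p - 1\<close> times the convolution of \<open>norm (g y) powr p\<close> with
  \<open>f\<close>; left invariance then evaluates the integral over \<open>x\<close>, compact set
  by compact set.\<close>

lemma convolution_Cc:
  assumes g: "g \<in> Lp_space \<mu> p" and p: "1 \<le> p" and f: "f \<in> Cc"
  defines "c \<equiv> (\<integral>y. f (- y) \<partial>\<mu>) powr (p - 1) * (\<integral>x. f x \<partial>\<mu>)"
  shows "convolution_exists \<mu> g (\<lambda>x. complex_of_real (f x))"
    and "convolution \<mu> g (\<lambda>x. complex_of_real (f x)) \<in> Lp_space \<mu> p"
    and "(\<integral>x. norm (convolution \<mu> g (\<lambda>x. complex_of_real (f x)) x) powr p \<partial>\<mu>) \<le> c * (\<integral>x. norm (g x) powr p \<partial>\<mu>)"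
proof -
  have [measurable]: "f \<in> borel_measurable borel" "g \<in> borel_measurable borel"
    using Cc_meas[OF f] Lp_meas[OF g] by auto
  define G where "G y = norm (g y) powr p" for y
  have [measurable]: "G \<in> borel_measurable borel" by (simp add: G_def[abs_def])
  have G0: "0 \<le> G y" for y by (simp add: G_def)
  have intG: "integrable \<mu> G" using g by (simp add: Lp_space_def G_def[abs_def])
  define d where "d = (\<integral>y. f (- y) \<partial>\<mu>)"
  define conv where "conv = convolution \<mu> g (\<lambda>x. complex_of_real (f x))"
  have cont: "continuous_on UNIV conv" unfolding conv_def by (rule convolution_Cc_continuous[OF g p f])
  then have [measurable]: "conv \<in> borel_measurable borel" by (rule borel_measurable_continuous_onI)
  obtain B where B: "0 \<le> B" "\<And>x. f x \<le> B" by (rule Cc_bounded[OF f]) blast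
  have int1: "integrable \<mu> (\<lambda>y. G y * f (- y + x))" for x
  proof (rule Bochner_Integration.integrable_bound)
    show "integrable \<mu> (\<lambda>y. G y * B)" using intG by simp
    show "AE y in \<mu>. norm (G y * f (- y + x)) \<le> norm (G y * B)"
      using B G0 Cc_nonneg[OF f] by (intro AE_I2) (auto simp: abs_mult intro!: mult_mono)
  qed simp
  have int2: "integrable \<mu> (\<lambda>y. norm (g y) * f (- y + x))"
    and le2: "(\<integral>y. norm (g y) * f (- y + x) \<partial>\<mu>) powr p \<le> d powr (p - 1) * (\<integral>y. G y * f (- y + x) \<partial>\<mu>)" for x
    using jensen_weighted[of "\<lambda>y. norm (g y)" \<mu> "\<lambda>y. f (- y + x)" p] int1[of x] p
      Cc_integrable[OF Cc_reflect[OF f]] integral_reflect[OF f, of x]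
    by (auto simp: G_def d_def Cc_nonneg[OF f])
  have int3: "integrable \<mu> (\<lambda>y. g y * complex_of_real (f (- y + x)))" for x
    using int2[of x] by (rule Bochner_Integration.integrable_bound) (auto simp: norm_mult)
  then show "convolution_exists \<mu> g (\<lambda>x. complex_of_real (f x))" by (simp add: convolution_exists_def)
  have le: "norm (conv x) powr p \<le> d powr (p - 1) * (\<integral>y. G y * f (- y + x) \<partial>\<mu>)" for x
  proof -
    have "norm (conv x) \<le> (\<integral>y. norm (g y * complex_of_real (f (- y + x))) \<partial>\<mu>)"
      unfolding conv_def convolution_def by (rule integral_norm_bound)
    also have "\<dots> = (\<integral>y. norm (g y) * f (- y + x) \<partial>\<mu>)"
      by (simp add: norm_mult Cc_nonneg[OF f])
    finally have "norm (conv x) powr p \<le> (\<integral>y. norm (g y) * f (- y + x) \<partial>\<mu>) powr p"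
      using p by (intro powr_mono2) auto
    then show ?thesis using le2 order_trans by blast
  qed
  have nn: "(\<integral>\<^sup>+x. ennreal (norm (conv x) powr p) \<partial>\<mu>) \<le> ennreal (c * (\<integral>y. G y \<partial>\<mu>))"
  proof (rule nn_integral_le_of_compact)
    show "continuous_on UNIV (\<lambda>x. norm (conv x) powr p)"
      using p by (intro continuous_on_powr' continuous_intros cont) auto
    fix X :: "'a set" assume X: "compact X"
    have [measurable]: "X \<in> sets borel" by (rule compact_borel[OF X])
    have GX: "(\<integral>\<^sup>+y. ennreal (G y) \<partial>\<mu>) = ennreal (\<integral>y. G y \<partial>\<mu>)"
      by (intro nn_integral_eq_integral intG) (simp add: G0)
    have eq: "ennreal (\<integral>y. G y * f (- y + x) \<partial>\<mu>) = (\<integral>\<^sup>+y. ennreal (G y) * ennreal (f (- y + x)) \<partial>\<mu>)" for x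
      using int1[of x] G0 Cc_nonneg[OF f]
      by (subst nn_integral_eq_integral[symmetric]) (auto simp: ennreal_mult)
    \<comment> \<open>Measurability of the convolution of \<open>G\<close> with \<open>f\<close>
      follows from its continuity, which is the case of exponent 1 of the preceding lemma.\<close>
    have Gp: "(\<lambda>x. complex_of_real (G x)) \<in> Lp_space \<mu> 1"
      using intG G0 by (simp add: Lp_space_def)
    have "continuous_on UNIV (\<lambda>x. convolution \<mu> (\<lambda>x. complex_of_real (G x)) (\<lambda>x. complex_of_real (f x)) x)"
      by (rule convolution_Cc_continuous[OF Gp _ f]) simp
    then have "(\<lambda>x. Re (convolution \<mu> (\<lambda>x. complex_of_real (G x)) (\<lambda>x. complex_of_real (f x)) x)) \<in> borel_measurable borel"
      by (intro borel_measurable_continuous_onI continuous_intros) (simp add: G0)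
    moreover have "convolution \<mu> (\<lambda>x. complex_of_real (G x)) (\<lambda>x. complex_of_real (f x)) x = complex_of_real (\<integral>y. G y * f (- y + x) \<partial>\<mu>)" for x
      unfolding convolution_def of_real_mult[symmetric] by (rule integral_complex_of_real)
    ultimately have [measurable]: "(\<lambda>x. \<integral>y. G y * f (- y + x) \<partial>\<mu>) \<in> borel_measurable borel" by simp
    have "(\<integral>\<^sup>+x. indicator X x * ennreal (norm (conv x) powr p) \<partial>\<mu>)
        \<le> (\<integral>\<^sup>+x. ennreal (d powr (p - 1)) * (indicator X x * ennreal (\<integral>y. G y * f (- y + x) \<partial>\<mu>)) \<partial>\<mu>)"
      using le by (intro nn_integral_mono) (auto simp: indicator_def ennreal_mult'[symmetric] intro!: ennreal_leI)
    also have "\<dots> = ennreal (d powr (p - 1)) * (\<integral>\<^sup>+x. indicator X x * (\<integral>\<^sup>+y. ennreal (G y) * ennreal (f (- y + x)) \<partial>\<mu>) \<partial>\<mu>)"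
      unfolding eq[symmetric] by (rule nn_integral_cmult) simp
    also have "\<dots> \<le> ennreal (d powr (p - 1)) * ((\<integral>\<^sup>+y. ennreal (G y) \<partial>\<mu>) * ennreal (\<integral>x. f x \<partial>\<mu>))"
      by (intro mult_left_mono nn_integral_conv_le f X) (auto simp: GX)
    also have "\<dots> = ennreal (c * (\<integral>y. G y \<partial>\<mu>))"
      using G0 Cc_nonneg[OF f] by (simp add: GX c_def d_def ennreal_mult'[symmetric] mult_ac)
    finally show "(\<integral>\<^sup>+x. indicator X x * ennreal (norm (conv x) powr p) \<partial>\<mu>) \<le> ennreal (c * (\<integral>y. G y \<partial>\<mu>))" .
  qed auto
  have c0: "0 \<le> c * (\<integral>y. G y \<partial>\<mu>)"
    using G0 Cc_nonneg[OF f] by (auto simp: c_def)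
  have int4: "integrable \<mu> (\<lambda>x. norm (conv x) powr p)"
    using nn by (intro integrableI_bounded) (auto intro: le_less_trans)
  then show "convolution \<mu> g (\<lambda>x. complex_of_real (f x)) \<in> Lp_space \<mu> p"
    by (simp add: Lp_space_def conv_def[symmetric] cong: measurable_cong_sets)
  have "ennreal (\<integral>x. norm (conv x) powr p \<partial>\<mu>) \<le> ennreal (c * (\<integral>y. G y \<partial>\<mu>))"
    using nn int4 by (subst nn_integral_eq_integral[symmetric]) auto
  then show "(\<integral>x. norm (convolution \<mu> g (\<lambda>x. complex_of_real (f x)) x) powr p \<partial>\<mu>) \<le> c * (\<integral>x. norm (g x) powr p \<partial>\<mu>)"
    using c0 by (simp add: conv_def[symmetric] G_def[symmetric])
qed

lemma Cc_Lp:
  assumes "f \<in> Cc" "0 < p"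
  shows "(\<lambda>x. complex_of_real (f x)) \<in> Lp_space \<mu> p"
  using Cc_integrable[OF Cc_powr[OF assms]] Cc_meas[OF assms(1)] Cc_nonneg[OF assms(1)]
  by (simp add: Lp_space_def cong: measurable_cong_sets)

text \<open>Makes the functions in \<open>Cc\<close> available as test functions for bounds on
  \<open>LpT_space\<close>.\<close>

lemma Cc_LpT:
  assumes f: "f \<in> Cc" and p: "1 \<le> p"
  shows "(\<lambda>x. complex_of_real (f x)) \<in> LpT_space \<mu> p"
proof -
  have "LpT_norm \<mu> p (\<lambda>x. complex_of_real (f x)) \<le> ennreal (((\<integral>y. f (- y) \<partial>\<mu>) powr (p - 1) * (\<integral>x. f x \<partial>\<mu>)) powr (1 / p))"
    using p Cc_nonneg[OF f] by (intro LpT_norm_leI convolution_Cc[OF _ p f]) auto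
  then have "LpT_norm \<mu> p (\<lambda>x. complex_of_real (f x)) < \<infinity>" by (rule le_less_trans) simp
  then show ?thesis using Cc_Lp[OF f] convolution_Cc(1)[OF _ p f] p by (simp add: LpT_space_def)
qed

text \<open>The supremum over the unit ball is extended to all \<open>g\<close> by homogeneity.
  Since \<open>Lp_norm\<close> is infinite off the space, a finite bound also yields membership in
  L^p.\<close>

lemma LpT_normD:
  assumes f: "LpT_norm \<mu> p f \<le> ennreal B" "0 \<le> B" and g: "g \<in> Cc" and p: "1 \<le> p"
  shows "convolution \<mu> (\<lambda>x. complex_of_real (g x)) f \<in> Lp_space \<mu> p"
    and "(\<integral>x. norm (convolution \<mu> (\<lambda>x. complex_of_real (g x)) f x) powr p \<partial>\<mu>) \<le> B powr p * (\<integral>x. g x powr p \<partial>\<mu>)"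
proof -
  define N where "N = (\<integral>x. g x powr p \<partial>\<mu>)"
  have N0: "0 \<le> N" by (simp add: N_def)
  define g' where "g' x = complex_of_real (g x)" for x
  have gL: "g' \<in> Lp_space \<mu> p" unfolding g'_def[abs_def] using p by (intro Cc_Lp g) simp
  have "convolution \<mu> g' f \<in> Lp_space \<mu> p \<and> (\<integral>x. norm (convolution \<mu> g' f x) powr p \<partial>\<mu>) \<le> B powr p * N"
  proof (cases "N = 0")
    case True
    have "g x = 0" for x
    proof (rule ccontr)
      assume "g x \<noteq> 0"
      then have "N > 0" unfolding N_def using p Cc_nonneg[OF g, of x] by (intro Cc_integral_pos[where x = x] Cc_powr g) auto
      then show False using True by simp
    qed
    then have "convolution \<mu> g' f = (\<lambda>x. 0)" by (simp add: g'_def convolution_def fun_eq_iff)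
    then show ?thesis using True p by (simp add: Lp_space_def)
  next
    case False
    then have N: "N > 0" using N0 by simp
    \<comment> \<open>Scales \<open>g'\<close> to L^p norm 1. The case \<open>N = 0\<close> had to
      be split off, since there \<open>g\<close> vanishes identically.\<close>
    define a where "a = N powr (- 1 / p)"
    have "a powr p = N powr (- 1)" using p by (simp add: a_def powr_powr)
    then have a: "a > 0" "a powr p = 1 / N" using N by (auto simp: a_def powr_minus_divide)
    define g0 where "g0 x = complex_of_real a * g' x" for x
    have n0: "norm (complex_of_real a * z) powr p = norm z powr p / N" for z
      using a by (simp add: norm_mult powr_mult)
    have g0: "g0 \<in> Lp_space \<mu> p"
      using gL unfolding Lp_space_def g0_def[abs_def] by (auto simp: n0 intro!: borel_measurable_times)
    have "(\<integral>x. norm (g0 x) powr p \<partial>\<mu>) = 1"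
      using N Cc_nonneg[OF g] by (simp add: g0_def n0 g'_def N_def)
    then have "Lp_norm \<mu> p g0 \<le> 1" using g0 by (simp add: Lp_norm_eq)
    then have "Lp_norm \<mu> p (convolution \<mu> g0 f) \<le> LpT_norm \<mu> p f"
      unfolding LpT_norm_def using g0 by (intro SUP_upper) auto
    then have "Lp_norm \<mu> p (convolution \<mu> g0 f) \<le> ennreal B" using f(1) by (rule order_trans)
    then have L0: "convolution \<mu> g0 f \<in> Lp_space \<mu> p" "(\<integral>x. norm (convolution \<mu> g0 f x) powr p \<partial>\<mu>) \<le> B powr p"
      using p f by (auto simp: Lp_norm_le_iff)
    have conv0: "convolution \<mu> g0 f = (\<lambda>x. complex_of_real a * convolution \<mu> g' f x)"
      unfolding g0_def[abs_def] by (rule ext) (rule convolution_cmult)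
    have conv: "convolution \<mu> g' f = (\<lambda>x. complex_of_real (1 / a) * convolution \<mu> g0 f x)"
      using a by (simp add: conv0)
    have "convolution \<mu> g' f \<in> borel_measurable \<mu>"
      unfolding conv using L0(1) by (intro borel_measurable_times) (auto simp: Lp_space_def)
    moreover have "integrable \<mu> (\<lambda>x. norm (convolution \<mu> g' f x) powr p / N * N)"
      using L0(1) by (intro integrable_mult_left) (simp add: Lp_space_def conv0 n0)
    ultimately have "convolution \<mu> g' f \<in> Lp_space \<mu> p"
      using N by (simp add: Lp_space_def)
    moreover have "(\<integral>x. norm (convolution \<mu> g' f x) powr p \<partial>\<mu>) / N \<le> B powr p"
      using L0(2) by (simp add: conv0 n0)
    ultimately show ?thesis using N by (simp add: field_simps)
  qed
  then show "convolution \<mu> (\<lambda>x. complex_of_real (g x)) f \<in> Lp_space \<mu> p"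
    "(\<integral>x. norm (convolution \<mu> (\<lambda>x. complex_of_real (g x)) f x) powr p \<partial>\<mu>) \<le> B powr p * (\<integral>x. g x powr p \<partial>\<mu>)"
    by (simp_all add: g'_def[abs_def] N_def)
qed

section \<open>Compactness from a norm bound and from equality of the spaces\<close>

lemma convolution_Cc_eq:
  "convolution \<mu> (\<lambda>x. complex_of_real (g x)) (\<lambda>x. complex_of_real (f x)) x = complex_of_real (\<integral>y. g y * f (- y + x) \<partial>\<mu>)"
  unfolding convolution_def of_real_mult[symmetric] by (rule integral_complex_of_real)

text \<open>Tested on functions in \<open>Cc\<close>, the bound says that convolution is bounded
  with constant \<open>K\<close> there, against \<open>cv_unbounded\<close>.\<close>

lemma LpT_norm_bounded_imp_compact:
  assumes p: "1 < p" and K: "K > 0" "\<And>f. f \<in> LpT_space \<mu> p \<Longrightarrow> LpT_norm \<mu> p f \<le> ennreal K * Lp_norm \<mu> p f"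
  shows "compact (UNIV :: 'a set)"
proof (rule ccontr)
  assume nc: "\<not> compact (UNIV :: 'a set)"
  obtain g f where gf: "g \<in> Cc" "f \<in> Cc"
    "K powr p * ((\<integral>x. g x powr p \<partial>\<mu>) * (\<integral>x. f x powr p \<partial>\<mu>)) < (\<integral>x. cv g f x powr p \<partial>\<mu>)"
    by (rule cv_unbounded[OF nc p, of "K powr p"]) blast
  define N where "N = (\<integral>x. f x powr p \<partial>\<mu>)"
  have N0: "0 \<le> N" by (simp add: N_def)
  have "Lp_norm \<mu> p (\<lambda>x. complex_of_real (f x)) = ennreal (N powr (1 / p))"
    using p Cc_nonneg[OF gf(2)] by (simp add: Lp_norm_eq Cc_Lp gf N_def)
  then have "LpT_norm \<mu> p (\<lambda>x. complex_of_real (f x)) \<le> ennreal (K * N powr (1 / p))"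
    using K(2)[OF Cc_LpT[OF gf(2), of p]] p K(1) by (simp add: ennreal_mult)
  from LpT_normD(2)[OF this _ gf(1)] have
    "(\<integral>x. norm (complex_of_real (cv g f x)) powr p \<partial>\<mu>) \<le> (K * N powr (1 / p)) powr p * (\<integral>x. g x powr p \<partial>\<mu>)"
    using p K(1) by (simp add: convolution_Cc_eq cv_def)
  also have "\<dots> = K powr p * ((\<integral>x. g x powr p \<partial>\<mu>) * N)"
    using p K(1) N0 by (simp add: powr_mult powr_powr)
  finally show False using gf(3) Cc_nonneg[OF cv_Cc[OF gf(1,2)]] by (simp add: N_def)
qed

text \<open>Gliding hump. Take pairs whose quotient of masses exceeds \<open>4 ^ n\<close> and let
  F^p be the sum of the f_n^p scaled to mass \<open>(1 / 2) ^ n\<close>. Then \<open>F\<close> is in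
  L^p, hence convolution with it has some bound \<open>B\<close>. But \<open>F\<close> dominates
  each scaled f_n almost everywhere, so testing with g_n gives \<open>2 ^ n \<le> B powr p\<close>
  for every \<open>n\<close>.\<close>

lemma Lp_eq_LpT_imp_compact:
  assumes p: "1 < p" and eq: "Lp_space \<mu> p = LpT_space \<mu> p"
  shows "compact (UNIV :: 'a set)"
proof (rule ccontr)
  assume nc: "\<not> compact (UNIV :: 'a set)"
  define N where "N f = (\<integral>x. f x powr p \<partial>\<mu>)" for f :: "'a \<Rightarrow> real"
  have N0: "0 \<le> N f" for f by (simp add: N_def)
  have "\<exists>g f. g \<in> Cc \<and> f \<in> Cc \<and> 4 ^ n * (N g * N f) < N (cv g f)" for n :: nat
    using cv_unbounded[OF nc p, of "4 ^ n"] unfolding N_def by blast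
  then obtain g f where g: "\<And>n. g n \<in> Cc" and f: "\<And>n. f n \<in> Cc"
    and big: "\<And>n :: nat. 4 ^ n * (N (g n) * N (f n)) < N (cv (g n) (f n))" by metis
  have [measurable]: "g n \<in> borel_measurable borel" "f n \<in> borel_measurable borel" for n
    using Cc_meas[OF g] Cc_meas[OF f] by auto
  have Npos: "N h > 0" if "h \<in> Cc" "h x \<noteq> 0" for h x
    unfolding N_def using p that Cc_nonneg[OF that(1), of x] by (intro Cc_integral_pos[where x = x] Cc_powr) auto
  \<comment> \<open>The strict inequality \<open>big\<close> makes the convolution nonzero, so
    neither factor vanishes identically.\<close>
  have Nf: "N (f n) > 0" and Ng: "N (g n) > 0" for n
  proof -
    have "0 \<le> 4 ^ n * (N (g n) * N (f n))" using N0 by simp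
    then have *: "N (cv (g n) (f n)) \<noteq> 0" using big[of n] by linarith
    have "\<exists>x. f n x \<noteq> 0"
    proof (rule ccontr)
      assume "\<not> ?thesis"
      then have "cv (g n) (f n) = (\<lambda>x. 0)" by (simp add: cv_def fun_eq_iff)
      then show False using * p by (simp add: N_def)
    qed
    then show "N (f n) > 0" using Npos[OF f] by blast
    have "\<exists>x. g n x \<noteq> 0"
    proof (rule ccontr)
      assume "\<not> ?thesis"
      then have "cv (g n) (f n) = (\<lambda>x. 0)" by (simp add: cv_def fun_eq_iff)
      then show False using * p by (simp add: N_def)
    qed
    then show "N (g n) > 0" using Npos[OF g] by blast
  qed
  define a where "a n = (1 / 2) ^ n / N (f n)" for n
  have a: "a n > 0" for n using Nf by (simp add: a_def)
  define u where "u n x = a n * f n x powr p" for n x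
  have u: "u n \<in> Cc" for n unfolding u_def[abs_def] using p a by (intro Cc_scale Cc_powr f) (auto simp: less_imp_le)
  have [measurable]: "u n \<in> borel_measurable borel" for n by (rule Cc_meas[OF u])
  have Iu: "(\<integral>x. u n x \<partial>\<mu>) = (1 / 2) ^ n" for n
    using Nf[of n] by (simp add: u_def a_def N_def)
  have nu: "(\<integral>\<^sup>+x. ennreal (u n x) \<partial>\<mu>) = ennreal ((1 / 2) ^ n)" for n
    unfolding Iu[symmetric] by (intro nn_integral_eq_integral Cc_integrable u) (simp add: Cc_nonneg[OF u])
  have geom: "(\<Sum>n. ennreal ((1 / 2) ^ n)) = ennreal 2"
    using suminf_geometric[of "1 / 2 :: real"] by (subst suminf_ennreal2) auto
  define W where "W x = (\<Sum>n. ennreal (u n x))" for x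
  have [measurable]: "W \<in> borel_measurable borel" unfolding W_def[abs_def] by measurable
  have IW: "(\<integral>\<^sup>+x. W x \<partial>\<mu>) = ennreal 2"
    unfolding W_def by (subst nn_integral_suminf) (simp_all add: nu geom)
  \<comment> \<open>\<open>W\<close> may be infinite on a null set, where \<open>F\<close> is \<open>0\<close> and does not dominate \<open>u n\<close>\<close>
  define F where "F x = enn2real (W x) powr (1 / p)" for x
  have [measurable]: "F \<in> borel_measurable borel" unfolding F_def[abs_def] by measurable
  have F0: "0 \<le> F x" for x by (simp add: F_def)
  have FL: "(\<lambda>x. complex_of_real (F x)) \<in> Lp_space \<mu> p"
  proof -
    have "integrable \<mu> (\<lambda>x. enn2real (W x))"
    proof (rule integrableI_bounded)
      have "(\<integral>\<^sup>+x. ennreal (norm (enn2real (W x))) \<partial>\<mu>) \<le> (\<integral>\<^sup>+x. W x \<partial>\<mu>)"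
        by (intro nn_integral_mono) (simp add: ennreal_enn2real_if)
      then show "(\<integral>\<^sup>+x. ennreal (norm (enn2real (W x))) \<partial>\<mu>) < \<infinity>" by (simp add: IW le_less_trans)
    qed simp
    then show ?thesis using p by (simp add: Lp_space_def F_def powr_powr cong: measurable_cong_sets)
  qed
  then have FT: "(\<lambda>x. complex_of_real (F x)) \<in> LpT_space \<mu> p" using eq by simp
  then obtain B where B: "0 \<le> B" "LpT_norm \<mu> p (\<lambda>x. complex_of_real (F x)) \<le> ennreal B"
    by (cases "LpT_norm \<mu> p (\<lambda>x. complex_of_real (F x))") (auto simp: LpT_space_def)
  have main: "2 ^ n \<le> B powr p" for n :: nat
  proof -
    define h where "h = cv (g n) (f n)"
    have h: "h \<in> Cc" unfolding h_def by (intro cv_Cc g f)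
    obtain X where X: "compact X" "\<And>x. x \<notin> X \<Longrightarrow> h x = 0" by (rule CcE[OF h]) blast
    have [measurable]: "X \<in> sets borel" by (rule compact_borel[OF X(1)])
    define V where "V x = (\<integral>y. g n y * F (- y + x) \<partial>\<mu>)" for x
    have conv: "convolution \<mu> (\<lambda>x. complex_of_real (g n x)) (\<lambda>x. complex_of_real (F x)) x = complex_of_real (V x)" for x
      by (simp add: convolution_Cc_eq V_def)
    have V0: "0 \<le> V x" for x unfolding V_def using F0 Cc_nonneg[OF g] by simp
    have VL: "(\<lambda>x. complex_of_real (V x)) \<in> Lp_space \<mu> p" and IV: "(\<integral>x. V x powr p \<partial>\<mu>) \<le> B powr p * N (g n)"
      using LpT_normD[OF B(2,1) g[of n]] p V0 unfolding conv by (auto simp: N_def)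
    have intV: "integrable \<mu> (\<lambda>x. V x powr p)" using VL V0 by (simp add: Lp_space_def)
    have ex: "AE x in \<mu>. integrable \<mu> (\<lambda>y. g n y * F (- y + x))"
    proof -
      have "convolution_exists \<mu> (\<lambda>x. complex_of_real (g n x)) (\<lambda>x. complex_of_real (F x))"
        using FT Cc_Lp[OF g[of n], of p] p by (simp add: LpT_space_def)
      then show ?thesis
        unfolding convolution_exists_def of_real_mult[symmetric] complex_of_real_integrable_eq .
    qed
    have nng: "(\<integral>\<^sup>+y. ennreal (g n y) \<partial>\<mu>) = ennreal (\<integral>y. g n y \<partial>\<mu>)"
      by (intro nn_integral_eq_integral Cc_integrable g) (simp add: Cc_nonneg[OF g])
    have cvm: "(\<integral>\<^sup>+y. ennreal (g n y) * ennreal (u m (- y + x)) \<partial>\<mu>) = ennreal (cv (g n) (u m) x)" for m x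
      unfolding cv_def using cv_integrable[OF g[of n] u[of m]] Cc_nonneg[OF g] Cc_nonneg[OF u]
      by (subst nn_integral_eq_integral[symmetric]) (auto simp: ennreal_mult)
    have [measurable]: "cv (g n) (u m) \<in> borel_measurable borel" for m by (intro Cc_meas cv_Cc g u)
    have inner: "(\<integral>\<^sup>+y. ennreal (g n y) * W (- y + x) \<partial>\<mu>) = (\<Sum>m. ennreal (cv (g n) (u m) x))" for x
      \<comment> \<open>Countable additivity turns the convolution of g_n with \<open>W\<close> into
        a series of continuous functions, which is measurable in \<open>x\<close>.\<close>
      unfolding W_def cvm[symmetric] by (subst nn_integral_suminf[symmetric]) (auto simp: ennreal_suminf_cmult)
    \<comment> \<open>For almost all \<open>x\<close> in \<open>X\<close> the convolution of g_n
      with \<open>W\<close> is finite. For such \<open>x\<close>, almost no \<open>y\<close> with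
      \<open>g n y\<close> nonzero meets a point where \<open>W\<close> is infinite, so there
      \<open>F\<close> does dominate the scaled f_n.\<close>
    have "(\<integral>\<^sup>+x. indicator X x * (\<integral>\<^sup>+y. ennreal (g n y) * W (- y + x) \<partial>\<mu>) \<partial>\<mu>)
        = (\<Sum>m. \<integral>\<^sup>+x. indicator X x * (\<integral>\<^sup>+y. ennreal (g n y) * ennreal (u m (- y + x)) \<partial>\<mu>) \<partial>\<mu>)"
      unfolding inner cvm ennreal_suminf_cmult[symmetric] by (rule nn_integral_suminf) simp
    also have "\<dots> \<le> (\<Sum>m. ennreal (\<integral>y. g n y \<partial>\<mu>) * ennreal ((1 / 2) ^ m))"
    proof (intro suminf_le allI)
      fix m
      show "(\<integral>\<^sup>+x. indicator X x * (\<integral>\<^sup>+y. ennreal (g n y) * ennreal (u m (- y + x)) \<partial>\<mu>) \<partial>\<mu>)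
          \<le> ennreal (\<integral>y. g n y \<partial>\<mu>) * ennreal ((1 / 2) ^ m)"
        using nn_integral_conv_le[OF _ _ u[of m] X(1), of "\<lambda>y. ennreal (g n y)"] by (simp add: nng Iu)
    qed auto
    also have "\<dots> = ennreal (\<integral>y. g n y \<partial>\<mu>) * ennreal 2" by (simp add: ennreal_suminf_cmult geom)
    also have "\<dots> < \<infinity>" by (simp add: ennreal_mult_less_top)
    finally have "AE x in \<mu>. indicator X x * (\<integral>\<^sup>+y. ennreal (g n y) * W (- y + x) \<partial>\<mu>) \<noteq> \<infinity>"
      by (intro nn_integral_PInf_AE) (auto simp: inner)
    then have "AE x in \<mu>. (a n) powr (1 / p) * h x \<le> V x"
      using ex
    proof eventually_elim
      fix x assume fin: "indicator X x * (\<integral>\<^sup>+y. ennreal (g n y) * W (- y + x) \<partial>\<mu>) \<noteq> \<infinity>"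
        and int: "integrable \<mu> (\<lambda>y. g n y * F (- y + x))"
      show "(a n) powr (1 / p) * h x \<le> V x"
      proof (cases "x \<in> X")
        case True
        then have "(\<integral>\<^sup>+y. ennreal (g n y) * W (- y + x) \<partial>\<mu>) \<noteq> \<infinity>" using fin by simp
        then have "AE y in \<mu>. ennreal (g n y) * W (- y + x) \<noteq> \<infinity>"
          by (intro nn_integral_PInf_AE) auto
        then have "AE y in \<mu>. g n y * (a n powr (1 / p) * f n (- y + x)) \<le> g n y * F (- y + x)"
        proof eventually_elim
          fix y assume y: "ennreal (g n y) * W (- y + x) \<noteq> \<infinity>"
          show "g n y * (a n powr (1 / p) * f n (- y + x)) \<le> g n y * F (- y + x)"
          proof (cases "g n y = 0")
            case False
            then have gy: "g n y > 0" using Cc_nonneg[OF g, of n y] by simp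
            then have Wfin: "W (- y + x) < \<infinity>" using y by (auto simp: ennreal_mult_eq_top_iff less_top)
            have "ennreal (u n (- y + x)) \<le> W (- y + x)"
              unfolding W_def using sum_le_suminf[of "\<lambda>n. ennreal (u n (- y + x))" "{n}"] by simp
            then have "u n (- y + x) \<le> enn2real (W (- y + x))"
              using Wfin Cc_nonneg[OF u] by (metis enn2real_ennreal enn2real_mono infinity_ennreal_def)
            then have "u n (- y + x) powr (1 / p) \<le> F (- y + x)"
              unfolding F_def using p Cc_nonneg[OF u] by (intro powr_mono2) auto
            then have "a n powr (1 / p) * f n (- y + x) \<le> F (- y + x)"
              using a[of n] p Cc_nonneg[OF f] by (simp add: u_def powr_mult powr_powr)
            then show ?thesis using gy by (intro mult_left_mono) auto
          qed simp
        qed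
        moreover have "integrable \<mu> (\<lambda>y. g n y * (a n powr (1 / p) * f n (- y + x)))"
          using cv_integrable[OF g[of n] f[of n], of x] unfolding mult.left_commute[of "g n _" "a n powr _"]
          by (rule integrable_mult_right)
        ultimately have "(\<integral>y. g n y * (a n powr (1 / p) * f n (- y + x)) \<partial>\<mu>) \<le> V x"
          unfolding V_def by (intro integral_mono_AE int)
        then show ?thesis
          unfolding mult.left_commute[of "g n _" "a n powr _"] by (simp add: h_def cv_def)
      qed (use V0 in \<open>simp add: X(2)\<close>)
    qed
    then have "AE x in \<mu>. a n * h x powr p \<le> V x powr p"
    proof eventually_elim
      fix x assume "(a n) powr (1 / p) * h x \<le> V x"
      then have "((a n) powr (1 / p) * h x) powr p \<le> V x powr p"
        using p Cc_nonneg[OF h] by (intro powr_mono2) auto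
      then show "a n * h x powr p \<le> V x powr p"
        using p a[of n] Cc_nonneg[OF h] by (simp add: powr_mult powr_powr)
    qed
    then have "(\<integral>x. a n * h x powr p \<partial>\<mu>) \<le> (\<integral>x. V x powr p \<partial>\<mu>)"
      using p by (intro integral_mono_AE intV integrable_mult_right Cc_integrable Cc_powr h) auto
    then have "a n * N h \<le> B powr p * N (g n)" using IV by (simp add: N_def)
    moreover have "a n * (4 ^ n * (N (g n) * N (f n))) \<le> a n * N h"
      using big[of n] a[of n] by (intro mult_left_mono) (auto simp: h_def)
    \<comment> \<open>The weight \<open>(1 / 2) ^ n\<close> inside \<open>a n\<close> uses up only
      half of the exponent in \<open>4 ^ n\<close>.\<close>
    moreover have "a n * (4 ^ n * (N (g n) * N (f n))) = 2 ^ n * N (g n)"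
    proof -
      have "(1 / 2) ^ n * 4 ^ n = (2 :: real) ^ n" by (simp flip: power_mult_distrib)
      then show ?thesis using Nf[of n] by (simp add: a_def mult.assoc[symmetric])
    qed
    ultimately have "2 ^ n * N (g n) \<le> B powr p * N (g n)" by linarith
    then show ?thesis using Ng[of n] by simp
  qed
  obtain n where "B powr p < 2 ^ n" using real_arch_pow[of 2 "B powr p"] by auto
  then show False using main[of n] by simp
qed

section \<open>Compact groups\<close>

text \<open>Unimodularity of compact groups, by convolving the constant 1 with \<open>f\<close>: the
  result is the constant integral of \<open>f (- y)\<close>, while its total mass is the product of
  the masses.\<close>

lemma integral_uminus_compact:
  assumes comp: "compact (UNIV :: 'a set)" and f: "f \<in> Cc"
  shows "(\<integral>y. f (- y) \<partial>\<mu>) = (\<integral>y. f y \<partial>\<mu>)"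
proof -
  have one: "(\<lambda>x. 1) \<in> Cc" by (rule CcI[OF _ _ comp]) auto
  have pos: "(\<integral>x. 1 \<partial>\<mu>) > (0 :: real)" by (rule Cc_integral_pos[OF one]) simp
  have "(\<integral>x. 1 \<partial>\<mu>) * (\<integral>y. f y \<partial>\<mu>) = (\<integral>x. cv (\<lambda>x. 1) f x \<partial>\<mu>)"
    using integral_cv[OF one f] by simp
  also have "cv (\<lambda>x. 1) f = (\<lambda>x. \<integral>y. f (- y) \<partial>\<mu>)"
    unfolding cv_def mult_1 integral_reflect[OF f] ..
  also have "(\<integral>x. (\<integral>y. f (- y) \<partial>\<mu>) \<partial>\<mu>) = (\<integral>x. 1 \<partial>\<mu>) * (\<integral>y. f (- y) \<partial>\<mu>)" by simp
  finally show ?thesis using pos by simp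
qed

text \<open>A Urysohn function between a compact subset \<open>K\<close> and the reflected
  \<open>U\<close> has the same integral as its reflection, which lies below the indicator of
  \<open>U\<close>. Inner regularity then takes the supremum over \<open>K\<close>.\<close>

lemma emeasure_uminus_open_le:
  assumes comp: "compact (UNIV :: 'a set)" and U: "open (U :: 'a set)"
  shows "emeasure \<mu> (uminus -` U) \<le> emeasure \<mu> U"
proof -
  have op: "open (uminus -` U :: 'a set)" by (intro open_vimage U continuous_intros)
  show ?thesis unfolding inner_regular[OF op]
  proof (rule SUP_least)
    fix K :: "'a set" assume "K \<in> {K. compact K \<and> K \<subseteq> uminus -` U}"
    then have K: "compact K" "K \<subseteq> uminus -` U" by auto
    obtain \<phi> where \<phi>: "\<phi> \<in> Cc" "\<And>x. \<phi> x \<le> 1" "\<And>x. x \<in> K \<Longrightarrow> \<phi> x = 1" "\<And>x. x \<notin> uminus -` U \<Longrightarrow> \<phi> x = 0"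
      by (rule exists_Cc_one[OF K(1) op K(2)]) blast
    have "(\<lambda>y. \<phi> (- y + 0)) \<in> Cc" by (rule Cc_reflect[OF \<phi>(1)])
    then have \<phi>': "(\<lambda>y. \<phi> (- y)) \<in> Cc" by simp
    have [measurable]: "K \<in> sets borel" "U \<in> sets borel" using U compact_borel[OF K(1)] by auto
    have "emeasure \<mu> K = (\<integral>\<^sup>+x. indicator K x \<partial>\<mu>)" by simp
    also have "\<dots> \<le> (\<integral>\<^sup>+x. ennreal (\<phi> x) \<partial>\<mu>)"
      using \<phi>(3) by (intro nn_integral_mono) (auto simp: indicator_def)
    also have "\<dots> = ennreal (\<integral>x. \<phi> x \<partial>\<mu>)"
      by (intro nn_integral_eq_integral Cc_integrable \<phi>) (simp add: Cc_nonneg[OF \<phi>(1)])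
    also have "\<dots> = ennreal (\<integral>x. \<phi> (- x) \<partial>\<mu>)" by (simp add: integral_uminus_compact[OF comp \<phi>(1)])
    also have "\<dots> = (\<integral>\<^sup>+x. ennreal (\<phi> (- x)) \<partial>\<mu>)"
      by (intro nn_integral_eq_integral[symmetric] Cc_integrable \<phi>') (simp add: Cc_nonneg[OF \<phi>(1)])
    also have "\<dots> \<le> (\<integral>\<^sup>+x. indicator U x \<partial>\<mu>)"
    proof (rule nn_integral_mono)
      fix x show "ennreal (\<phi> (- x)) \<le> indicator U x"
        using \<phi>(2)[of "- x"] \<phi>(4)[of "- x"] by (cases "x \<in> U") auto
    qed
    also have "\<dots> = emeasure \<mu> U" by simp
    finally show "emeasure \<mu> K \<le> emeasure \<mu> U" .
  qed
qed

text \<open>A null set lies in open sets of arbitrarily small measure, and inversion does not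
  enlarge the measure of open sets, so its inverse is null. Left translation by \<open>- x\<close>
  then gives the map, because \<open>- (- x + y) = - y + x\<close>.\<close>

lemma AE_reflect:
  assumes comp: "compact (UNIV :: 'a set)" and P: "AE z in \<mu>. P z"
  shows "AE y in \<mu>. P (- y + x)"
proof -
  obtain N where N: "{z. \<not> P z} \<subseteq> N" "emeasure \<mu> N = 0" "N \<in> sets borel"
    using P by (auto elim: AE_E)
  have [measurable]: "(uminus :: 'a \<Rightarrow> 'a) \<in> borel \<rightarrow>\<^sub>M borel"
    by (intro borel_measurable_continuous_onI continuous_intros)
  have N': "uminus -` N \<in> sets borel" using measurable_sets[of uminus borel borel N] N by simp
  have "emeasure \<mu> (uminus -` N) \<le> 0 + e" if "0 < e" for e :: ennreal
  proof -
    have "(INF U\<in>{U. open U \<and> N \<subseteq> U}. emeasure \<mu> U) < e"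
      using outer_regular[OF N(3)] N(2) that by simp
    then obtain U where U: "open U" "N \<subseteq> U" "emeasure \<mu> U < e" by (auto simp: INF_less_iff)
    have "emeasure \<mu> (uminus -` N) \<le> emeasure \<mu> (uminus -` U)"
      using U N' open_vimage[OF U(1), of "uminus"] by (intro emeasure_mono) (auto intro!: borel_open continuous_intros)
    also have "\<dots> \<le> emeasure \<mu> U" by (rule emeasure_uminus_open_le[OF comp U(1)])
    finally show ?thesis using U by simp
  qed
  then have "emeasure \<mu> (uminus -` N) = 0" using ennreal_le_epsilon[of 0 "emeasure \<mu> (uminus -` N)"]
    by (metis add_0 dense_ge_bounded ennreal_zero_less_one le_zero_eq dense_ge)
  then have "AE z in \<mu>. z \<notin> uminus -` N" using N' by (intro AE_not_in) auto
  then have "AE z in distr \<mu> \<mu> ((+) (- x)). z \<notin> uminus -` N" unfolding distr_translate .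
  moreover have "{z \<in> space \<mu>. z \<notin> uminus -` N} \<in> sets \<mu>"
    using borel_comp[OF N'] by (simp add: Compl_eq)
  moreover have "(+) (- x) \<in> \<mu> \<rightarrow>\<^sub>M \<mu>" by (simp cong: measurable_cong_sets)
  ultimately have "AE y in \<mu>. - x + y \<notin> uminus -` N" 
    using AE_distr_iff[of "(+) (- x)" \<mu> \<mu> "\<lambda>z. z \<notin> uminus -` N"] by blast
  then show ?thesis
    by (rule AE_mp) (use N in \<open>auto simp: minus_add intro!: AE_I2\<close>)
qed

section \<open>Joint measurability of reflected functions on compact groups\<close>

lemma reflect_measurable_Cc:
  assumes comp: "compact (UNIV :: 'a set)" and f: "f \<in> Cc"
  shows "(\<lambda>z. f (- snd z + fst z)) \<in> borel_measurable (borel \<Otimes>\<^sub>M borel)"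
proof -
  have "continuous_on UNIV (\<lambda>(x, y). f (- y + x))"
    unfolding case_prod_unfold by (intro Cc_cont_on[OF f] continuous_intros)
  from borel_measurable_restrict_compact_Times[OF this comp comp] show ?thesis
    by (simp add: case_prod_unfold)
qed

text \<open>
  In a non-metrizable group the preimage of a Borel set under \<open>(x, y) \<mapsto> - y + x\<close> need not be
  product measurable, so functions are first changed on a null set.
\<close>

lemma exists_reflect_measurable_set:
  assumes comp: "compact (UNIV :: 'a set)" and A: "A \<in> sets (borel :: 'a measure)"
  shows "\<exists>B\<in>sets borel. (AE x in \<mu>. x \<in> A \<longleftrightarrow> x \<in> B) \<and>
    {z. - snd z + fst z \<in> B} \<in> sets (borel \<Otimes>\<^sub>M borel)"
proof -
  have "A \<in> sigma_sets UNIV {S. open S}" using A by (simp add: borel_def sets_measure_of)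
  then show ?thesis
  proof induction
    case (Basic U)
    then have U: "open U" by simp
    have "emeasure \<mu> U \<le> emeasure \<mu> UNIV" using U by (intro emeasure_mono) auto
    also have "\<dots> < \<infinity>" by (rule emeasure_compact_finite[OF comp])
    finally obtain K :: "nat \<Rightarrow> 'a set" where K: "\<And>n. compact (K n)" "\<And>n. K n \<subseteq> U" "AE x in \<mu>. x \<in> U \<longrightarrow> x \<in> (\<Union>n. K n)"
      by (rule open_inner_AE[OF U]) blast
    \<comment> \<open>An open set is replaced by the union of the sets where these Urysohn functions
      are positive. It lies in \<open>U\<close>, contains almost all of it, and its preimage is
      product measurable because the functions are continuous on a compact group.\<close>
    have "\<exists>\<phi>. \<phi> \<in> Cc \<and> (\<forall>x\<in>K n. \<phi> x = 1) \<and> (\<forall>x. x \<notin> U \<longrightarrow> \<phi> x = 0)" for n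
      by (rule exists_Cc_one[OF K(1) U K(2), of n]) blast
    then obtain \<phi> where \<phi>: "\<And>n. \<phi> n \<in> Cc" "\<And>n x. x \<in> K n \<Longrightarrow> \<phi> n x = 1" "\<And>n x. x \<notin> U \<Longrightarrow> \<phi> n x = 0"
      by metis
    have [measurable]: "\<phi> n \<in> borel_measurable borel" for n by (rule Cc_meas[OF \<phi>(1)])
    have [measurable]: "(\<lambda>z. \<phi> n (- snd z + fst z)) \<in> borel_measurable (borel \<Otimes>\<^sub>M borel)" for n
      by (rule reflect_measurable_Cc[OF comp \<phi>(1)])
    define B where "B = (\<Union>n. {x. 0 < \<phi> n x})"
    have "{z \<in> space (borel \<Otimes>\<^sub>M borel). \<exists>n. 0 < \<phi> n (- snd z + fst z)} \<in> sets (borel \<Otimes>\<^sub>M borel)"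
      by measurable
    moreover have "{z \<in> space (borel \<Otimes>\<^sub>M borel). \<exists>n. 0 < \<phi> n (- snd z + fst z)} = {z. - snd z + fst z \<in> B}"
      by (auto simp: B_def space_pair_measure)
    moreover have "AE x in \<mu>. x \<in> U \<longleftrightarrow> x \<in> B"
      using K(3)
    proof eventually_elim
      fix x assume x: "x \<in> U \<longrightarrow> x \<in> (\<Union>n. K n)"
      show "x \<in> U \<longleftrightarrow> x \<in> B"
      proof
        assume "x \<in> U"
        then obtain n where "x \<in> K n" using x by blast
        then have "0 < \<phi> n x" using \<phi>(2) by simp
        then show "x \<in> B" by (auto simp: B_def)
      next
        assume "x \<in> B"
        then show "x \<in> U" using \<phi>(3) by (force simp: B_def)
      qed
    qed
    moreover have "B \<in> sets borel" unfolding B_def by measurable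
    ultimately show ?case by auto
  next
    case Empty
    then show ?case by (intro bexI[of _ "{}"]) auto
  next
    case (Compl A)
    then obtain B where B: "B \<in> sets borel" "AE x in \<mu>. x \<in> A \<longleftrightarrow> x \<in> B"
      "{z. - snd z + fst z \<in> B} \<in> sets (borel \<Otimes>\<^sub>M borel)" by blast
    have "{z. - snd z + fst z \<in> UNIV - B} = space (borel \<Otimes>\<^sub>M borel) - {z. - snd z + fst z \<in> B}"
      by (auto simp: space_pair_measure)
    also have "\<dots> \<in> sets (borel \<Otimes>\<^sub>M borel)" by (rule sets.compl_sets[OF B(3)])
    finally have "{z. - snd z + fst z \<in> UNIV - B} \<in> sets (borel \<Otimes>\<^sub>M borel)" .
    moreover have "AE x in \<mu>. x \<in> UNIV - A \<longleftrightarrow> x \<in> UNIV - B" using B(2) by eventually_elim simp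
    moreover have "UNIV - B \<in> sets borel" using B(1) by auto
    ultimately show ?case by blast
  next
    case (Union A)
    then have "\<forall>i. \<exists>B. B \<in> sets borel \<and> (AE x in \<mu>. x \<in> A i \<longleftrightarrow> x \<in> B) \<and>
      {z. - snd z + fst z \<in> B} \<in> sets (borel \<Otimes>\<^sub>M borel)" by blast
    from choice[OF this] obtain B where B: "\<And>i :: nat. B i \<in> sets borel" "\<And>i. AE x in \<mu>. x \<in> A i \<longleftrightarrow> x \<in> B i"
      "\<And>i. {z. - snd z + fst z \<in> B i} \<in> sets (borel \<Otimes>\<^sub>M borel)" by blast
    have "AE x in \<mu>. \<forall>i. x \<in> A i \<longleftrightarrow> x \<in> B i" using B(2) by (simp add: AE_all_countable)
    then have "AE x in \<mu>. x \<in> (\<Union>i. A i) \<longleftrightarrow> x \<in> (\<Union>i. B i)" by eventually_elim simp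
    moreover have "{z. - snd z + fst z \<in> (\<Union>i. B i)} \<in> sets (borel \<Otimes>\<^sub>M borel)"
    proof -
      have "{z. - snd z + fst z \<in> (\<Union>i. B i)} = (\<Union>i. {z. - snd z + fst z \<in> B i})" by auto
      also have "\<dots> \<in> sets (borel \<Otimes>\<^sub>M borel)" using B(3) by auto
      finally show ?thesis .
    qed
    moreover have "(\<Union>i. B i) \<in> sets borel" using B(1) by auto
    ultimately show ?case by blast
  qed
qed

text \<open>The property passes from indicators to sums, multiples and increasing limits, as
  countably many exceptional null sets form one.\<close>

lemma exists_reflect_measurable_ennreal:
  fixes u :: "'a \<Rightarrow> ennreal"
  assumes comp: "compact (UNIV :: 'a set)" and u: "u \<in> borel_measurable borel"
  shows "\<exists>v\<in>borel_measurable borel. (AE x in \<mu>. u x = v x) \<and>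
    (\<lambda>z. v (- snd z + fst z)) \<in> borel_measurable (borel \<Otimes>\<^sub>M borel)"
  using u
proof (induction rule: borel_measurable_induct)
  case (cong f g)
  then show ?case by (simp add: fun_eq_iff[symmetric])
next
  case (set A)
  obtain B where B: "B \<in> sets borel" "AE x in \<mu>. x \<in> A \<longleftrightarrow> x \<in> B"
    "{z. - snd z + fst z \<in> B} \<in> sets (borel \<Otimes>\<^sub>M borel)"
    using exists_reflect_measurable_set[OF comp set] by blast
  have "AE x in \<mu>. (indicator A x :: ennreal) = indicator B x" using B(2) by eventually_elim (simp add: indicator_def)
  moreover have "(\<lambda>z. indicator B (- snd z + fst z) :: ennreal) = indicator {z. - snd z + fst z \<in> B}"
    by (auto simp: indicator_def)
  ultimately show ?case using B by (intro bexI[of _ "indicator B"]) auto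
next
  case (mult u c)
  then obtain v where v: "v \<in> borel_measurable borel" "AE x in \<mu>. u x = v x"
    "(\<lambda>z. v (- snd z + fst z)) \<in> borel_measurable (borel \<Otimes>\<^sub>M borel)" by blast
  have "AE x in \<mu>. c * u x = c * v x" using v(2) by eventually_elim simp
  then show ?case using v by (intro bexI[of _ "\<lambda>x. c * v x"]) auto
next
  case (add u u')
  then obtain v v' where v: "v \<in> borel_measurable borel" "AE x in \<mu>. u x = v x"
    "(\<lambda>z. v (- snd z + fst z)) \<in> borel_measurable (borel \<Otimes>\<^sub>M borel)"
    and v': "v' \<in> borel_measurable borel" "AE x in \<mu>. u' x = v' x"
    "(\<lambda>z. v' (- snd z + fst z)) \<in> borel_measurable (borel \<Otimes>\<^sub>M borel)" by blast
  have "AE x in \<mu>. u' x + u x = v' x + v x" using v(2) v'(2) by eventually_elim simp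
  then show ?case using v v' by (intro bexI[of _ "\<lambda>x. v' x + v x"]) auto
next
  case (seq U)
  then have "\<forall>i. \<exists>v. v \<in> borel_measurable borel \<and> (AE x in \<mu>. U i x = v x) \<and>
    (\<lambda>z. v (- snd z + fst z)) \<in> borel_measurable (borel \<Otimes>\<^sub>M borel)" by blast
  from choice[OF this] obtain v where v: "\<And>i. v i \<in> borel_measurable borel" "\<And>i. AE x in \<mu>. U i x = v i x"
    "\<And>i. (\<lambda>z. v i (- snd z + fst z)) \<in> borel_measurable (borel \<Otimes>\<^sub>M borel)" by blast
  have "AE x in \<mu>. \<forall>i. U i x = v i x" using v(2) by (simp add: AE_all_countable)
  then have "AE x in \<mu>. (SUP i. U i) x = (SUP i. v i x)" by eventually_elim (simp add: image_image)
  then show ?case using v by (intro bexI[of _ "\<lambda>x. SUP i. v i x"]) auto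
qed

lemma exists_reflect_measurable:
  fixes f :: "'a \<Rightarrow> complex"
  assumes comp: "compact (UNIV :: 'a set)" and [measurable]: "f \<in> borel_measurable borel"
  obtains v where "v \<in> borel_measurable borel" "AE x in \<mu>. f x = v x"
    "(\<lambda>z. v (- snd z + fst z)) \<in> borel_measurable (borel \<Otimes>\<^sub>M borel)"
proof -
  \<comment> \<open>The positive and negative parts of the real and imaginary parts;
    \<open>ennreal\<close> sends negative numbers to 0.\<close>
  define u where "u i x = ennreal ([Re (f x), - Re (f x), Im (f x), - Im (f x)] ! i)" for i :: nat and x
  have u: "u i \<in> borel_measurable borel" if "i < 4" for i
  proof -
    have "i = 0 \<or> i = 1 \<or> i = 2 \<or> i = 3" using that by auto
    then show ?thesis by (auto simp: u_def[abs_def])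
  qed
  have "\<forall>i. \<exists>v. i < 4 \<longrightarrow> v \<in> borel_measurable borel \<and> (AE x in \<mu>. u i x = v x) \<and>
    (\<lambda>z. v (- snd z + fst z)) \<in> borel_measurable (borel \<Otimes>\<^sub>M borel)"
    using exists_reflect_measurable_ennreal[OF comp u] by blast
  from choice[OF this] obtain v where v: "\<And>i. i < 4 \<Longrightarrow> v i \<in> borel_measurable borel"
    "\<And>i. i < 4 \<Longrightarrow> AE x in \<mu>. u i x = v i x"
    "\<And>i. i < 4 \<Longrightarrow> (\<lambda>z. v i (- snd z + fst z)) \<in> borel_measurable (borel \<Otimes>\<^sub>M borel)" by blast
  define w where "w x = Complex (enn2real (v 0 x) - enn2real (v 1 x)) (enn2real (v 2 x) - enn2real (v 3 x))" for x
  have w: "w x = complex_of_real (enn2real (v 0 x) - enn2real (v 1 x)) + \<i> * complex_of_real (enn2real (v 2 x) - enn2real (v 3 x))" for x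
    by (simp add: w_def complex_eq_iff)
  note [measurable] = v(1)[of 0] v(1)[of "Suc 0"] v(1)[of 2] v(1)[of 3] v(3)[of 0] v(3)[of "Suc 0"] v(3)[of 2] v(3)[of 3]
  have "w \<in> borel_measurable borel" "(\<lambda>z. w (- snd z + fst z)) \<in> borel_measurable (borel \<Otimes>\<^sub>M borel)"
    unfolding w[abs_def] by (auto intro!: borel_measurable_add borel_measurable_times borel_measurable_diff borel_measurable_of_real)
  moreover have "AE x in \<mu>. f x = w x"
    using v(2)[of 0, simplified] v(2)[of 1, simplified] v(2)[of 2, simplified] v(2)[of 3, simplified]
  proof eventually_elim
    fix x assume "u 0 x = v 0 x" "u (Suc 0) x = v (Suc 0) x" "u 2 x = v 2 x" "u 3 x = v 3 x"
    then have "v 0 x = ennreal (Re (f x))" "v 1 x = ennreal (- Re (f x))" "v 2 x = ennreal (Im (f x))" "v 3 x = ennreal (- Im (f x))"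
      by (auto simp: u_def)
    \<comment> \<open>One of the two terms is 0, according to the sign of \<open>r\<close>.\<close>
    moreover have "enn2real (ennreal r) - enn2real (ennreal (- r)) = r" for r
      by (cases "0 \<le> r") (auto simp: ennreal_neg)
    ultimately show "f x = w x" by (simp add: w_def)
  qed
  ultimately show thesis using that by blast
qed

text \<open>Jensen with weight \<open>norm (g y)\<close> of mass \<open>A\<close>, then Tonelli and
  left invariance, bound the integral by \<open>A powr p\<close> times that of
  \<open>norm (f x) powr p\<close>; Jensen with weight 1 bounds \<open>A powr p\<close> by the mass
  of \<open>g\<close>. The version \<open>v\<close> of \<open>f\<close> provides the joint
  measurability for Tonelli.\<close>

lemma convolution_compact:
  assumes comp: "compact (UNIV :: 'a set)" and p: "1 \<le> p"
    and g: "g \<in> Lp_space \<mu> p" and f: "f \<in> Lp_space \<mu> p"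
  shows "convolution_exists \<mu> g f" and "convolution \<mu> g f \<in> Lp_space \<mu> p"
    and "(\<integral>x. norm (convolution \<mu> g f x) powr p \<partial>\<mu>)
      \<le> measure \<mu> UNIV powr (p - 1) * (\<integral>x. norm (f x) powr p \<partial>\<mu>) * (\<integral>x. norm (g x) powr p \<partial>\<mu>)"
proof -
  interpret finite_measure \<mu>
    using emeasure_compact_finite[OF comp] by (intro finite_measureI) auto
  interpret P: pair_sigma_finite \<mu> \<mu> ..
  have [measurable]: "f \<in> borel_measurable borel" "g \<in> borel_measurable borel"
    using Lp_meas[OF f] Lp_meas[OF g] by auto
  obtain v where [measurable]: "v \<in> borel_measurable borel" and fv: "AE x in \<mu>. f x = v x"
    and "(\<lambda>z. v (- snd z + fst z)) \<in> borel_measurable (borel \<Otimes>\<^sub>M borel)"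
    by (rule exists_reflect_measurable[OF comp, of f]) auto
  then have [measurable]: "(\<lambda>z. v (- snd z + fst z)) \<in> borel_measurable (\<mu> \<Otimes>\<^sub>M \<mu>)"
    by (simp cong: measurable_cong_sets sets_pair_measure_cong)
  have fv': "AE y in \<mu>. f (- y + x) = v (- y + x)" for x by (rule AE_reflect[OF comp fv])
  define I where "I = (\<integral>x. norm (f x) powr p \<partial>\<mu>)"
  define J where "J = (\<integral>x. norm (g x) powr p \<partial>\<mu>)"
  define A where "A = (\<integral>x. norm (g x) \<partial>\<mu>)"
  have pos: "0 \<le> I" "0 \<le> J" "0 \<le> A" by (auto simp: I_def J_def A_def)
  have intf: "integrable \<mu> (\<lambda>x. norm (f x) powr p)" and intgp: "integrable \<mu> (\<lambda>x. norm (g x) powr p)"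
    using f g by (auto simp: Lp_space_def)
  have "integrable \<mu> (\<lambda>x. norm (g x) * 1)" and "A powr p \<le> measure \<mu> UNIV powr (p - 1) * J"
    using jensen_weighted[of "\<lambda>x. norm (g x)" \<mu> "\<lambda>x. 1" p] p intgp by (auto simp: A_def J_def)
  then have intg: "integrable \<mu> (\<lambda>x. norm (g x))" and AJ: "A powr p \<le> measure \<mu> UNIV powr (p - 1) * J" by auto
  have nnv: "(\<integral>\<^sup>+x. ennreal (norm (v x) powr p) \<partial>\<mu>) = ennreal I"
  proof -
    have "(\<integral>\<^sup>+x. ennreal (norm (v x) powr p) \<partial>\<mu>) = (\<integral>\<^sup>+x. ennreal (norm (f x) powr p) \<partial>\<mu>)"
      by (rule nn_integral_cong_AE) (use fv in eventually_elim, simp)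
    also have "\<dots> = ennreal I" unfolding I_def by (intro nn_integral_eq_integral intf) auto
    finally show ?thesis .
  qed
  define D where "D x = (\<integral>\<^sup>+y. ennreal (norm (v (- y + x)) powr p * norm (g y)) \<partial>\<mu>)" for x
  have [measurable]: "D \<in> borel_measurable \<mu>" unfolding D_def[abs_def]
    by (rule borel_measurable_nn_integral) (simp add: case_prod_unfold)
  have ID: "(\<integral>\<^sup>+x. D x \<partial>\<mu>) = ennreal (A * I)"
  proof -
    have "(\<integral>\<^sup>+x. D x \<partial>\<mu>) = (\<integral>\<^sup>+y. (\<integral>\<^sup>+x. ennreal (norm (v (- y + x)) powr p * norm (g y)) \<partial>\<mu>) \<partial>\<mu>)"
      unfolding D_def by (rule P.Fubini'[symmetric]) (simp add: case_prod_unfold)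
    also have "\<dots> = (\<integral>\<^sup>+y. ennreal I * ennreal (norm (g y)) \<partial>\<mu>)"
    proof (rule nn_integral_cong)
      fix y
      have "(\<integral>\<^sup>+x. ennreal (norm (v (- y + x)) powr p * norm (g y)) \<partial>\<mu>)
          = (\<integral>\<^sup>+x. ennreal (norm (v (- y + x)) powr p) \<partial>\<mu>) * ennreal (norm (g y))"
        by (subst nn_integral_multc[symmetric]) (auto simp: ennreal_mult)
      also have "(\<integral>\<^sup>+x. ennreal (norm (v (- y + x)) powr p) \<partial>\<mu>) = ennreal I"
        using nn_integral_translate[of "\<lambda>x. ennreal (norm (v x) powr p)" "- y"] by (simp add: nnv)
      finally show "(\<integral>\<^sup>+x. ennreal (norm (v (- y + x)) powr p * norm (g y)) \<partial>\<mu>) = ennreal I * ennreal (norm (g y))" .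
    qed
    also have "\<dots> = ennreal I * ennreal A"
      unfolding A_def by (subst nn_integral_cmult) (auto intro!: arg_cong2[where f = "(*)"] nn_integral_eq_integral intg)
    finally show ?thesis using pos by (simp add: ennreal_mult' mult.commute)
  qed
  \<comment> \<open>The iterated integral of \<open>D\<close> is finite, so \<open>D\<close> is
    finite almost everywhere, and at such \<open>x\<close> Jensen's inequality applies.\<close>
  have "AE x in \<mu>. D x \<noteq> \<infinity>" by (rule nn_integral_PInf_AE) (auto simp: ID)
  then have main: "AE x in \<mu>. integrable \<mu> (\<lambda>y. g y * f (- y + x)) \<and>
      ennreal (norm (convolution \<mu> g f x) powr p) \<le> ennreal (A powr (p - 1)) * D x"
  proof eventually_elim
    fix x assume "D x \<noteq> \<infinity>"
    then have int: "integrable \<mu> (\<lambda>y. norm (v (- y + x)) powr p * norm (g y))"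
      by (intro integrableI_bounded) (auto simp: D_def less_top)
    then have Dx: "D x = ennreal (\<integral>y. norm (v (- y + x)) powr p * norm (g y) \<partial>\<mu>)"
      unfolding D_def by (intro nn_integral_eq_integral) auto
    have int2: "integrable \<mu> (\<lambda>y. norm (v (- y + x)) * norm (g y))"
      and le: "(\<integral>y. norm (v (- y + x)) * norm (g y) \<partial>\<mu>) powr p \<le> A powr (p - 1) * (\<integral>y. norm (v (- y + x)) powr p * norm (g y) \<partial>\<mu>)"
      using jensen_weighted[of "\<lambda>y. norm (v (- y + x))" \<mu> "\<lambda>y. norm (g y)" p] p intg int by (auto simp: A_def)
    have int3: "integrable \<mu> (\<lambda>y. g y * v (- y + x))"
      using int2 by (rule Bochner_Integration.integrable_bound) (auto simp: norm_mult)
    have cong: "AE y in \<mu>. g y * v (- y + x) = g y * f (- y + x)"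
      using fv'[of x] by eventually_elim simp
    have "integrable \<mu> (\<lambda>y. g y * f (- y + x))"
      by (rule integrable_cong_AE_imp[OF int3 _ cong]) simp
    moreover have "norm (convolution \<mu> g f x) powr p \<le> A powr (p - 1) * (\<integral>y. norm (v (- y + x)) powr p * norm (g y) \<partial>\<mu>)"
    proof -
      have "convolution \<mu> g f x = (\<integral>y. g y * v (- y + x) \<partial>\<mu>)"
        unfolding convolution_def by (rule integral_cong_AE) (use cong in \<open>auto\<close>)
      then have "norm (convolution \<mu> g f x) \<le> (\<integral>y. norm (g y * v (- y + x)) \<partial>\<mu>)"
        by (simp only: integral_norm_bound)
      also have "\<dots> = (\<integral>y. norm (v (- y + x)) * norm (g y) \<partial>\<mu>)" by (simp add: norm_mult mult.commute)
      finally have "norm (convolution \<mu> g f x) powr p \<le> (\<integral>y. norm (v (- y + x)) * norm (g y) \<partial>\<mu>) powr p"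
        using p by (intro powr_mono2) auto
      then show ?thesis using le by simp
    qed
    ultimately show "integrable \<mu> (\<lambda>y. g y * f (- y + x)) \<and>
      ennreal (norm (convolution \<mu> g f x) powr p) \<le> ennreal (A powr (p - 1)) * D x"
      by (auto simp: Dx ennreal_mult'[symmetric] intro!: ennreal_leI)
  qed
  then show "convolution_exists \<mu> g f" unfolding convolution_exists_def by eventually_elim simp
  \<comment> \<open>Since \<open>fv'\<close> holds for every \<open>x\<close>, replacing
    \<open>f\<close> by \<open>v\<close> leaves the convolution unchanged at each point; its
    measurability follows from that of the kernel with \<open>v\<close>.\<close>
  have conv_eq: "convolution \<mu> g f x = (\<integral>y. g y * v (- y + x) \<partial>\<mu>)" for x
    unfolding convolution_def by (rule integral_cong_AE) (use fv'[of x] in \<open>auto\<close>)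
  have [measurable]: "convolution \<mu> g f \<in> borel_measurable \<mu>"
    unfolding conv_eq[abs_def] by (rule borel_measurable_lebesgue_integral) (simp add: case_prod_unfold)
  have nn: "(\<integral>\<^sup>+x. ennreal (norm (convolution \<mu> g f x) powr p) \<partial>\<mu>) \<le> ennreal (A powr p * I)"
  proof -
    have "(\<integral>\<^sup>+x. ennreal (norm (convolution \<mu> g f x) powr p) \<partial>\<mu>) \<le> (\<integral>\<^sup>+x. ennreal (A powr (p - 1)) * D x \<partial>\<mu>)"
      by (rule nn_integral_mono_AE) (use main in eventually_elim, simp)
    also have "\<dots> = ennreal (A powr (p - 1)) * ennreal (A * I)" by (simp add: nn_integral_cmult ID)
    also have "\<dots> = ennreal (A powr (p - 1) * A * I)" by (simp add: ennreal_mult'[symmetric] mult.assoc)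
    also have "A powr (p - 1) * A = A powr p"
      using pos p powr_add[of A "p - 1" 1] by (cases "A = 0") auto
    finally show ?thesis .
  qed
  have int: "integrable \<mu> (\<lambda>x. norm (convolution \<mu> g f x) powr p)"
    using nn by (intro integrableI_bounded) (auto intro: le_less_trans)
  then show "convolution \<mu> g f \<in> Lp_space \<mu> p" by (simp add: Lp_space_def)
  have "ennreal (\<integral>x. norm (convolution \<mu> g f x) powr p \<partial>\<mu>) \<le> ennreal (A powr p * I)"
    using nn int by (subst nn_integral_eq_integral[symmetric]) auto
  then have "(\<integral>x. norm (convolution \<mu> g f x) powr p \<partial>\<mu>) \<le> A powr p * I" using pos by simp
  also have "\<dots> \<le> measure \<mu> UNIV powr (p - 1) * J * I" using AJ pos by (intro mult_right_mono)
  finally show "(\<integral>x. norm (convolution \<mu> g f x) powr p \<partial>\<mu>)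
      \<le> measure \<mu> UNIV powr (p - 1) * (\<integral>x. norm (f x) powr p \<partial>\<mu>) * (\<integral>x. norm (g x) powr p \<partial>\<mu>)"
    by (simp add: I_def J_def mult_ac)
qed

lemma LpT_norm_le_compact:
  assumes comp: "compact (UNIV :: 'a set)" and p: "1 \<le> p" and f: "f \<in> Lp_space \<mu> p"
  shows "LpT_norm \<mu> p f \<le> ennreal ((measure \<mu> UNIV powr (p - 1)) powr (1 / p)) * Lp_norm \<mu> p f"
proof -
  have "LpT_norm \<mu> p f \<le> ennreal ((measure \<mu> UNIV powr (p - 1) * (\<integral>x. norm (f x) powr p \<partial>\<mu>)) powr (1 / p))"
    using p by (intro LpT_norm_leI convolution_compact[OF comp p _ f]) auto
  also have "\<dots> = ennreal ((measure \<mu> UNIV powr (p - 1)) powr (1 / p)) * Lp_norm \<mu> p f"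
    by (simp add: Lp_norm_eq f powr_mult ennreal_mult)
  finally show ?thesis .
qed

lemma LpT_eq_Lp_compact:
  assumes comp: "compact (UNIV :: 'a set)" and p: "1 \<le> p"
  shows "Lp_space \<mu> p = LpT_space \<mu> p"
proof (intro equalityI subsetI)
  fix f assume f: "f \<in> Lp_space \<mu> p"
  have "LpT_norm \<mu> p f < \<infinity>"
    using LpT_norm_le_compact[OF comp p f] f by (auto simp: Lp_norm_eq ennreal_mult[symmetric] intro: le_less_trans)
  then show "f \<in> LpT_space \<mu> p" using f convolution_compact(1)[OF comp p _ f] by (simp add: LpT_space_def)
qed (simp add: LpT_space_def)

end

section \<open>The relations between the four assertions\<close>

lemma equivalent_norms_LpT_iff:
  "equivalent_norms_on (LpT_space \<mu> p) (Lp_norm \<mu> p) (LpT_sum_norm \<mu> p)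
    \<longleftrightarrow> (\<exists>K>0. \<forall>f\<in>LpT_space \<mu> p. LpT_norm \<mu> p f \<le> ennreal K * Lp_norm \<mu> p f)" (is "?L \<longleftrightarrow> ?R")
proof
  assume ?L
  then obtain c C where C: "0 < C" "\<And>f. f \<in> LpT_space \<mu> p \<Longrightarrow> LpT_sum_norm \<mu> p f \<le> ennreal C * Lp_norm \<mu> p f"
    unfolding equivalent_norms_on_def by blast
  have "LpT_norm \<mu> p f \<le> ennreal C * Lp_norm \<mu> p f" if "f \<in> LpT_space \<mu> p" for f
    using C(2)[OF that] by (rule order_trans[rotated]) (simp add: LpT_sum_norm_def)
  then show ?R using C(1) by blast
next
  assume ?R
  then obtain K where K: "0 < K" "\<And>f. f \<in> LpT_space \<mu> p \<Longrightarrow> LpT_norm \<mu> p f \<le> ennreal K * Lp_norm \<mu> p f" by blast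
  \<comment> \<open>The sum norm contains \<open>Lp_norm\<close> as a summand, so the lower constant
    is 1; the upper one adds \<open>K\<close> to it.\<close>
  have "ennreal 1 * Lp_norm \<mu> p f \<le> LpT_sum_norm \<mu> p f \<and> LpT_sum_norm \<mu> p f \<le> ennreal (1 + K) * Lp_norm \<mu> p f"
    if "f \<in> LpT_space \<mu> p" for f
    using K(2)[OF that] K(1) by (simp add: LpT_sum_norm_def distrib_right add_left_mono)
  then show ?L unfolding equivalent_norms_on_def using K(1) by (intro exI[of _ 1] exI[of _ "1 + K"]) auto
qed

theorem theorem2p4:
  fixes \<mu> :: "'a::{topological_group_add, t2_space} measure" and p :: real
  assumes "locally_compact_space (euclidean :: 'a topology)"
    and "left_haar_measure \<mu>"
    and "1 < p"
  defines "i \<equiv> Lp_space \<mu> p = LpT_space \<mu> p"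
    and "ii \<equiv> equivalent_norms_on (LpT_space \<mu> p) (Lp_norm \<mu> p) (LpT_sum_norm \<mu> p)"
    and "iii \<equiv> \<exists>K>0. \<forall>f\<in>LpT_space \<mu> p. LpT_norm \<mu> p f \<le> ennreal K * Lp_norm \<mu> p f"
    and "iv \<equiv> compact (UNIV :: 'a set)"
  shows "(i \<longleftrightarrow> iv) \<and> (ii \<longleftrightarrow> iii) \<and> (iv \<longrightarrow> iii) \<and>
    (unimodular TYPE('a) \<and> p \<le> 2 \<longrightarrow> (i \<longleftrightarrow> ii) \<and> (ii \<longleftrightarrow> iii) \<and> (iii \<longleftrightarrow> iv))"
proof -
  interpret left_haar_space \<mu> by unfold_locales fact+
  have 1: "i \<longleftrightarrow> iv"
    unfolding i_def iv_def using Lp_eq_LpT_imp_compact[OF assms(3)] LpT_eq_Lp_compact[of p] assms(3) by auto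
  have 2: "ii \<longleftrightarrow> iii" unfolding ii_def iii_def by (rule equivalent_norms_LpT_iff)
  have 3: "iii" if iv
  proof -
    have comp: "compact (UNIV :: 'a set)" using that by (simp add: iv_def)
    \<comment> \<open>The constant \<mu>(G)^((p-1)/p) has to be positive, so the total mass must be
      both nonzero and finite.\<close>
    have "UNIV \<noteq> ({} :: 'a set)" by simp
    then have "0 < emeasure \<mu> UNIV" by (intro emeasure_open_pos) auto
    then have "0 < measure \<mu> UNIV"
      using emeasure_compact_finite[OF comp] by (simp add: measure_def enn2real_positive_iff)
    then have "0 < (measure \<mu> UNIV powr (p - 1)) powr (1 / p)" by simp
    moreover have "LpT_norm \<mu> p f \<le> ennreal ((measure \<mu> UNIV powr (p - 1)) powr (1 / p)) * Lp_norm \<mu> p f"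
      if "f \<in> LpT_space \<mu> p" for f
      using that assms(3) by (intro LpT_norm_le_compact[OF comp]) (auto simp: LpT_space_def)
    ultimately show iii unfolding iii_def by blast
  qed
  \<comment> \<open>The norm bound restricts to test functions in \<open>Cc\<close>, for which it
    fails on a non-compact group; together with the preceding implications this links all four
    assertions.\<close>
  have 4: "iv" if iii
    using that LpT_norm_bounded_imp_compact[OF assms(3)] unfolding iii_def iv_def by blast
  show ?thesis using 1 2 3 4 by blast
qed

end
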